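(* Let $\Sigma$ be a monoidal signature and let $n\xrightarrow{\iota}G\xleftarrow{\omega}m$ and $n\xrightarrow{\iota'}G'\xleftarrow{\omega'}m$ be arrows of $\mathsf{DiscCospan}(\mathbf{Hyp}_\Sigma)$. If for every morphism of preordered cartesian bicategories $\mathcal M:\mathsf{DiscCospan}(\mathbf{Hyp}_\Sigma)\to\mathsf{Span}^{\leq}(\mathbf{Set})$ we have $\mathcal M(n\xrightarrow{\iota}G\xleftarrow{\omega}m)\le\mathcal M(n\xrightarrow{\iota'}G'\xleftarrow{\omega'}m)$, then $(n\xrightarrow{\iota}G\xleftarrow{\omega}m)\le(n\xrightarrow{\iota'}G'\xleftarrow{\omega'}m)$ in $\mathsf{DiscCospan}(\mathbf{Hyp}_\Sigma)$.
   Context: A monoidal signature $\Sigma$ is a set of symbols each with an arity $n$ and coarity $m$ ($\Sigma_{n,m}$ those with arity $n$, coarity $m$). A $\Sigma$-hypergraph $G$ is a set $G_V$ of vertices and, for each $R\in\Sigma_{n,m}$, a set $G_R$ with functions $s_R:G_R\to(G_V)^n$, $t_R:G_R\to(G_V)^m$; a morphism $f:G\to G'$ is $f_V:G_V\to G'_V$ and $f_R:G_R\to G'_R$ commuting with sources and targets. $\mathbf{Hyp}_\Sigma$ is the category of finite $\Sigma$-hypergraphs. For a finitely cocomplete $\mathcal C$, $\mathsf{Cospan}^{\leq}(\mathcal C)$ has arrows $X\to Y$ the isomorphism classes of cospans $X\to A\leftarrow Y$, composition by pushout, tensor by coproduct, and $(X\to A\leftarrow Y)\le(X\to B\leftarrow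 Y)$ iff there is an arrow $B\to A$ commuting with the legs. $\mathsf{DiscCospan}(\mathbf{Hyp}_\Sigma)$ is its full subcategory on finite ordinals $n$ (discrete hypergraphs with vertices $\{0,\dots,n-1\}$, no edges); monoid on $X$: $X+X\xrightarrow{[\mathrm{id},\mathrm{id}]}X\xleftarrow{\mathrm{id}}X$ and $0\to X\xleftarrow{\mathrm{id}}X$; comonoid: the reversed cospans. For a finitely complete $\mathcal C$, $\mathsf{Span}^{\leq}(\mathcal C)$ has arrows $X\to Y$ the isomorphism classes of spans $X\leftarrow A\to Y$, composition by pullback, tensor by product, and $(X\leftarrow A\to Y)\le(X\leftarrow B\to Y)$ iff there is an arrow $A\to B$ commuting with the legs; comonoid on $X$: $X\xleftarrow{\mathrm{id}}X\xrightarrow{\langle\mathrm{id},\mathrm{id}\rangle}X\times X$ and $X\xleftarrow{\mathrm{id}}X\to1$; monoid: the reversed spans. A preordered cartesian bicategory is a symmetric monoidal category $(\mathcal B,\oplus,I)$ with preordered hom-sets (composition, $\oplus$ monotone), each object $X$ carrying a monoid $\mu_X,\eta_X$ and comonoid $\delta_X,\varepsilon_X$ forming a special commutative Frobenius bimonoid (in diagrammatic order: $(\delta_X\oplus\mathrm{id});(\mathrm{id}\oplus\mu_X)=\mu_X;\delta_X=(\mathrm{id}\oplus\delta_X);(\mu_X\oplus\mathrm{id})$, $\delta_X;\mu_X=\mathrm{id}_X$), with $\mathrm{id}_X\le\varepsilon_X;\eta_X$, $\eta_X;\varepsilon_X\le\mathrm{id}_I$, $\mathrm{id}_X\le\delta_X;\mu_X$,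 $\mu_X;\delta_X\le\mathrm{id}_{X\oplus X}$, and every arrow $R:X\to Y$ satisfying $R;\delta_Y\le\delta_X;(R\oplus R)$ and $R;\varepsilon_Y\le\varepsilon_X$. A morphism of preordered cartesian bicategories is a monoidal functor preserving the preorders and the monoids and comonoids. *)

theory Defs
  imports "HOL-Library.FuncSet"
begin

section \<open>Categories\<close>

text \<open>Composition is written in diagrammatic order throughout.\<close>

record ('o, 'a) cat =
  Obj :: "'o set"
  Arr :: "'a set"
  Dom :: "'a \<Rightarrow> 'o"
  Cod :: "'a \<Rightarrow> 'o"
  ident :: "'o \<Rightarrow> 'a"
  seq :: "'a \<Rightarrow> 'a \<Rightarrow> 'a"  (infixl "\<Zsemi>\<index>" 70)

definition Hom :: "('o, 'a, 'z) cat_scheme \<Rightarrow> 'o \<Rightarrow> 'o \<Rightarrow> 'a set" where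
  "Hom C X Y = {f \<in> Arr C. Dom C f = X \<and> Cod C f = Y}"

locale category =
  fixes C :: "('o, 'a, 'z) cat_scheme" (structure)
  assumes Dom_Obj: "f \<in> Arr C \<Longrightarrow> Dom C f \<in> Obj C"
    and Cod_Obj: "f \<in> Arr C \<Longrightarrow> Cod C f \<in> Obj C"
    and ident_Hom: "X \<in> Obj C \<Longrightarrow> ident C X \<in> Hom C X X"
    and seq_Hom: "f \<in> Hom C X Y \<Longrightarrow> g \<in> Hom C Y Z \<Longrightarrow> f \<Zsemi> g \<in> Hom C X Z"
    and ident_left: "f \<in> Hom C X Y \<Longrightarrow> ident C X \<Zsemi> f = f"
    and ident_right: "f \<in> Hom C X Y \<Longrightarrow> f \<Zsemi> ident C Y = f"
    and seq_assoc: "f \<in> Hom C W X \<Longrightarrow> g \<in> Hom C X Y \<Longrightarrow> h \<in> Hom C Y Z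
      \<Longrightarrow> (f \<Zsemi> g) \<Zsemi> h = f \<Zsemi> (g \<Zsemi> h)"

definition inverse_arrows :: "('o, 'a, 'z) cat_scheme \<Rightarrow> 'a \<Rightarrow> 'a \<Rightarrow> bool" where
  "inverse_arrows C f g \<longleftrightarrow>
     f \<in> Arr C \<and> g \<in> Hom C (Cod C f) (Dom C f) \<and>
     f \<Zsemi>\<^bsub>C\<^esub> g = ident C (Dom C f) \<and> g \<Zsemi>\<^bsub>C\<^esub> f = ident C (Cod C f)"

definition iso_arrow :: "('o, 'a, 'z) cat_scheme \<Rightarrow> 'a \<Rightarrow> bool" where
  "iso_arrow C f \<longleftrightarrow> (\<exists>g. inverse_arrows C f g)"

definition inverse_of :: "('o, 'a, 'z) cat_scheme \<Rightarrow> 'a \<Rightarrow> 'a" where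
  "inverse_of C f = (THE g. inverse_arrows C f g)"

definition op_cat :: "('o, 'a) cat \<Rightarrow> ('o, 'a) cat" where
  "op_cat C = C\<lparr>Dom := Cod C, Cod := Dom C, seq := (\<lambda>f g. g \<Zsemi>\<^bsub>C\<^esub> f)\<rparr>"

definition full_subcat :: "('o, 'a, 'z) cat_scheme \<Rightarrow> 'o set \<Rightarrow> ('o, 'a, 'z) cat_scheme" where
  "full_subcat C S =
     C\<lparr>Obj := Obj C \<inter> S, Arr := {f \<in> Arr C. Dom C f \<in> S \<and> Cod C f \<in> S}\<rparr>"

definition is_pushout ::
  "('o, 'a, 'z) cat_scheme \<Rightarrow> 'a \<Rightarrow> 'a \<Rightarrow> 'a \<Rightarrow> 'a \<Rightarrow> bool" where
  "is_pushout C f g p q \<longleftrightarrow>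
     f \<in> Arr C \<and> g \<in> Arr C \<and> p \<in> Arr C \<and> q \<in> Arr C \<and>
     Dom C f = Dom C g \<and> Cod C f = Dom C p \<and> Cod C g = Dom C q \<and> Cod C p = Cod C q \<and>
     f \<Zsemi>\<^bsub>C\<^esub> p = g \<Zsemi>\<^bsub>C\<^esub> q \<and>
     (\<forall>Z \<in> Obj C. \<forall>p' \<in> Hom C (Cod C f) Z. \<forall>q' \<in> Hom C (Cod C g) Z.
        f \<Zsemi>\<^bsub>C\<^esub> p' = g \<Zsemi>\<^bsub>C\<^esub> q' \<longrightarrow>
        (\<exists>!h. h \<in> Hom C (Cod C p) Z \<and> p \<Zsemi>\<^bsub>C\<^esub> h = p' \<and> q \<Zsemi>\<^bsub>C\<^esub> h = q'))"


section \<open>Preordered cartesian bicategories\<close>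

text \<open>
  The associator goes from \<open>(X \<oplus> Y) \<oplus> Z\<close> to \<open>X \<oplus> (Y \<oplus> Z)\<close>, the unitors from
  \<open>I \<oplus> X\<close> and \<open>X \<oplus> I\<close> to \<open>X\<close>.
  The tensor is written \<open>\<oplus>\<close> on objects and \<open>\<otimes>\<close> on arrows.
\<close>

record ('o, 'a) pcb = "('o, 'a) cat" +
  tunit :: "'o"
  tobj :: "'o \<Rightarrow> 'o \<Rightarrow> 'o"  (infixl "\<oplus>\<index>" 80)
  tarr :: "'a \<Rightarrow> 'a \<Rightarrow> 'a"  (infixl "\<otimes>\<index>" 80)
  associator :: "'o \<Rightarrow> 'o \<Rightarrow> 'o \<Rightarrow> 'a"
  lunitor :: "'o \<Rightarrow> 'a"
  runitor :: "'o \<Rightarrow> 'a"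
  symmetry :: "'o \<Rightarrow> 'o \<Rightarrow> 'a"
  leq :: "'a \<Rightarrow> 'a \<Rightarrow> bool"  (infix "\<lesssim>\<index>" 50)
  mult :: "'o \<Rightarrow> 'a"  ("\<mu>\<index>")
  unit_of :: "'o \<Rightarrow> 'a"  ("\<eta>\<index>")
  comult :: "'o \<Rightarrow> 'a"  ("\<delta>\<index>")
  counit :: "'o \<Rightarrow> 'a"  ("\<epsilon>\<index>")

locale symmetric_monoidal_category = category B
  for B :: "('o, 'a, 'z) pcb_scheme" (structure) +
  assumes tunit_Obj: "tunit B \<in> Obj B"
    and tobj_Obj: "X \<in> Obj B \<Longrightarrow> Y \<in> Obj B \<Longrightarrow> X \<oplus> Y \<in> Obj B"
    and tarr_Hom: "f \<in> Hom B X X' \<Longrightarrow> g \<in> Hom B Y Y' \<Longrightarrow> f \<otimes> g \<in> Hom B (X \<oplus> Y) (X' \<oplus> Y')"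
    and tarr_ident: "X \<in> Obj B \<Longrightarrow> Y \<in> Obj B \<Longrightarrow>
      ident B X \<otimes> ident B Y = ident B (X \<oplus> Y)"
    and tarr_seq: "f \<in> Hom B X X' \<Longrightarrow> f' \<in> Hom B X' X'' \<Longrightarrow>
      g \<in> Hom B Y Y' \<Longrightarrow> g' \<in> Hom B Y' Y'' \<Longrightarrow>
      (f \<Zsemi> f') \<otimes> (g \<Zsemi> g') = (f \<otimes> g) \<Zsemi> (f' \<otimes> g')"
    and associator_Hom: "X \<in> Obj B \<Longrightarrow> Y \<in> Obj B \<Longrightarrow> Z \<in> Obj B \<Longrightarrow>
      associator B X Y Z \<in> Hom B ((X \<oplus> Y) \<oplus> Z) (X \<oplus> (Y \<oplus> Z))"
    and associator_iso: "X \<in> Obj B \<Longrightarrow> Y \<in> Obj B \<Longrightarrow> Z \<in> Obj B \<Longrightarrow>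
      iso_arrow B (associator B X Y Z)"
    and associator_natural: "f \<in> Hom B X X' \<Longrightarrow> g \<in> Hom B Y Y' \<Longrightarrow> h \<in> Hom B Z Z' \<Longrightarrow>
      ((f \<otimes> g) \<otimes> h) \<Zsemi> associator B X' Y' Z' = associator B X Y Z \<Zsemi> (f \<otimes> (g \<otimes> h))"
    and lunitor_Hom: "X \<in> Obj B \<Longrightarrow> lunitor B X \<in> Hom B (tunit B \<oplus> X) X"
    and lunitor_iso: "X \<in> Obj B \<Longrightarrow> iso_arrow B (lunitor B X)"
    and lunitor_natural: "f \<in> Hom B X Y \<Longrightarrow>
      (ident B (tunit B) \<otimes> f) \<Zsemi> lunitor B Y = lunitor B X \<Zsemi> f"
    and runitor_Hom: "X \<in> Obj B \<Longrightarrow> runitor B X \<in> Hom B (X \<oplus> tunit B) X"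
    and runitor_iso: "X \<in> Obj B \<Longrightarrow> iso_arrow B (runitor B X)"
    and runitor_natural: "f \<in> Hom B X Y \<Longrightarrow>
      (f \<otimes> ident B (tunit B)) \<Zsemi> runitor B Y = runitor B X \<Zsemi> f"
    and symmetry_Hom: "X \<in> Obj B \<Longrightarrow> Y \<in> Obj B \<Longrightarrow> symmetry B X Y \<in> Hom B (X \<oplus> Y) (Y \<oplus> X)"
    and symmetry_natural: "f \<in> Hom B X X' \<Longrightarrow> g \<in> Hom B Y Y' \<Longrightarrow>
      (f \<otimes> g) \<Zsemi> symmetry B X' Y' = symmetry B X Y \<Zsemi> (g \<otimes> f)"
    and symmetry_involutive: "X \<in> Obj B \<Longrightarrow> Y \<in> Obj B \<Longrightarrow>
      symmetry B X Y \<Zsemi> symmetry B Y X = ident B (X \<oplus> Y)"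
    and pentagon: "W \<in> Obj B \<Longrightarrow> X \<in> Obj B \<Longrightarrow> Y \<in> Obj B \<Longrightarrow> Z \<in> Obj B \<Longrightarrow>
      associator B (W \<oplus> X) Y Z \<Zsemi> associator B W X (Y \<oplus> Z) =
      (associator B W X Y \<otimes> ident B Z) \<Zsemi> associator B W (X \<oplus> Y) Z \<Zsemi>
        (ident B W \<otimes> associator B X Y Z)"
    and triangle: "X \<in> Obj B \<Longrightarrow> Y \<in> Obj B \<Longrightarrow>
      associator B X (tunit B) Y \<Zsemi> (ident B X \<otimes> lunitor B Y) = runitor B X \<otimes> ident B Y"
    and hexagon: "X \<in> Obj B \<Longrightarrow> Y \<in> Obj B \<Longrightarrow> Z \<in> Obj B \<Longrightarrow>
      associator B X Y Z \<Zsemi> symmetry B X (Y \<oplus> Z) \<Zsemi> associator B Y Z X =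
      (symmetry B X Y \<otimes> ident B Z) \<Zsemi> associator B Y X Z \<Zsemi> (ident B Y \<otimes> symmetry B X Z)"

locale preordered_cartesian_bicategory = symmetric_monoidal_category B
  for B :: "('o, 'a, 'z) pcb_scheme" (structure) +
  assumes leq_refl: "f \<in> Hom B X Y \<Longrightarrow> f \<lesssim> f"
    and leq_trans: "f \<in> Hom B X Y \<Longrightarrow> g \<in> Hom B X Y \<Longrightarrow> h \<in> Hom B X Y \<Longrightarrow>
      f \<lesssim> g \<Longrightarrow> g \<lesssim> h \<Longrightarrow> f \<lesssim> h"
    and seq_mono: "f \<in> Hom B X Y \<Longrightarrow> f' \<in> Hom B X Y \<Longrightarrow> g \<in> Hom B Y Z \<Longrightarrow> g' \<in> Hom B Y Z \<Longrightarrow>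
      f \<lesssim> f' \<Longrightarrow> g \<lesssim> g' \<Longrightarrow> f \<Zsemi> g \<lesssim> f' \<Zsemi> g'"
    and tarr_mono: "f \<in> Hom B X Y \<Longrightarrow> f' \<in> Hom B X Y \<Longrightarrow> g \<in> Hom B W Z \<Longrightarrow> g' \<in> Hom B W Z \<Longrightarrow>
      f \<lesssim> f' \<Longrightarrow> g \<lesssim> g' \<Longrightarrow> f \<otimes> g \<lesssim> f' \<otimes> g'"
    and mult_Hom: "X \<in> Obj B \<Longrightarrow> \<mu> X \<in> Hom B (X \<oplus> X) X"
    and unit_Hom: "X \<in> Obj B \<Longrightarrow> \<eta> X \<in> Hom B (tunit B) X"
    and comult_Hom: "X \<in> Obj B \<Longrightarrow> \<delta> X \<in> Hom B X (X \<oplus> X)"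
    and counit_Hom: "X \<in> Obj B \<Longrightarrow> \<epsilon> X \<in> Hom B X (tunit B)"
    and mult_assoc: "X \<in> Obj B \<Longrightarrow>
      (\<mu> X \<otimes> ident B X) \<Zsemi> \<mu> X = associator B X X X \<Zsemi> (ident B X \<otimes> \<mu> X) \<Zsemi> \<mu> X"
    and mult_unit_left: "X \<in> Obj B \<Longrightarrow> (\<eta> X \<otimes> ident B X) \<Zsemi> \<mu> X = lunitor B X"
    and mult_unit_right: "X \<in> Obj B \<Longrightarrow> (ident B X \<otimes> \<eta> X) \<Zsemi> \<mu> X = runitor B X"
    and mult_comm: "X \<in> Obj B \<Longrightarrow> symmetry B X X \<Zsemi> \<mu> X = \<mu> X"
    and comult_assoc: "X \<in> Obj B \<Longrightarrow>
      \<delta> X \<Zsemi> (\<delta> X \<otimes> ident B X) \<Zsemi> associator B X X X = \<delta> X \<Zsemi> (ident B X \<otimes> \<delta> X)"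
    and comult_counit_left: "X \<in> Obj B \<Longrightarrow>
      \<delta> X \<Zsemi> (\<epsilon> X \<otimes> ident B X) \<Zsemi> lunitor B X = ident B X"
    and comult_counit_right: "X \<in> Obj B \<Longrightarrow>
      \<delta> X \<Zsemi> (ident B X \<otimes> \<epsilon> X) \<Zsemi> runitor B X = ident B X"
    and comult_comm: "X \<in> Obj B \<Longrightarrow> \<delta> X \<Zsemi> symmetry B X X = \<delta> X"
    and frobenius_left: "X \<in> Obj B \<Longrightarrow>
      (\<delta> X \<otimes> ident B X) \<Zsemi> associator B X X X \<Zsemi> (ident B X \<otimes> \<mu> X) = \<mu> X \<Zsemi> \<delta> X"
    and frobenius_right: "X \<in> Obj B \<Longrightarrow>
      (ident B X \<otimes> \<delta> X) \<Zsemi> inverse_of B (associator B X X X) \<Zsemi> (\<mu> X \<otimes> ident B X)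
        = \<mu> X \<Zsemi> \<delta> X"
    and special: "X \<in> Obj B \<Longrightarrow> \<delta> X \<Zsemi> \<mu> X = ident B X"
    and counit_unit: "X \<in> Obj B \<Longrightarrow> ident B X \<lesssim> \<epsilon> X \<Zsemi> \<eta> X"
    and unit_counit: "X \<in> Obj B \<Longrightarrow> \<eta> X \<Zsemi> \<epsilon> X \<lesssim> ident B (tunit B)"
    and comult_mult: "X \<in> Obj B \<Longrightarrow> ident B X \<lesssim> \<delta> X \<Zsemi> \<mu> X"
    and mult_comult: "X \<in> Obj B \<Longrightarrow> \<mu> X \<Zsemi> \<delta> X \<lesssim> ident B (X \<oplus> X)"
    and comult_lax: "R \<in> Hom B X Y \<Longrightarrow> R \<Zsemi> \<delta> Y \<lesssim> \<delta> X \<Zsemi> (R \<otimes> R)"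
    and counit_lax: "R \<in> Hom B X Y \<Longrightarrow> R \<Zsemi> \<epsilon> Y \<lesssim> \<epsilon> X"

text \<open>
  Monoidal functors are strong: \<open>\<phi> X Y\<close> and \<open>\<phi>0\<close> are the coherence isomorphisms
  \<open>F X \<oplus> F Y \<rightarrow> F (X \<oplus> Y)\<close> and \<open>I \<rightarrow> F I\<close>, and monoids and comonoids are preserved
  up to them.
\<close>

locale pcb_morphism =
  B: preordered_cartesian_bicategory B + C: preordered_cartesian_bicategory C
  for B :: "('o, 'a, 'y) pcb_scheme"
    and C :: "('p, 'b, 'z) pcb_scheme"
    and Fo :: "'o \<Rightarrow> 'p" and F :: "'a \<Rightarrow> 'b"
    and \<phi> :: "'o \<Rightarrow> 'o \<Rightarrow> 'b" and \<phi>0 :: "'b" +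
  assumes functor_Obj: "X \<in> Obj B \<Longrightarrow> Fo X \<in> Obj C"
    and functor_Hom: "f \<in> Hom B X Y \<Longrightarrow> F f \<in> Hom C (Fo X) (Fo Y)"
    and functor_ident: "X \<in> Obj B \<Longrightarrow> F (ident B X) = ident C (Fo X)"
    and functor_seq: "f \<in> Hom B X Y \<Longrightarrow> g \<in> Hom B Y Z \<Longrightarrow> F (f \<Zsemi>\<^bsub>B\<^esub> g) = F f \<Zsemi>\<^bsub>C\<^esub> F g"
    and tensor_coh_Hom: "X \<in> Obj B \<Longrightarrow> Y \<in> Obj B \<Longrightarrow>
      \<phi> X Y \<in> Hom C (Fo X \<oplus>\<^bsub>C\<^esub> Fo Y) (Fo (X \<oplus>\<^bsub>B\<^esub> Y))"
    and tensor_coh_iso: "X \<in> Obj B \<Longrightarrow> Y \<in> Obj B \<Longrightarrow> iso_arrow C (\<phi> X Y)"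
    and tensor_coh_natural: "f \<in> Hom B X X' \<Longrightarrow> g \<in> Hom B Y Y' \<Longrightarrow>
      (F f \<otimes>\<^bsub>C\<^esub> F g) \<Zsemi>\<^bsub>C\<^esub> \<phi> X' Y' = \<phi> X Y \<Zsemi>\<^bsub>C\<^esub> F (f \<otimes>\<^bsub>B\<^esub> g)"
    and unit_coh_Hom: "\<phi>0 \<in> Hom C (tunit C) (Fo (tunit B))"
    and unit_coh_iso: "iso_arrow C \<phi>0"
    and coh_associator: "X \<in> Obj B \<Longrightarrow> Y \<in> Obj B \<Longrightarrow> Z \<in> Obj B \<Longrightarrow>
      (\<phi> X Y \<otimes>\<^bsub>C\<^esub> ident C (Fo Z)) \<Zsemi>\<^bsub>C\<^esub> \<phi> (X \<oplus>\<^bsub>B\<^esub> Y) Z \<Zsemi>\<^bsub>C\<^esub> F (associator B X Y Z) =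
      associator C (Fo X) (Fo Y) (Fo Z) \<Zsemi>\<^bsub>C\<^esub> (ident C (Fo X) \<otimes>\<^bsub>C\<^esub> \<phi> Y Z) \<Zsemi>\<^bsub>C\<^esub>
        \<phi> X (Y \<oplus>\<^bsub>B\<^esub> Z)"
    and coh_lunitor: "X \<in> Obj B \<Longrightarrow>
      (\<phi>0 \<otimes>\<^bsub>C\<^esub> ident C (Fo X)) \<Zsemi>\<^bsub>C\<^esub> \<phi> (tunit B) X \<Zsemi>\<^bsub>C\<^esub> F (lunitor B X) = lunitor C (Fo X)"
    and coh_runitor: "X \<in> Obj B \<Longrightarrow>
      (ident C (Fo X) \<otimes>\<^bsub>C\<^esub> \<phi>0) \<Zsemi>\<^bsub>C\<^esub> \<phi> X (tunit B) \<Zsemi>\<^bsub>C\<^esub> F (runitor B X) = runitor C (Fo X)"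
    and functor_mono: "f \<in> Hom B X Y \<Longrightarrow> g \<in> Hom B X Y \<Longrightarrow> f \<lesssim>\<^bsub>B\<^esub> g \<Longrightarrow> F f \<lesssim>\<^bsub>C\<^esub> F g"
    and functor_mult: "X \<in> Obj B \<Longrightarrow> \<phi> X X \<Zsemi>\<^bsub>C\<^esub> F (\<mu>\<^bsub>B\<^esub> X) = \<mu>\<^bsub>C\<^esub> (Fo X)"
    and functor_unit: "X \<in> Obj B \<Longrightarrow> \<phi>0 \<Zsemi>\<^bsub>C\<^esub> F (\<eta>\<^bsub>B\<^esub> X) = \<eta>\<^bsub>C\<^esub> (Fo X)"
    and functor_comult: "X \<in> Obj B \<Longrightarrow> F (\<delta>\<^bsub>B\<^esub> X) = \<delta>\<^bsub>C\<^esub> (Fo X) \<Zsemi>\<^bsub>C\<^esub> \<phi> X X"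
    and functor_counit: "X \<in> Obj B \<Longrightarrow> F (\<epsilon>\<^bsub>B\<^esub> X) = \<epsilon>\<^bsub>C\<^esub> (Fo X) \<Zsemi>\<^bsub>C\<^esub> \<phi>0"


section \<open>Cospans and spans\<close>

text \<open>
  A choice of a neutral object and, for any two objects, of an object with two legs. It is
  used for chosen finite coproducts (initial object, injections) as well as for chosen
  finite products (terminal object, projections); as arrows of the opposite category,
  projections are injections.
\<close>

record ('o, 'a) chosen_bin =
  neutral :: 'o
  bin :: "'o \<Rightarrow> 'o \<Rightarrow> 'o"
  leg1 :: "'o \<Rightarrow> 'o \<Rightarrow> 'a"
  leg2 :: "'o \<Rightarrow> 'o \<Rightarrow> 'a"

definition initial_arrow :: "('o, 'a) cat \<Rightarrow> ('o, 'a) chosen_bin \<Rightarrow> 'o \<Rightarrow> 'a" where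
  "initial_arrow C P X = (THE f. f \<in> Hom C (neutral P) X)"

definition copair :: "('o, 'a) cat \<Rightarrow> ('o, 'a) chosen_bin \<Rightarrow> 'a \<Rightarrow> 'a \<Rightarrow> 'a" where
  "copair C P f g = (THE h. h \<in> Hom C (bin P (Dom C f) (Dom C g)) (Cod C f) \<and>
     leg1 P (Dom C f) (Dom C g) \<Zsemi>\<^bsub>C\<^esub> h = f \<and> leg2 P (Dom C f) (Dom C g) \<Zsemi>\<^bsub>C\<^esub> h = g)"

definition arrow_sum :: "('o, 'a) cat \<Rightarrow> ('o, 'a) chosen_bin \<Rightarrow> 'a \<Rightarrow> 'a \<Rightarrow> 'a" where
  "arrow_sum C P f g = copair C P
     (f \<Zsemi>\<^bsub>C\<^esub> leg1 P (Cod C f) (Cod C g)) (g \<Zsemi>\<^bsub>C\<^esub> leg2 P (Cod C f) (Cod C g))"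

definition cospan :: "('o, 'a) cat \<Rightarrow> 'a \<times> 'a \<Rightarrow> bool" where
  "cospan C c \<longleftrightarrow> fst c \<in> Arr C \<and> snd c \<in> Arr C \<and> Cod C (fst c) = Cod C (snd c)"

text \<open>The isomorphism class of the cospan with legs \<open>i\<close> and \<open>j\<close>.\<close>

definition cospan_class :: "('o, 'a) cat \<Rightarrow> 'a \<Rightarrow> 'a \<Rightarrow> ('a \<times> 'a) set" where
  "cospan_class C i j =
     {(i \<Zsemi>\<^bsub>C\<^esub> h, j \<Zsemi>\<^bsub>C\<^esub> h) | h. iso_arrow C h \<and> Dom C h = Cod C i}"

text \<open>
  \<open>Cospan\<^sup>\<le>(C)\<close> for a category with finite colimits whose chosen finite coproducts are \<open>P\<close>.
  The composite collects the cospans obtained from all representatives and all pushouts;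
  this set is closed under isomorphism, hence a single isomorphism class.
\<close>

definition cospan_pcb ::
  "('o, 'a) cat \<Rightarrow> ('o, 'a) chosen_bin \<Rightarrow> ('o, ('a \<times> 'a) set) pcb" where
  "cospan_pcb C P = \<lparr>
     Obj = Obj C,
     Arr = {cospan_class C i j | i j. cospan C (i, j)},
     Dom = (\<lambda>S. the_elem ((\<lambda>c. Dom C (fst c)) ` S)),
     Cod = (\<lambda>S. the_elem ((\<lambda>c. Dom C (snd c)) ` S)),
     ident = (\<lambda>X. cospan_class C (ident C X) (ident C X)),
     seq = (\<lambda>S T. {(i \<Zsemi>\<^bsub>C\<^esub> p, j' \<Zsemi>\<^bsub>C\<^esub> q) | i j i' j' p q.
        (i, j) \<in> S \<and> (i', j') \<in> T \<and> is_pushout C j i' p q}),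
     tunit = neutral P,
     tobj = bin P,
     tarr = (\<lambda>S T. \<Union>{cospan_class C (arrow_sum C P i i') (arrow_sum C P j j') | i j i' j'.
        (i, j) \<in> S \<and> (i', j') \<in> T}),
     associator = (\<lambda>X Y Z. cospan_class C
        (copair C P
          (copair C P (leg1 P X (bin P Y Z)) (leg1 P Y Z \<Zsemi>\<^bsub>C\<^esub> leg2 P X (bin P Y Z)))
          (leg2 P Y Z \<Zsemi>\<^bsub>C\<^esub> leg2 P X (bin P Y Z)))
        (ident C (bin P X (bin P Y Z)))),
     lunitor = (\<lambda>X. cospan_class C (copair C P (initial_arrow C P X) (ident C X)) (ident C X)),
     runitor = (\<lambda>X. cospan_class C (copair C P (ident C X) (initial_arrow C P X)) (ident C X)),
     symmetry = (\<lambda>X Y. cospan_class C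
        (copair C P (leg2 P Y X) (leg1 P Y X)) (ident C (bin P Y X))),
     leq = (\<lambda>S T. \<exists>(i, j) \<in> S. \<exists>(i', j') \<in> T. \<exists>h \<in> Hom C (Cod C i') (Cod C i).
        i' \<Zsemi>\<^bsub>C\<^esub> h = i \<and> j' \<Zsemi>\<^bsub>C\<^esub> h = j),
     mult = (\<lambda>X. cospan_class C (copair C P (ident C X) (ident C X)) (ident C X)),
     unit_of = (\<lambda>X. cospan_class C (initial_arrow C P X) (ident C X)),
     comult = (\<lambda>X. cospan_class C (ident C X) (copair C P (ident C X) (ident C X))),
     counit = (\<lambda>X. cospan_class C (ident C X) (initial_arrow C P X)) \<rparr>"

text \<open>
  A span \<open>X \<leftarrow> A \<rightarrow> Y\<close> in \<open>C\<close> is a cospan \<open>X \<rightarrow> A \<leftarrow> Y\<close> in the opposite category.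
  Pullbacks and products in \<open>C\<close> are pushouts and coproducts in the opposite, and the
  direction of the ordering of spans is the one of cospans in the opposite.
\<close>

definition span_pcb ::
  "('o, 'a) cat \<Rightarrow> ('o, 'a) chosen_bin \<Rightarrow> ('o, ('a \<times> 'a) set) pcb" where
  "span_pcb C P = cospan_pcb (op_cat C) P"


section \<open>The category of sets\<close>

text \<open>
  Sets are the subsets of the type \<open>'u elem\<close>, which is closed under pairing, so that
  these sets have finite products and, as subsets of products, pullbacks.
  The type \<open>'u\<close> is arbitrary.
\<close>

datatype 'u elem = Atom 'u | Star | Tup "'u elem" "'u elem"

fun tup_fst :: "'u elem \<Rightarrow> 'u elem" where
  "tup_fst (Tup x y) = x" | "tup_fst z = z"

fun tup_snd :: "'u elem \<Rightarrow> 'u elem" where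
  "tup_snd (Tup x y) = y" | "tup_snd z = z"

record 'u set_map =
  sdom :: "'u elem set"
  sfun :: "'u elem \<Rightarrow> 'u elem"
  scod :: "'u elem set"

definition Set_cat :: "('u elem set, 'u set_map) cat" where
  "Set_cat = \<lparr>
     Obj = UNIV,
     Arr = {f. sfun f \<in> sdom f \<rightarrow>\<^sub>E scod f},
     Dom = sdom,
     Cod = scod,
     ident = (\<lambda>X. \<lparr>sdom = X, sfun = (\<lambda>x\<in>X. x), scod = X\<rparr>),
     seq = (\<lambda>f g. \<lparr>sdom = sdom f, sfun = compose (sdom f) (sfun g) (sfun f), scod = scod g\<rparr>) \<rparr>"

definition set_prod :: "'u elem set \<Rightarrow> 'u elem set \<Rightarrow> 'u elem set" where
  "set_prod X Y = {Tup x y | x y. x \<in> X \<and> y \<in> Y}"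

definition Set_products :: "('u elem set, 'u set_map) chosen_bin" where
  "Set_products = \<lparr>
     neutral = {Star},
     bin = set_prod,
     leg1 = (\<lambda>X Y. \<lparr>sdom = set_prod X Y, sfun = restrict tup_fst (set_prod X Y), scod = X\<rparr>),
     leg2 = (\<lambda>X Y. \<lparr>sdom = set_prod X Y, sfun = restrict tup_snd (set_prod X Y), scod = Y\<rparr>) \<rparr>"

definition Span_Set :: "('u elem set, ('u set_map \<times> 'u set_map) set) pcb" where
  "Span_Set = span_pcb Set_cat Set_products"


section \<open>Hypergraphs\<close>

record 's signature =
  syms :: "'s set"
  arity :: "'s \<Rightarrow> nat"
  coarity :: "'s \<Rightarrow> nat"

text \<open>
  Vertices and edges of finite hypergraphs are natural numbers, so that every finite
  hypergraph is represented up to isomorphism and the finite ordinals are objects.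
\<close>

record 's hypergraph =
  verts :: "nat set"
  edges :: "'s \<Rightarrow> nat set"
  source :: "'s \<Rightarrow> nat \<Rightarrow> nat list"
  target :: "'s \<Rightarrow> nat \<Rightarrow> nat list"

definition finite_hypergraph :: "'s signature \<Rightarrow> 's hypergraph \<Rightarrow> bool" where
  "finite_hypergraph \<Sigma> G \<longleftrightarrow>
     finite (verts G) \<and> finite (SIGMA R : syms \<Sigma>. edges G R) \<and>
     (\<forall>R \<in> syms \<Sigma>. \<forall>e \<in> edges G R.
        length (source G R e) = arity \<Sigma> R \<and> set (source G R e) \<subseteq> verts G \<and>
        length (target G R e) = coarity \<Sigma> R \<and> set (target G R e) \<subseteq> verts G)"

record 's hyp_map =
  hdom :: "'s hypergraph"
  vmap :: "nat \<Rightarrow> nat"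
  emap :: "'s \<Rightarrow> nat \<Rightarrow> nat"
  hcod :: "'s hypergraph"

definition hypergraph_morphism :: "'s signature \<Rightarrow> 's hyp_map \<Rightarrow> bool" where
  "hypergraph_morphism \<Sigma> f \<longleftrightarrow>
     vmap f \<in> verts (hdom f) \<rightarrow>\<^sub>E verts (hcod f) \<and>
     emap f \<in> (\<Pi>\<^sub>E R \<in> syms \<Sigma>. edges (hdom f) R \<rightarrow>\<^sub>E edges (hcod f) R) \<and>
     (\<forall>R \<in> syms \<Sigma>. \<forall>e \<in> edges (hdom f) R.
        source (hcod f) R (emap f R e) = map (vmap f) (source (hdom f) R e) \<and>
        target (hcod f) R (emap f R e) = map (vmap f) (target (hdom f) R e))"

definition Hyp :: "'s signature \<Rightarrow> ('s hypergraph, 's hyp_map) cat" where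
  "Hyp \<Sigma> = \<lparr>
     Obj = {G. finite_hypergraph \<Sigma> G},
     Arr = {f. finite_hypergraph \<Sigma> (hdom f) \<and> finite_hypergraph \<Sigma> (hcod f) \<and>
               hypergraph_morphism \<Sigma> f},
     Dom = hdom,
     Cod = hcod,
     ident = (\<lambda>G. \<lparr>hdom = G, vmap = (\<lambda>v\<in>verts G. v),
        emap = (\<lambda>R\<in>syms \<Sigma>. \<lambda>e\<in>edges G R. e), hcod = G\<rparr>),
     seq = (\<lambda>f g. \<lparr>hdom = hdom f, vmap = compose (verts (hdom f)) (vmap g) (vmap f),
        emap = (\<lambda>R\<in>syms \<Sigma>. compose (edges (hdom f) R) (emap g R) (emap f R)),
        hcod = hcod g\<rparr>) \<rparr>"

definition discrete :: "nat \<Rightarrow> 's hypergraph" where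
  "discrete n = \<lparr>verts = {..<n}, edges = (\<lambda>R. {}),
     source = (\<lambda>R e. []), target = (\<lambda>R e. [])\<rparr>"

text \<open>
  Coproducts of hypergraphs: the vertices and edges of the second summand are shifted above
  those of the first. In particular the coproduct of \<open>discrete n\<close> and \<open>discrete m\<close> is
  \<open>discrete (n + m)\<close>.
\<close>

definition bound :: "nat set \<Rightarrow> nat" where
  "bound A = (LEAST k. A \<subseteq> {..<k})"

definition hyp_sum :: "'s hypergraph \<Rightarrow> 's hypergraph \<Rightarrow> 's hypergraph" where
  "hyp_sum G H = \<lparr>
     verts = verts G \<union> (+) (bound (verts G)) ` verts H,
     edges = (\<lambda>R. edges G R \<union> (+) (bound (edges G R)) ` edges H R),
     source = (\<lambda>R e. if e < bound (edges G R) then source G R e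
        else map ((+) (bound (verts G))) (source H R (e - bound (edges G R)))),
     target = (\<lambda>R e. if e < bound (edges G R) then target G R e
        else map ((+) (bound (verts G))) (target H R (e - bound (edges G R)))) \<rparr>"

definition Hyp_coproducts :: "'s signature \<Rightarrow> ('s hypergraph, 's hyp_map) chosen_bin" where
  "Hyp_coproducts \<Sigma> = \<lparr>
     neutral = discrete 0,
     bin = hyp_sum,
     leg1 = (\<lambda>G H. \<lparr>hdom = G, vmap = (\<lambda>v\<in>verts G. v),
        emap = (\<lambda>R\<in>syms \<Sigma>. \<lambda>e\<in>edges G R. e), hcod = hyp_sum G H\<rparr>),
     leg2 = (\<lambda>G H. \<lparr>hdom = H, vmap = (\<lambda>v\<in>verts H. bound (verts G) + v),
        emap = (\<lambda>R\<in>syms \<Sigma>. \<lambda>e\<in>edges H R. bound (edges G R) + e), hcod = hyp_sum G H\<rparr>) \<rparr>"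

definition DiscCospan_Hyp ::
  "'s signature \<Rightarrow> ('s hypergraph, ('s hyp_map \<times> 's hyp_map) set) pcb" where
  "DiscCospan_Hyp \<Sigma> =
     full_subcat (cospan_pcb (Hyp \<Sigma>) (Hyp_coproducts \<Sigma>)) (range discrete)"

end

theory Submission
  imports Defs
begin

text \<open>
  For a hypergraph \<open>G\<close>, the contravariant functor \<open>Hom(-, G)\<close> turns finite colimits of
  hypergraphs into limits of sets. Applied to the legs of cospans it is therefore a morphism of
  preordered cartesian bicategories into spans of sets. If \<open>G\<close> is the apex of
  \<open>n \<rightarrow> G \<leftarrow> m\<close>, the assumed inequality of spans is a map \<open>Hom(G, G) \<rightarrow> Hom(G', G)\<close>
  compatible with restriction along the legs; as in the Yoneda lemma, the image of the identity
  is an arrow \<open>G' \<rightarrow> G\<close> under \<open>n\<close> and \<open>m\<close>.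

  Since spans are cospans in the opposite category, both bicategories are instances of cospans
  in a category with finite colimits.
\<close>

section \<open>Categories\<close>

text \<open>Objects of \<open>Span_Set\<close> are subsets of \<open>'u elem\<close> with
  \<open>'u\<close> arbitrary, so a hom-set of hypergraphs is not literally an object. Finiteness
  makes room: there are only finitely many morphisms between two finite hypergraphs, even over an
  infinite signature, and \<open>'u elem\<close> contains infinitely many trees built from
  \<open>Star\<close> and \<open>Tup\<close>. Each hom-set is therefore replaced by an injective
  copy inside \<open>'u elem\<close>. Coproducts are sent to products only up to isomorphism. The
  comparison arrows supply the coherence data of the morphism, and their inverses enter where
  comonoids are compared. The morphism is built on cospans between all finite hypergraphs, since the
  argument needs pushouts and coproducts of arbitrary apexes; only the feet are restricted to
  discrete hypergraphs at the end. That restriction changes neither hom-sets nor the order, and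
  finite ordinals are closed under the chosen coproduct on the nose.\<close>

context category
begin

lemma HomD:
  assumes "f \<in> Hom C X Y"
  shows "f \<in> Arr C" "Dom C f = X" "Cod C f = Y" "X \<in> Obj C" "Y \<in> Obj C"
  using assms Dom_Obj[of f] Cod_Obj[of f] by (auto simp: Hom_def)

lemma seq_arr [simp]:
  assumes "f \<in> Arr C" "g \<in> Arr C" "Cod C f = Dom C g"
  shows "f \<Zsemi> g \<in> Arr C" "Dom C (f \<Zsemi> g) = Dom C f" "Cod C (f \<Zsemi> g) = Cod C g"
  using seq_Hom[of f "Dom C f" "Cod C f" g "Cod C g"] assms by (auto simp: Hom_def)

lemma ident_arr [simp]:
  assumes "X \<in> Obj C"
  shows "ident C X \<in> Arr C" "Dom C (ident C X) = X" "Cod C (ident C X) = X"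
  using ident_Hom[OF assms] by (auto simp: Hom_def)

lemma obj [simp]: "f \<in> Arr C \<Longrightarrow> Dom C f \<in> Obj C" "f \<in> Arr C \<Longrightarrow> Cod C f \<in> Obj C"
  by (auto simp: Dom_Obj Cod_Obj)

lemma ident_seq [simp]:
  "f \<in> Arr C \<Longrightarrow> Dom C f = X \<Longrightarrow> ident C X \<Zsemi> f = f"
  "f \<in> Arr C \<Longrightarrow> Cod C f = X \<Longrightarrow> f \<Zsemi> ident C X = f"
  using ident_left[of f X] ident_right[of f _ X] by (auto simp: Hom_def)

lemma seq_assoc' [simp]:
  "f \<in> Arr C \<Longrightarrow> g \<in> Arr C \<Longrightarrow> h \<in> Arr C \<Longrightarrow> Cod C f = Dom C g \<Longrightarrow> Cod C g = Dom C h \<Longrightarrow>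
   (f \<Zsemi> g) \<Zsemi> h = f \<Zsemi> (g \<Zsemi> h)"
  using seq_assoc[of f _ _ g _ h] by (auto simp: Hom_def)

section \<open>Isomorphisms and their inverses\<close>

lemma iso_arrowE:
  assumes "iso_arrow C f"
  obtains g where "f \<in> Arr C" "g \<in> Arr C" "Dom C g = Cod C f" "Cod C g = Dom C f"
    "f \<Zsemi> g = ident C (Dom C f)" "g \<Zsemi> f = ident C (Cod C f)"
  using assms by (auto simp: iso_arrow_def inverse_arrows_def Hom_def)

lemma iso_arrowI:
  assumes "f \<in> Arr C" "g \<in> Arr C" "Dom C g = Cod C f" "Cod C g = Dom C f"
    "f \<Zsemi> g = ident C (Dom C f)" "g \<Zsemi> f = ident C (Cod C f)"
  shows "iso_arrow C f"
  using assms by (auto simp: iso_arrow_def inverse_arrows_def Hom_def)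

lemma iso_Arr: "iso_arrow C f \<Longrightarrow> f \<in> Arr C"
  by (auto simp: iso_arrow_def inverse_arrows_def)

lemma iso_ident: "X \<in> Obj C \<Longrightarrow> iso_arrow C (ident C X)"
  by (rule iso_arrowI[of _ "ident C X"]) auto

text \<open>The simplifier brackets composites to the right, where \<open>f \<Zsemi> g\<close> is no
  longer a subterm of \<open>f \<Zsemi> (g \<Zsemi> h)\<close>. This form makes an equation for
  \<open>f \<Zsemi> g\<close> usable inside longer composites.\<close>

lemma seq_cancel_left:
  assumes "f \<Zsemi> g = k" "f \<in> Arr C" "g \<in> Arr C" "h \<in> Arr C" "Cod C f = Dom C g" "Cod C g = Dom C h"
  shows "f \<Zsemi> (g \<Zsemi> h) = k \<Zsemi> h"
  using assms seq_assoc' by metis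

lemma iso_seq:
  assumes "iso_arrow C f" "iso_arrow C g" "Cod C f = Dom C g"
  shows "iso_arrow C (f \<Zsemi> g)"
proof -
  obtain f' where f: "f \<in> Arr C" "f' \<in> Arr C" "Dom C f' = Cod C f" "Cod C f' = Dom C f"
    "f \<Zsemi> f' = ident C (Dom C f)" "f' \<Zsemi> f = ident C (Cod C f)"
    using assms(1) by (rule iso_arrowE)
  obtain g' where g: "g \<in> Arr C" "g' \<in> Arr C" "Dom C g' = Cod C g" "Cod C g' = Dom C g"
    "g \<Zsemi> g' = ident C (Dom C g)" "g' \<Zsemi> g = ident C (Cod C g)"
    using assms(2) by (rule iso_arrowE)
  show ?thesis
    by (rule iso_arrowI[of _ "g' \<Zsemi> f'"])
      (use f g assms(3) in \<open>auto simp: seq_cancel_left[OF g(5)] seq_cancel_left[OF f(6)]\<close>)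
qed

lemma iso_epi:
  assumes "iso_arrow C f" "f \<Zsemi> g = f \<Zsemi> h" "g \<in> Arr C" "h \<in> Arr C" "Dom C g = Cod C f" "Dom C h = Cod C f"
  shows "g = h"
proof -
  obtain f' where f: "f \<in> Arr C" "f' \<in> Arr C" "Dom C f' = Cod C f" "Cod C f' = Dom C f"
    "f' \<Zsemi> f = ident C (Cod C f)"
    using assms(1) by (rule iso_arrowE)
  have "f' \<Zsemi> (f \<Zsemi> g) = g" "f' \<Zsemi> (f \<Zsemi> h) = h"
    using f assms(1,3-) by (auto simp: seq_cancel_left[OF f(5)])
  with assms(2) show ?thesis by metis
qed

text \<open>Two-sided inverses are unique, so the definite description denotes. It is needed because
  the right Frobenius law refers to the inverse of the associator through
  \<open>inverse_of\<close>.\<close>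

lemma inverse_of_eq:
  assumes "inverse_arrows C f g"
  shows "inverse_of C f = g"
  unfolding inverse_of_def
proof (rule the_equality)
  show "inverse_arrows C f g" by fact
next
  fix h assume h: "inverse_arrows C f h"
  have g: "f \<in> Arr C" "g \<in> Arr C" "Dom C g = Cod C f" "Cod C g = Dom C f" "f \<Zsemi> g = ident C (Dom C f)"
    using assms by (auto simp: inverse_arrows_def Hom_def)
  have h: "h \<in> Arr C" "Dom C h = Cod C f" "Cod C h = Dom C f" "h \<Zsemi> f = ident C (Cod C f)"
    using h by (auto simp: inverse_arrows_def Hom_def)
  have "h = h \<Zsemi> (f \<Zsemi> g)" using g h by simp
  also have "\<dots> = g" using g(1-4) h by (simp add: seq_cancel_left[OF h(4)])
  finally show "h = g" .
qed

subsection \<open>Pushouts\<close>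

lemma is_pushoutD:
  assumes "is_pushout C f g p q"
  shows "f \<in> Arr C" "g \<in> Arr C" "p \<in> Arr C" "q \<in> Arr C" "Dom C g = Dom C f" "Dom C p = Cod C f"
    "Dom C q = Cod C g" "Cod C q = Cod C p" "f \<Zsemi> p = g \<Zsemi> q"
  using assms by (auto simp: is_pushout_def)

lemma is_pushout_ex1:
  assumes "is_pushout C f g p q" "Z \<in> Obj C" "p' \<in> Hom C (Cod C f) Z" "q' \<in> Hom C (Cod C g) Z"
    "f \<Zsemi> p' = g \<Zsemi> q'"
  shows "\<exists>!h. h \<in> Hom C (Cod C p) Z \<and> p \<Zsemi> h = p' \<and> q \<Zsemi> h = q'"
proof -
  have "\<forall>Z \<in> Obj C. \<forall>p' \<in> Hom C (Cod C f) Z. \<forall>q' \<in> Hom C (Cod C g) Z. f \<Zsemi> p' = g \<Zsemi> q' \<longrightarrow>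
     (\<exists>!h. h \<in> Hom C (Cod C p) Z \<and> p \<Zsemi> h = p' \<and> q \<Zsemi> h = q')"
    using assms(1) unfolding is_pushout_def by (elim conjE)
  from this[rule_format, OF assms(2-5)] show ?thesis .
qed

lemma is_pushout_ex:
  assumes "is_pushout C f g p q" "p' \<in> Arr C" "q' \<in> Arr C" "Dom C p' = Cod C f" "Dom C q' = Cod C g"
    "Cod C p' = Cod C q'" "f \<Zsemi> p' = g \<Zsemi> q'"
  obtains h where "h \<in> Arr C" "Dom C h = Cod C p" "Cod C h = Cod C p'" "p \<Zsemi> h = p'" "q \<Zsemi> h = q'"
proof -
  have "p' \<in> Hom C (Cod C f) (Cod C p')" "q' \<in> Hom C (Cod C g) (Cod C p')" "Cod C p' \<in> Obj C"
    using assms by (auto simp: Hom_def)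
  then have "\<exists>h. h \<in> Hom C (Cod C p) (Cod C p') \<and> p \<Zsemi> h = p' \<and> q \<Zsemi> h = q'"
    using is_pushout_ex1[OF assms(1) _ _ _ assms(7)] by (blast dest: ex1_implies_ex)
  then show ?thesis using that by (auto simp: Hom_def)
qed

text \<open>The legs of a pushout are jointly epi: both arrows mediate the same cocone.\<close>

lemma is_pushout_eq:
  assumes "is_pushout C f g p q" "h \<in> Arr C" "k \<in> Arr C" "Dom C h = Cod C p" "Dom C k = Cod C p"
    "p \<Zsemi> h = p \<Zsemi> k" "q \<Zsemi> h = q \<Zsemi> k"
  shows "h = k"
proof -
  note po = is_pushoutD[OF assms(1)]
  \<comment> \<open>Equality of the composites forces the codomains to agree, so \<open>h\<close>
    and \<open>k\<close> compete for the same universal property.\<close>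
  have "Cod C (p \<Zsemi> h) = Cod C h" "Cod C (p \<Zsemi> k) = Cod C k" using assms(2-5) po by simp_all
  with assms(6) have ck: "Cod C k = Cod C h" by simp
  have *: "p \<Zsemi> h \<in> Hom C (Cod C f) (Cod C h)" "q \<Zsemi> h \<in> Hom C (Cod C g) (Cod C h)" "Cod C h \<in> Obj C"
    using assms(2-5) po by (auto simp: Hom_def)
  have "f \<Zsemi> (p \<Zsemi> h) = g \<Zsemi> (q \<Zsemi> h)"
    using assms(2-5) po by (simp add: seq_cancel_left[OF po(9)])
  with * have "\<exists>!k. k \<in> Hom C (Cod C p) (Cod C h) \<and> p \<Zsemi> k = p \<Zsemi> h \<and> q \<Zsemi> k = q \<Zsemi> h"
    by (intro is_pushout_ex1[OF assms(1)]) auto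
  moreover have "h \<in> Hom C (Cod C p) (Cod C h)" "k \<in> Hom C (Cod C p) (Cod C h)"
    using assms(2-5) ck by (auto simp: Hom_def)
  ultimately show ?thesis by (elim ex1E) (metis assms(6,7))
qed

text \<open>Existence and uniqueness of the mediating arrow become separate obligations, phrased
  with \<open>Arr\<close>, \<open>Dom\<close> and \<open>Cod\<close>. In this form the typing
  conditions are ones that the simplifier can compute.\<close>

lemma is_pushoutI:
  assumes "f \<in> Arr C" "g \<in> Arr C" "p \<in> Arr C" "q \<in> Arr C" "Dom C g = Dom C f" "Dom C p = Cod C f"
    "Dom C q = Cod C g" "Cod C q = Cod C p" "f \<Zsemi> p = g \<Zsemi> q"
    and ex: "\<And>p' q'. p' \<in> Arr C \<Longrightarrow> q' \<in> Arr C \<Longrightarrow> Dom C p' = Cod C f \<Longrightarrow> Dom C q' = Cod C g \<Longrightarrow>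
      Cod C p' = Cod C q' \<Longrightarrow> f \<Zsemi> p' = g \<Zsemi> q' \<Longrightarrow>
      \<exists>h. h \<in> Arr C \<and> Dom C h = Cod C p \<and> Cod C h = Cod C q' \<and> p \<Zsemi> h = p' \<and> q \<Zsemi> h = q'"
    and eq: "\<And>h k. h \<in> Arr C \<Longrightarrow> k \<in> Arr C \<Longrightarrow> Dom C h = Cod C p \<Longrightarrow> Dom C k = Cod C p \<Longrightarrow> Cod C k = Cod C h \<Longrightarrow>
      p \<Zsemi> h = p \<Zsemi> k \<Longrightarrow> q \<Zsemi> h = q \<Zsemi> k \<Longrightarrow> h = k"
  shows "is_pushout C f g p q"
proof -
  have "\<exists>!h. h \<in> Hom C (Cod C p) Z \<and> p \<Zsemi> h = p' \<and> q \<Zsemi> h = q'"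
    if *: "Z \<in> Obj C" "p' \<in> Hom C (Cod C f) Z" "q' \<in> Hom C (Cod C g) Z" "f \<Zsemi> p' = g \<Zsemi> q'" for Z p' q'
  proof -
    from * have "\<exists>h. h \<in> Arr C \<and> Dom C h = Cod C p \<and> Cod C h = Cod C q' \<and> p \<Zsemi> h = p' \<and> q \<Zsemi> h = q'"
      by (intro ex) (auto simp: Hom_def)
    then obtain h where h: "h \<in> Hom C (Cod C p) Z \<and> p \<Zsemi> h = p' \<and> q \<Zsemi> h = q'"
      using * by (auto simp: Hom_def)
    show ?thesis
    proof (rule ex1I[of _ h])
      fix k assume k: "k \<in> Hom C (Cod C p) Z \<and> p \<Zsemi> k = p' \<and> q \<Zsemi> k = q'"
      with h have "p \<Zsemi> k = p \<Zsemi> h" "q \<Zsemi> k = q \<Zsemi> h" by simp_all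
      moreover have "k \<in> Arr C" "h \<in> Arr C" "Dom C k = Cod C p" "Dom C h = Cod C p" "Cod C h = Cod C k"
        using h k by (auto simp: Hom_def)
      ultimately show "k = h" by - (rule eq; assumption)
    qed fact
  qed
  with assms(1-9) show ?thesis unfolding is_pushout_def by auto
qed

lemma is_pushout_sym:
  assumes "is_pushout C f g p q"
  shows "is_pushout C g f q p"
proof -
  note a = is_pushoutD[OF assms]
  show ?thesis
  proof (rule is_pushoutI)
    fix p' q' assume *: "p' \<in> Arr C" "q' \<in> Arr C" "Dom C p' = Cod C g" "Dom C q' = Cod C f"
      "Cod C p' = Cod C q'" "g \<Zsemi> p' = f \<Zsemi> q'"
    obtain u where "u \<in> Arr C" "Dom C u = Cod C p" "Cod C u = Cod C q'" "p \<Zsemi> u = q'" "q \<Zsemi> u = p'"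
      by (rule is_pushout_ex[OF assms, of q' p']) (use * in auto)
    then show "\<exists>h. h \<in> Arr C \<and> Dom C h = Cod C q \<and> Cod C h = Cod C q' \<and> q \<Zsemi> h = p' \<and> p \<Zsemi> h = q'"
      using a by auto
  next
    fix u u' assume "u \<in> Arr C" "u' \<in> Arr C" "Dom C u = Cod C q" "Dom C u' = Cod C q"
      "q \<Zsemi> u = q \<Zsemi> u'" "p \<Zsemi> u = p \<Zsemi> u'"
    then show "u = u'" using a by (rule_tac is_pushout_eq[OF assms]) auto
  qed (use a in auto)
qed

lemma is_pushout_unique:
  assumes "is_pushout C f g p q" "is_pushout C f g p' q'"
  obtains k where "iso_arrow C k" "Dom C k = Cod C p" "Cod C k = Cod C p'" "p \<Zsemi> k = p'" "q \<Zsemi> k = q'"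
proof -
  note a = is_pushoutD[OF assms(1)] and b = is_pushoutD[OF assms(2)]
  obtain k where k: "k \<in> Arr C" "Dom C k = Cod C p" "Cod C k = Cod C p'" "p \<Zsemi> k = p'" "q \<Zsemi> k = q'"
    using b by (rule_tac is_pushout_ex[OF assms(1), of p' q']) auto
  obtain l where l: "l \<in> Arr C" "Dom C l = Cod C p'" "Cod C l = Cod C p" "p' \<Zsemi> l = p" "q' \<Zsemi> l = q"
    using a by (rule_tac is_pushout_ex[OF assms(2), of p q]) auto
  have "k \<Zsemi> l = ident C (Cod C p)"
    by (rule is_pushout_eq[OF assms(1)]) (use a b k l in \<open>auto simp: seq_cancel_left[OF k(4)] seq_cancel_left[OF k(5)]\<close>)
  moreover have "l \<Zsemi> k = ident C (Cod C p')"
    by (rule is_pushout_eq[OF assms(2)]) (use a b k l in \<open>auto simp: seq_cancel_left[OF l(4)] seq_cancel_left[OF l(5)]\<close>)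
  ultimately have "iso_arrow C k" using k l by (intro iso_arrowI[of k l]) auto
  then show ?thesis using k that by blast
qed

lemma is_pushout_seq_iso:
  assumes "is_pushout C f g p q" "iso_arrow C k" "Dom C k = Cod C p"
  shows "is_pushout C f g (p \<Zsemi> k) (q \<Zsemi> k)"
proof -
  note a = is_pushoutD[OF assms(1)]
  obtain l where k: "k \<in> Arr C" and l: "l \<in> Arr C" "Dom C l = Cod C k" "Cod C l = Dom C k"
    "k \<Zsemi> l = ident C (Dom C k)" "l \<Zsemi> k = ident C (Cod C k)"
    using assms(2) by (rule iso_arrowE)
  show ?thesis
  proof (rule is_pushoutI)
    fix p' q' assume *: "p' \<in> Arr C" "q' \<in> Arr C" "Dom C p' = Cod C f" "Dom C q' = Cod C g"
      "Cod C p' = Cod C q'" "f \<Zsemi> p' = g \<Zsemi> q'"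
    then obtain h where "h \<in> Arr C" "Dom C h = Cod C p" "Cod C h = Cod C p'" "p \<Zsemi> h = p'" "q \<Zsemi> h = q'"
      by (rule is_pushout_ex[OF assms(1)])
    then show "\<exists>h. h \<in> Arr C \<and> Dom C h = Cod C (p \<Zsemi> k) \<and> Cod C h = Cod C q' \<and> (p \<Zsemi> k) \<Zsemi> h = p' \<and> (q \<Zsemi> k) \<Zsemi> h = q'"
      using a k l assms(3) * by (intro exI[of _ "l \<Zsemi> h"]) (auto simp: seq_cancel_left[OF l(4)])
  next
    fix h h' assume *: "h \<in> Arr C" "h' \<in> Arr C" "Dom C h = Cod C (p \<Zsemi> k)" "Dom C h' = Cod C (p \<Zsemi> k)"
      "(p \<Zsemi> k) \<Zsemi> h = (p \<Zsemi> k) \<Zsemi> h'" "(q \<Zsemi> k) \<Zsemi> h = (q \<Zsemi> k) \<Zsemi> h'"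
    have "k \<Zsemi> h = k \<Zsemi> h'"
      by (rule is_pushout_eq[OF assms(1)]) (use * a k assms(3) in auto)
    then show "h = h'" by (rule iso_epi[OF assms(2)]) (use * a k assms(3) in auto)
  qed (use a k l assms(3) in \<open>auto simp: seq_cancel_left[OF a(9)]\<close>)
qed

text \<open>Other representatives of two composable cospans differ by isomorphisms \<open>h\<close>
  and \<open>k\<close> on the inner legs. A cocone \<open>(p', q')\<close> over the original legs
  becomes one over the changed legs after composing with the inverses, so the isomorphisms can be
  moved to the other side of the square.\<close>

lemma is_pushout_iso_seq:
  assumes "is_pushout C (j \<Zsemi> h) (i \<Zsemi> k) p q" "iso_arrow C h" "iso_arrow C k"
    "j \<in> Arr C" "i \<in> Arr C" "Cod C j = Dom C h" "Cod C i = Dom C k"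
  shows "is_pushout C j i (h \<Zsemi> p) (k \<Zsemi> q)"
proof -
  obtain h' where h: "h \<in> Arr C" "h' \<in> Arr C" "Dom C h' = Cod C h" "Cod C h' = Dom C h"
    "h \<Zsemi> h' = ident C (Dom C h)" "h' \<Zsemi> h = ident C (Cod C h)"
    using assms(2) by (rule iso_arrowE)
  obtain k' where k: "k \<in> Arr C" "k' \<in> Arr C" "Dom C k' = Cod C k" "Cod C k' = Dom C k"
    "k \<Zsemi> k' = ident C (Dom C k)" "k' \<Zsemi> k = ident C (Cod C k)"
    using assms(3) by (rule iso_arrowE)
  note a = is_pushoutD[OF assms(1)]
  from a assms h k have b: "Dom C p = Cod C h" "Dom C q = Cod C k" "Dom C i = Dom C j"
    "p \<in> Arr C" "q \<in> Arr C" "Cod C q = Cod C p" "j \<Zsemi> (h \<Zsemi> p) = i \<Zsemi> (k \<Zsemi> q)" by auto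
  show ?thesis
  proof (rule is_pushoutI)
    fix p' q' assume *: "p' \<in> Arr C" "q' \<in> Arr C" "Dom C p' = Cod C j" "Dom C q' = Cod C i"
      "Cod C p' = Cod C q'" "j \<Zsemi> p' = i \<Zsemi> q'"
    obtain u where u: "u \<in> Arr C" "Dom C u = Cod C p" "Cod C u = Cod C (h' \<Zsemi> p')" "p \<Zsemi> u = h' \<Zsemi> p'" "q \<Zsemi> u = k' \<Zsemi> q'"
      by (rule is_pushout_ex[OF assms(1), of "h' \<Zsemi> p'" "k' \<Zsemi> q'"])
        (use * h k assms in \<open>auto simp: seq_cancel_left[OF h(5)] seq_cancel_left[OF k(5)]\<close>)
    then show "\<exists>u. u \<in> Arr C \<and> Dom C u = Cod C (h \<Zsemi> p) \<and> Cod C u = Cod C q' \<and> (h \<Zsemi> p) \<Zsemi> u = p' \<and> (k \<Zsemi> q) \<Zsemi> u = q'"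
      using * h k b assms
      by (intro exI[of _ u]) (auto simp: seq_cancel_left[OF h(5)] seq_cancel_left[OF k(5)])
  next
    fix u u' assume *: "u \<in> Arr C" "u' \<in> Arr C" "Dom C u = Cod C (h \<Zsemi> p)" "Dom C u' = Cod C (h \<Zsemi> p)"
      "Cod C u' = Cod C u" "(h \<Zsemi> p) \<Zsemi> u = (h \<Zsemi> p) \<Zsemi> u'" "(k \<Zsemi> q) \<Zsemi> u = (k \<Zsemi> q) \<Zsemi> u'"
    have "p \<Zsemi> u = p \<Zsemi> u'" by (rule iso_epi[OF assms(2)]) (use * h b in auto)
    moreover have "q \<Zsemi> u = q \<Zsemi> u'" by (rule iso_epi[OF assms(3)]) (use * h k b in auto)
    ultimately show "u = u'" using * h b by (rule_tac is_pushout_eq[OF assms(1)]) auto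
  qed (use b h k assms in auto)
qed

text \<open>Since \<open>b\<close> is invertible, the mediating arrow has to be the inverse of
  \<open>b\<close> followed by \<open>p'\<close>; that it restricts to \<open>q'\<close> along
  \<open>g\<close> is seen after cancelling \<open>a\<close>. Unit laws of cospan composition and
  naturality of the structure isomorphisms rest on such squares.\<close>

lemma is_pushout_iso_square:
  assumes "iso_arrow C a" "iso_arrow C b" "f \<Zsemi> b = a \<Zsemi> g" "f \<in> Arr C" "g \<in> Arr C"
    "Dom C a = Dom C f" "Cod C f = Dom C b" "Cod C a = Dom C g" "Cod C b = Cod C g"
  shows "is_pushout C f a b g"
proof -
  obtain b' where b: "b \<in> Arr C" "b' \<in> Arr C" "Dom C b' = Cod C b" "Cod C b' = Dom C b"
    "b \<Zsemi> b' = ident C (Dom C b)" "b' \<Zsemi> b = ident C (Cod C b)"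
    using assms(2) by (rule iso_arrowE)
  note a = iso_Arr[OF assms(1)]
  show ?thesis
  proof (rule is_pushoutI)
    fix p' q' assume *: "p' \<in> Arr C" "q' \<in> Arr C" "Dom C p' = Cod C f" "Dom C q' = Cod C a"
      "Cod C p' = Cod C q'" "f \<Zsemi> p' = a \<Zsemi> q'"
    have "g \<Zsemi> (b' \<Zsemi> p') = q'"
    proof (rule iso_epi[OF assms(1)])
      have "a \<Zsemi> (g \<Zsemi> (b' \<Zsemi> p')) = (f \<Zsemi> b) \<Zsemi> (b' \<Zsemi> p')"
        unfolding assms(3) using a b assms * by simp
      also have "\<dots> = a \<Zsemi> q'" using a b assms(4-) * by (simp add: seq_cancel_left[OF b(5)])
      finally show "a \<Zsemi> (g \<Zsemi> (b' \<Zsemi> p')) = a \<Zsemi> q'" .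
    qed (use a b assms * in auto)
    then show "\<exists>h. h \<in> Arr C \<and> Dom C h = Cod C b \<and> Cod C h = Cod C q' \<and> b \<Zsemi> h = p' \<and> g \<Zsemi> h = q'"
      using a b assms *
      by (intro exI[of _ "b' \<Zsemi> p'"]) (auto simp: seq_cancel_left[OF b(5)])
  next
    fix u u' assume *: "u \<in> Arr C" "u' \<in> Arr C" "Dom C u = Cod C b" "Dom C u' = Cod C b"
      "Cod C u' = Cod C u" "b \<Zsemi> u = b \<Zsemi> u'" "g \<Zsemi> u = g \<Zsemi> u'"
    show "u = u'" by (rule iso_epi[OF assms(2)]) (use * in auto)
  qed (use a b assms in auto)
qed

lemma is_pushout_ident:
  assumes "f \<in> Arr C" "X = Dom C f" "Y = Cod C f"
  shows "is_pushout C f (ident C X) (ident C Y) f" "is_pushout C (ident C X) f f (ident C Y)"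
proof -
  show "is_pushout C f (ident C X) (ident C Y) f"
    by (rule is_pushout_iso_square) (use assms in \<open>auto intro: iso_ident\<close>)
  then show "is_pushout C (ident C X) f f (ident C Y)" by (rule is_pushout_sym)
qed

text \<open>A cocone over the outer square is first mediated by the left square with
  \<open>h \<Zsemi> q'\<close> in place of \<open>q'\<close>, and the result is mediated by the
  right square. Pasting in two directions yields associativity of cospan composition.\<close>

lemma is_pushout_paste:
  assumes "is_pushout C f g p q" "is_pushout C q h r s"
  shows "is_pushout C f (g \<Zsemi> h) (p \<Zsemi> r) s"
proof -
  note a = is_pushoutD[OF assms(1)] and b = is_pushoutD[OF assms(2)]
  show ?thesis
  proof (rule is_pushoutI)
    fix p' q' assume *: "p' \<in> Arr C" "q' \<in> Arr C" "Dom C p' = Cod C f" "Dom C q' = Cod C (g \<Zsemi> h)"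
      "Cod C p' = Cod C q'" "f \<Zsemi> p' = (g \<Zsemi> h) \<Zsemi> q'"
    obtain u where u: "u \<in> Arr C" "Dom C u = Cod C p" "Cod C u = Cod C p'" "p \<Zsemi> u = p'" "q \<Zsemi> u = h \<Zsemi> q'"
      by (rule is_pushout_ex[OF assms(1), of "p'" "h \<Zsemi> q'"]) (use * a b in auto)
    obtain v where v: "v \<in> Arr C" "Dom C v = Cod C r" "Cod C v = Cod C u" "r \<Zsemi> v = u" "s \<Zsemi> v = q'"
      by (rule is_pushout_ex[OF assms(2), of u q']) (use * a b u in auto)
    show "\<exists>u. u \<in> Arr C \<and> Dom C u = Cod C (p \<Zsemi> r) \<and> Cod C u = Cod C q' \<and> (p \<Zsemi> r) \<Zsemi> u = p' \<and> s \<Zsemi> u = q'"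
      using * a b u v by (intro exI[of _ v]) auto
  next
    fix u u' assume *: "u \<in> Arr C" "u' \<in> Arr C" "Dom C u = Cod C (p \<Zsemi> r)" "Dom C u' = Cod C (p \<Zsemi> r)"
      "Cod C u' = Cod C u" "(p \<Zsemi> r) \<Zsemi> u = (p \<Zsemi> r) \<Zsemi> u'" "s \<Zsemi> u = s \<Zsemi> u'"
    have "r \<Zsemi> u = r \<Zsemi> u'"
      by (rule is_pushout_eq[OF assms(1)])
        (use * a b in \<open>auto simp: seq_cancel_left[OF b(9)]\<close>)
    then show "u = u'" using * a b by (rule_tac is_pushout_eq[OF assms(2)]) auto
  next
    show "f \<Zsemi> (p \<Zsemi> r) = (g \<Zsemi> h) \<Zsemi> s"
      using a b by (simp add: seq_cancel_left[OF a(9)])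
  qed (use a b in auto)
qed

end

section \<open>Categories with finite colimits\<close>

text \<open>Coproducts are chosen because tensor and structure maps are functions of objects.
  Coequalizers are only asked to exist, because composition of cospans refers to arbitrary pushouts.
  The locale is meant for hypergraphs and equally for the opposite of sets.\<close>

locale finitely_cocomplete = category C for C :: "('o, 'a) cat" (structure) +
  fixes P :: "('o, 'a) chosen_bin"
  assumes neutral_Obj [simp]: "neutral P \<in> Obj C"
    and initial_ex1: "X \<in> Obj C \<Longrightarrow> \<exists>!f. f \<in> Hom C (neutral P) X"
    and bin_Obj [simp]: "X \<in> Obj C \<Longrightarrow> Y \<in> Obj C \<Longrightarrow> bin P X Y \<in> Obj C"
    and leg1_Hom: "X \<in> Obj C \<Longrightarrow> Y \<in> Obj C \<Longrightarrow> leg1 P X Y \<in> Hom C X (bin P X Y)"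
    and leg2_Hom: "X \<in> Obj C \<Longrightarrow> Y \<in> Obj C \<Longrightarrow> leg2 P X Y \<in> Hom C Y (bin P X Y)"
    and copair_ex1: "f \<in> Hom C X Z \<Longrightarrow> g \<in> Hom C Y Z \<Longrightarrow>
      \<exists>!h. h \<in> Hom C (bin P X Y) Z \<and> leg1 P X Y \<Zsemi> h = f \<and> leg2 P X Y \<Zsemi> h = g"
    and coequalizer_ex: "f \<in> Hom C X Y \<Longrightarrow> g \<in> Hom C X Y \<Longrightarrow>
      \<exists>q. q \<in> Arr C \<and> Dom C q = Y \<and> f \<Zsemi> q = g \<Zsemi> q \<and>
        (\<forall>h \<in> Arr C. Dom C h = Y \<longrightarrow> f \<Zsemi> h = g \<Zsemi> h \<longrightarrow> (\<exists>!k. k \<in> Hom C (Cod C q) (Cod C h) \<and> q \<Zsemi> k = h))"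
begin

section \<open>Calculation with copairs and sums of arrows\<close>

lemma initial_arr [simp]:
  assumes "X \<in> Obj C"
  shows "initial_arrow C P X \<in> Arr C" "Dom C (initial_arrow C P X) = neutral P"
    "Cod C (initial_arrow C P X) = X"
  using theI'[OF initial_ex1[OF assms]] unfolding initial_arrow_def by (auto simp: Hom_def)

lemma initial_eq: "f \<in> Arr C \<Longrightarrow> g \<in> Arr C \<Longrightarrow> Dom C f = neutral P \<Longrightarrow> Dom C g = neutral P \<Longrightarrow>
    Cod C f = Cod C g \<Longrightarrow> f = g"
  using initial_ex1[of "Cod C f"] by (auto simp: Hom_def)

lemma initial_seq [simp]:
  "h \<in> Arr C \<Longrightarrow> Dom C h = X \<Longrightarrow> initial_arrow C P X \<Zsemi> h = initial_arrow C P (Cod C h)"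
  by (rule initial_eq) auto

lemma leg_arr [simp]:
  assumes "X \<in> Obj C" "Y \<in> Obj C"
  shows "leg1 P X Y \<in> Arr C" "Dom C (leg1 P X Y) = X" "Cod C (leg1 P X Y) = bin P X Y"
    "leg2 P X Y \<in> Arr C" "Dom C (leg2 P X Y) = Y" "Cod C (leg2 P X Y) = bin P X Y"
  using leg1_Hom[OF assms] leg2_Hom[OF assms] by (auto simp: Hom_def)

lemma copair_props:
  assumes "f \<in> Arr C" "g \<in> Arr C" "Cod C f = Cod C g"
  shows "copair C P f g \<in> Hom C (bin P (Dom C f) (Dom C g)) (Cod C f) \<and>
    leg1 P (Dom C f) (Dom C g) \<Zsemi> copair C P f g = f \<and> leg2 P (Dom C f) (Dom C g) \<Zsemi> copair C P f g = g"
proof -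
  have "f \<in> Hom C (Dom C f) (Cod C f)" "g \<in> Hom C (Dom C g) (Cod C f)"
    using assms by (auto simp: Hom_def)
  from theI'[OF copair_ex1[OF this]] show ?thesis unfolding copair_def .
qed

lemma copair_arr [simp]:
  assumes "f \<in> Arr C" "g \<in> Arr C" "Cod C f = Cod C g"
  shows "copair C P f g \<in> Arr C" "Dom C (copair C P f g) = bin P (Dom C f) (Dom C g)"
    "Cod C (copair C P f g) = Cod C f"
  using copair_props[OF assms] by (auto simp: Hom_def)

lemma leg_copair [simp]:
  assumes "f \<in> Arr C" "g \<in> Arr C" "Cod C f = Cod C g" "Dom C f = X" "Dom C g = Y"
  shows "leg1 P X Y \<Zsemi> copair C P f g = f" "leg2 P X Y \<Zsemi> copair C P f g = g"
  using copair_props[OF assms(1-3)] assms(4,5) by auto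

lemma leg_copair_seq [simp]:
  assumes "f \<in> Arr C" "g \<in> Arr C" "Cod C f = Cod C g" "Dom C f = X" "Dom C g = Y" "h \<in> Arr C" "Dom C h = Cod C f"
  shows "leg1 P X Y \<Zsemi> (copair C P f g \<Zsemi> h) = f \<Zsemi> h" "leg2 P X Y \<Zsemi> (copair C P f g \<Zsemi> h) = g \<Zsemi> h"
proof -
  have "X \<in> Obj C" "Y \<in> Obj C" using assms(1-5) by auto
  then show "leg1 P X Y \<Zsemi> (copair C P f g \<Zsemi> h) = f \<Zsemi> h" "leg2 P X Y \<Zsemi> (copair C P f g \<Zsemi> h) = g \<Zsemi> h"
    using assms by (simp_all add: seq_assoc'[symmetric] del: seq_assoc')
qed

lemma bin_eqI:
  assumes "h \<in> Arr C" "k \<in> Arr C" "Dom C h = bin P X Y" "Dom C k = bin P X Y" "X \<in> Obj C" "Y \<in> Obj C"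
    "leg1 P X Y \<Zsemi> h = leg1 P X Y \<Zsemi> k" "leg2 P X Y \<Zsemi> h = leg2 P X Y \<Zsemi> k"
  shows "h = k"
proof -
  have "Cod C (leg1 P X Y \<Zsemi> h) = Cod C h" "Cod C (leg1 P X Y \<Zsemi> k) = Cod C k"
    using assms(1-6) by simp_all
  then have c: "Cod C k = Cod C h" using assms(7) by simp
  have *: "leg1 P X Y \<Zsemi> h \<in> Hom C X (Cod C h)" "leg2 P X Y \<Zsemi> h \<in> Hom C Y (Cod C h)"
    using assms(1-6) by (auto simp: Hom_def)
  have "h \<in> Hom C (bin P X Y) (Cod C h)" "k \<in> Hom C (bin P X Y) (Cod C h)"
    using assms(1-6) c by (auto simp: Hom_def)
  with copair_ex1[OF *] assms(7,8) show ?thesis by (elim ex1E) metis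
qed

text \<open>This rule and its neighbours push composition inside copairs and evaluate injections
  against them. Composites of structure maps thus normalise to nested copairs of injections, so that
  the coherence laws become simplification problems.\<close>

lemma copair_seq [simp]:
  assumes "f \<in> Arr C" "g \<in> Arr C" "Cod C f = Cod C g" "h \<in> Arr C" "Cod C g = Dom C h"
  shows "copair C P f g \<Zsemi> h = copair C P (f \<Zsemi> h) (g \<Zsemi> h)"
  by (rule bin_eqI[of _ _ "Dom C f" "Dom C g"]) (use assms in auto)

lemma copair_eta [simp]:
  assumes "X \<in> Obj C" "Y \<in> Obj C" "h \<in> Arr C" "Dom C h = bin P X Y"
  shows "copair C P (leg1 P X Y \<Zsemi> h) (leg2 P X Y \<Zsemi> h) = h"
  by (rule bin_eqI[of _ _ X Y]) (use assms in auto)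

lemma copair_legs [simp]:
  assumes "X \<in> Obj C" "Y \<in> Obj C"
  shows "copair C P (leg1 P X Y) (leg2 P X Y) = ident C (bin P X Y)"
  by (rule bin_eqI[of _ _ X Y]) (use assms in auto)

lemma arrow_sum_arr [simp]:
  assumes "f \<in> Arr C" "g \<in> Arr C"
  shows "arrow_sum C P f g \<in> Arr C" "Dom C (arrow_sum C P f g) = bin P (Dom C f) (Dom C g)"
    "Cod C (arrow_sum C P f g) = bin P (Cod C f) (Cod C g)"
  using assms unfolding arrow_sum_def by auto

lemma arrow_sum_copair [simp]:
  assumes "f \<in> Arr C" "g \<in> Arr C" "h \<in> Arr C" "k \<in> Arr C" "Cod C f = Dom C h" "Cod C g = Dom C k"
    "Cod C h = Cod C k"
  shows "arrow_sum C P f g \<Zsemi> copair C P h k = copair C P (f \<Zsemi> h) (g \<Zsemi> k)"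
  using assms unfolding arrow_sum_def by simp

lemma arrow_sum_seq [simp]:
  assumes "f \<in> Arr C" "g \<in> Arr C" "h \<in> Arr C" "k \<in> Arr C" "Cod C f = Dom C h" "Cod C g = Dom C k"
  shows "arrow_sum C P f g \<Zsemi> arrow_sum C P h k = arrow_sum C P (f \<Zsemi> h) (g \<Zsemi> k)"
  using assms unfolding arrow_sum_def by simp

lemma arrow_sum_ident [simp]:
  "X \<in> Obj C \<Longrightarrow> Y \<in> Obj C \<Longrightarrow> arrow_sum C P (ident C X) (ident C Y) = ident C (bin P X Y)"
  unfolding arrow_sum_def by simp

lemma leg_arrow_sum [simp]:
  assumes "f \<in> Arr C" "g \<in> Arr C" "X = Dom C f" "Y = Dom C g"
  shows "leg1 P X Y \<Zsemi> arrow_sum C P f g = f \<Zsemi> leg1 P (Cod C f) (Cod C g)"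
    "leg2 P X Y \<Zsemi> arrow_sum C P f g = g \<Zsemi> leg2 P (Cod C f) (Cod C g)"
  using assms unfolding arrow_sum_def by simp_all

lemma leg_arrow_sum_seq [simp]:
  assumes "f \<in> Arr C" "g \<in> Arr C" "X = Dom C f" "Y = Dom C g" "h \<in> Arr C" "Dom C h = bin P (Cod C f) (Cod C g)"
  shows "leg1 P X Y \<Zsemi> (arrow_sum C P f g \<Zsemi> h) = f \<Zsemi> (leg1 P (Cod C f) (Cod C g) \<Zsemi> h)"
    "leg2 P X Y \<Zsemi> (arrow_sum C P f g \<Zsemi> h) = g \<Zsemi> (leg2 P (Cod C f) (Cod C g) \<Zsemi> h)"
  using assms unfolding arrow_sum_def by simp_all

lemma iso_arrow_sum:
  assumes "iso_arrow C f" "iso_arrow C g"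
  shows "iso_arrow C (arrow_sum C P f g)"
proof -
  obtain f' where f: "f \<in> Arr C" "f' \<in> Arr C" "Dom C f' = Cod C f" "Cod C f' = Dom C f"
    "f \<Zsemi> f' = ident C (Dom C f)" "f' \<Zsemi> f = ident C (Cod C f)"
    using assms(1) by (rule iso_arrowE)
  obtain g' where g: "g \<in> Arr C" "g' \<in> Arr C" "Dom C g' = Cod C g" "Cod C g' = Dom C g"
    "g \<Zsemi> g' = ident C (Dom C g)" "g' \<Zsemi> g = ident C (Cod C g)"
    using assms(2) by (rule iso_arrowE)
  show ?thesis by (rule iso_arrowI[of _ "arrow_sum C P f' g'"]) (use f g in auto)
qed

text \<open>A cocone on \<open>f\<close>, \<open>g\<close> is an arrow out of the coproduct of their
  codomains that coequalizes the two composites with the injections.\<close>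

lemma pushout_ex:
  assumes "f \<in> Arr C" "g \<in> Arr C" "Dom C f = Dom C g"
  obtains p q where "is_pushout C f g p q"
proof -
  let ?l = "leg1 P (Cod C f) (Cod C g)" and ?r = "leg2 P (Cod C f) (Cod C g)"
  have "f \<Zsemi> ?l \<in> Hom C (Dom C f) (bin P (Cod C f) (Cod C g))" "g \<Zsemi> ?r \<in> Hom C (Dom C f) (bin P (Cod C f) (Cod C g))"
    using assms by (auto simp: Hom_def)
  from coequalizer_ex[OF this] obtain q where q: "q \<in> Arr C" "Dom C q = bin P (Cod C f) (Cod C g)"
    "(f \<Zsemi> ?l) \<Zsemi> q = (g \<Zsemi> ?r) \<Zsemi> q"
    and u: "\<And>h. h \<in> Arr C \<Longrightarrow> Dom C h = bin P (Cod C f) (Cod C g) \<Longrightarrow> (f \<Zsemi> ?l) \<Zsemi> h = (g \<Zsemi> ?r) \<Zsemi> h \<Longrightarrow>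
        (\<exists>!k. k \<in> Hom C (Cod C q) (Cod C h) \<and> q \<Zsemi> k = h)"
    by blast
  have "is_pushout C f g (?l \<Zsemi> q) (?r \<Zsemi> q)"
  proof (rule is_pushoutI)
    fix p' q' assume *: "p' \<in> Arr C" "q' \<in> Arr C" "Dom C p' = Cod C f" "Dom C q' = Cod C g"
      "Cod C p' = Cod C q'" "f \<Zsemi> p' = g \<Zsemi> q'"
    have "\<exists>!k. k \<in> Hom C (Cod C q) (Cod C (copair C P p' q')) \<and> q \<Zsemi> k = copair C P p' q'"
      by (rule u) (use * assms in auto)
    then obtain k where k: "k \<in> Hom C (Cod C q) (Cod C p')" "q \<Zsemi> k = copair C P p' q'"
      using * by auto
    then show "\<exists>k. k \<in> Arr C \<and> Dom C k = Cod C (?l \<Zsemi> q) \<and> Cod C k = Cod C q' \<and>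
      (?l \<Zsemi> q) \<Zsemi> k = p' \<and> (?r \<Zsemi> q) \<Zsemi> k = q'"
      using * assms q(1,2) by (intro exI[of _ k]) (auto simp: Hom_def)
  next
    fix h k assume *: "h \<in> Arr C" "k \<in> Arr C" "Dom C h = Cod C (?l \<Zsemi> q)" "Dom C k = Cod C (?l \<Zsemi> q)"
      "Cod C k = Cod C h" "(?l \<Zsemi> q) \<Zsemi> h = (?l \<Zsemi> q) \<Zsemi> k" "(?r \<Zsemi> q) \<Zsemi> h = (?r \<Zsemi> q) \<Zsemi> k"
    \<comment> \<open>Uniqueness has two layers: the injections are jointly epi, which gives this
      equation, and then the coequalizer \<open>q\<close> is epi.\<close>
    have eq: "q \<Zsemi> h = q \<Zsemi> k"
      by (rule bin_eqI[of _ _ "Cod C f" "Cod C g"]) (use assms q(1,2) * in auto)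
    have "(f \<Zsemi> ?l) \<Zsemi> (q \<Zsemi> k) = ((f \<Zsemi> ?l) \<Zsemi> q) \<Zsemi> k" using assms q(1,2) *(1-5) by simp
    also have "\<dots> = (g \<Zsemi> ?r) \<Zsemi> (q \<Zsemi> k)" unfolding q(3) using assms q(1,2) *(1-5) by simp
    finally have "(f \<Zsemi> ?l) \<Zsemi> (q \<Zsemi> k) = (g \<Zsemi> ?r) \<Zsemi> (q \<Zsemi> k)" .
    then have "\<exists>!l. l \<in> Hom C (Cod C q) (Cod C (q \<Zsemi> k)) \<and> q \<Zsemi> l = q \<Zsemi> k"
      using assms q(1,2) *(1-5) by (intro u) simp_all
    moreover have "h \<in> Hom C (Cod C q) (Cod C (q \<Zsemi> k))" "k \<in> Hom C (Cod C q) (Cod C (q \<Zsemi> k))"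
      using assms q(1,2) *(1-5) by (auto simp: Hom_def)
    ultimately show "h = k" using eq by (elim ex1E) metis
  qed (use assms q in auto)
  then show ?thesis by (rule that)
qed

text \<open>Colimits commute with colimits. A cocone on the sums restricts along the injections to a
  cocone on each summand, and the two mediating arrows are copaired. This gives the interchange law
  for composition and tensor of cospans.\<close>

lemma is_pushout_sum:
  assumes "is_pushout C f g p q" "is_pushout C f' g' p' q'"
  shows "is_pushout C (arrow_sum C P f f') (arrow_sum C P g g') (arrow_sum C P p p') (arrow_sum C P q q')"
proof -
  note a = is_pushoutD[OF assms(1)] and b = is_pushoutD[OF assms(2)]
  show ?thesis
  proof (rule is_pushoutI)
    fix r s assume *: "r \<in> Arr C" "s \<in> Arr C" "Dom C r = Cod C (arrow_sum C P f f')"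
      "Dom C s = Cod C (arrow_sum C P g g')" "Cod C r = Cod C s" "arrow_sum C P f f' \<Zsemi> r = arrow_sum C P g g' \<Zsemi> s"
    let ?l = "leg1 P (Dom C f) (Dom C f')" and ?r = "leg2 P (Dom C f) (Dom C f')"
    have "?l \<Zsemi> (arrow_sum C P f f' \<Zsemi> r) = ?l \<Zsemi> (arrow_sum C P g g' \<Zsemi> s)"
      "?r \<Zsemi> (arrow_sum C P f f' \<Zsemi> r) = ?r \<Zsemi> (arrow_sum C P g g' \<Zsemi> s)"
      using *(6) by simp_all
    then have 1: "f \<Zsemi> (leg1 P (Cod C f) (Cod C f') \<Zsemi> r) = g \<Zsemi> (leg1 P (Cod C g) (Cod C g') \<Zsemi> s)"
      "f' \<Zsemi> (leg2 P (Cod C f) (Cod C f') \<Zsemi> r) = g' \<Zsemi> (leg2 P (Cod C g) (Cod C g') \<Zsemi> s)"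
      using a(1-8) b(1-8) *(1-5) by simp_all
    obtain u where u: "u \<in> Arr C" "Dom C u = Cod C p" "Cod C u = Cod C s"
      "p \<Zsemi> u = leg1 P (Cod C f) (Cod C f') \<Zsemi> r" "q \<Zsemi> u = leg1 P (Cod C g) (Cod C g') \<Zsemi> s"
      by (rule is_pushout_ex[OF assms(1) _ _ _ _ _ 1(1)]) (use a(1-8) b(1-8) *(1-5) in simp_all)
    obtain v where v: "v \<in> Arr C" "Dom C v = Cod C p'" "Cod C v = Cod C s"
      "p' \<Zsemi> v = leg2 P (Cod C f) (Cod C f') \<Zsemi> r" "q' \<Zsemi> v = leg2 P (Cod C g) (Cod C g') \<Zsemi> s"
      by (rule is_pushout_ex[OF assms(2) _ _ _ _ _ 1(2)]) (use a(1-8) b(1-8) *(1-5) in simp_all)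
    show "\<exists>h. h \<in> Arr C \<and> Dom C h = Cod C (arrow_sum C P p p') \<and> Cod C h = Cod C s \<and>
      arrow_sum C P p p' \<Zsemi> h = r \<and> arrow_sum C P q q' \<Zsemi> h = s"
      by (rule exI[of _ "copair C P u v"]) (use a(1-8) b(1-8) *(1-5) u v in simp)
  next
    fix h k assume *: "h \<in> Arr C" "k \<in> Arr C" "Dom C h = Cod C (arrow_sum C P p p')" "Dom C k = Cod C (arrow_sum C P p p')"
      "Cod C k = Cod C h" "arrow_sum C P p p' \<Zsemi> h = arrow_sum C P p p' \<Zsemi> k"
      "arrow_sum C P q q' \<Zsemi> h = arrow_sum C P q q' \<Zsemi> k"
    let ?l = "leg1 P (Cod C f) (Cod C f')" and ?r = "leg2 P (Cod C f) (Cod C f')"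
    let ?l' = "leg1 P (Cod C g) (Cod C g')" and ?r' = "leg2 P (Cod C g) (Cod C g')"
    have "?l \<Zsemi> (arrow_sum C P p p' \<Zsemi> h) = ?l \<Zsemi> (arrow_sum C P p p' \<Zsemi> k)"
      "?r \<Zsemi> (arrow_sum C P p p' \<Zsemi> h) = ?r \<Zsemi> (arrow_sum C P p p' \<Zsemi> k)"
      "?l' \<Zsemi> (arrow_sum C P q q' \<Zsemi> h) = ?l' \<Zsemi> (arrow_sum C P q q' \<Zsemi> k)"
      "?r' \<Zsemi> (arrow_sum C P q q' \<Zsemi> h) = ?r' \<Zsemi> (arrow_sum C P q q' \<Zsemi> k)"
      using *(6,7) by simp_all
    then have 1: "p \<Zsemi> (leg1 P (Cod C p) (Cod C p') \<Zsemi> h) = p \<Zsemi> (leg1 P (Cod C p) (Cod C p') \<Zsemi> k)"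
      "p' \<Zsemi> (leg2 P (Cod C p) (Cod C p') \<Zsemi> h) = p' \<Zsemi> (leg2 P (Cod C p) (Cod C p') \<Zsemi> k)"
      "q \<Zsemi> (leg1 P (Cod C p) (Cod C p') \<Zsemi> h) = q \<Zsemi> (leg1 P (Cod C p) (Cod C p') \<Zsemi> k)"
      "q' \<Zsemi> (leg2 P (Cod C p) (Cod C p') \<Zsemi> h) = q' \<Zsemi> (leg2 P (Cod C p) (Cod C p') \<Zsemi> k)"
      using a(1-8) b(1-8) *(1-5) by simp_all
    have "leg1 P (Cod C p) (Cod C p') \<Zsemi> h = leg1 P (Cod C p) (Cod C p') \<Zsemi> k"
      by (rule is_pushout_eq[OF assms(1)]) (use a(1-8) b(1-8) *(1-5) 1 in simp_all)
    moreover have "leg2 P (Cod C p) (Cod C p') \<Zsemi> h = leg2 P (Cod C p) (Cod C p') \<Zsemi> k"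
      by (rule is_pushout_eq[OF assms(2)]) (use a(1-8) b(1-8) *(1-5) 1 in simp_all)
    ultimately show "h = k"
      by (rule_tac bin_eqI[of _ _ "Cod C p" "Cod C p'"]) (use a(1-8) b(1-8) *(1-5) in simp_all)
  qed (use a b in simp_all)
qed

text \<open>The codiagonal is a split epi, with the first injection as section, and an epi has the
  identity square as its pushout with itself. This is the special law.\<close>

lemma is_pushout_codiagonal:
  assumes "X \<in> Obj C"
  shows "is_pushout C (copair C P (ident C X) (ident C X)) (copair C P (ident C X) (ident C X)) (ident C X) (ident C X)"
proof (rule is_pushoutI)
  fix p q assume *: "p \<in> Arr C" "q \<in> Arr C" "Dom C p = Cod C (copair C P (ident C X) (ident C X))"
    "Dom C q = Cod C (copair C P (ident C X) (ident C X))" "Cod C p = Cod C q"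
    "copair C P (ident C X) (ident C X) \<Zsemi> p = copair C P (ident C X) (ident C X) \<Zsemi> q"
  have "leg1 P X X \<Zsemi> (copair C P (ident C X) (ident C X) \<Zsemi> p) = leg1 P X X \<Zsemi> (copair C P (ident C X) (ident C X) \<Zsemi> q)"
    using *(6) by simp
  then have "p = q" using *(1-5) assms by simp
  then show "\<exists>h. h \<in> Arr C \<and> Dom C h = Cod C (ident C X) \<and> Cod C h = Cod C q \<and>
    ident C X \<Zsemi> h = p \<and> ident C X \<Zsemi> h = q"
    using * assms by auto
qed (use assms in simp_all)

text \<open>Any two arrows out of the initial object agree, so a cocone here is just a pair of
  arrows with common codomain. It computes the counit followed by the unit.\<close>

lemma is_pushout_initial:
  assumes "X \<in> Obj C" "Y \<in> Obj C"
  shows "is_pushout C (initial_arrow C P X) (initial_arrow C P Y) (leg1 P X Y) (leg2 P X Y)"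
proof (rule is_pushoutI)
  fix p q assume *: "p \<in> Arr C" "q \<in> Arr C" "Dom C p = Cod C (initial_arrow C P X)"
    "Dom C q = Cod C (initial_arrow C P Y)" "Cod C p = Cod C q"
  then show "\<exists>h. h \<in> Arr C \<and> Dom C h = Cod C (leg1 P X Y) \<and> Cod C h = Cod C q \<and>
    leg1 P X Y \<Zsemi> h = p \<and> leg2 P X Y \<Zsemi> h = q"
    using assms by (intro exI[of _ "copair C P p q"]) simp
next
  fix h k assume *: "h \<in> Arr C" "k \<in> Arr C" "Dom C h = Cod C (leg1 P X Y)" "Dom C k = Cod C (leg1 P X Y)"
    "leg1 P X Y \<Zsemi> h = leg1 P X Y \<Zsemi> k" "leg2 P X Y \<Zsemi> h = leg2 P X Y \<Zsemi> k"
  show "h = k" by (rule bin_eqI[of _ _ X Y]) (use * assms in simp_all)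
qed (use assms in simp_all)

end

section \<open>Cospans\<close>

context finitely_cocomplete
begin

lemma cospan_class_self:
  "i \<in> Arr C \<Longrightarrow> j \<in> Arr C \<Longrightarrow> Cod C i = Cod C j \<Longrightarrow> (i, j) \<in> cospan_class C i j"
  unfolding cospan_class_def
  by (auto intro!: exI[of _ "ident C (Cod C j)"] iso_ident)

abbreviation K where "K \<equiv> cospan_class C"
abbreviation B where "B \<equiv> cospan_pcb C P"

lemma cospan_class_memE:
  assumes "(i', j') \<in> K i j"
  obtains h where "iso_arrow C h" "Dom C h = Cod C i" "i' = i \<Zsemi> h" "j' = j \<Zsemi> h"
  using assms unfolding cospan_class_def by auto

lemma cospan_class_iso:
  assumes "i \<in> Arr C" "j \<in> Arr C" "Cod C i = Cod C j" "iso_arrow C h" "Dom C h = Cod C j"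
  shows "K (i \<Zsemi> h) (j \<Zsemi> h) = K i j"
proof -
  obtain h' where h: "h \<in> Arr C" "h' \<in> Arr C" "Dom C h' = Cod C h" "Cod C h' = Dom C h"
    "h \<Zsemi> h' = ident C (Dom C h)" "h' \<Zsemi> h = ident C (Cod C h)"
    using assms(4) by (rule iso_arrowE)
  have ih': "iso_arrow C h'" by (rule iso_arrowI[of h' h]) (use h in auto)
  show ?thesis
  proof (intro subset_antisym subsetI)
    fix x assume "x \<in> K (i \<Zsemi> h) (j \<Zsemi> h)"
    then obtain k where k: "iso_arrow C k" "Dom C k = Cod C h" "x = ((i \<Zsemi> h) \<Zsemi> k, (j \<Zsemi> h) \<Zsemi> k)"
      unfolding cospan_class_def using assms h by auto
    then have "x = (i \<Zsemi> (h \<Zsemi> k), j \<Zsemi> (h \<Zsemi> k))" using assms h iso_Arr[OF k(1)] by simp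
    moreover have "iso_arrow C (h \<Zsemi> k)" using iso_seq[OF assms(4) k(1)] k(2) by simp
    ultimately show "x \<in> K i j"
      unfolding cospan_class_def using assms h iso_Arr[OF k(1)] k(2) by (auto intro!: exI[of _ "h \<Zsemi> k"])
  next
    fix x assume "x \<in> K i j"
    then obtain k where k: "iso_arrow C k" "Dom C k = Cod C i" "x = (i \<Zsemi> k, j \<Zsemi> k)"
      unfolding cospan_class_def by auto
    have "iso_arrow C (h' \<Zsemi> k)" using iso_seq[OF ih' k(1)] h k(2) assms by simp
    moreover have "x = ((i \<Zsemi> h) \<Zsemi> (h' \<Zsemi> k), (j \<Zsemi> h) \<Zsemi> (h' \<Zsemi> k))"
      using h k(2,3) assms(1-3,5) iso_Arr[OF k(1)] by (simp add: seq_cancel_left[OF h(5)])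
    ultimately show "x \<in> K (i \<Zsemi> h) (j \<Zsemi> h)"
      unfolding cospan_class_def using h k(2) assms iso_Arr[OF k(1)] by (auto intro!: exI[of _ "h' \<Zsemi> k"])
  qed
qed

section \<open>The category of cospans\<close>

lemma cospan_pcb_Obj [simp]: "Obj B = Obj C"
  and cospan_pcb_ident: "ident B X = K (ident C X) (ident C X)"
  and cospan_pcb_tunit [simp]: "tunit B = neutral P"
  and cospan_pcb_tobj [simp]: "tobj B = bin P"
  by (auto simp: cospan_pcb_def)

lemma cospan_class_arr [simp]:
  assumes "i \<in> Arr C" "j \<in> Arr C" "Cod C i = Cod C j"
  shows "K i j \<in> Arr B" "Dom B (K i j) = Dom C i" "Cod B (K i j) = Dom C j"
proof -
  show "K i j \<in> Arr B" using assms by (auto simp: cospan_pcb_def cospan_def)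
  have "Dom C (i \<Zsemi> h) = Dom C i \<and> Dom C (j \<Zsemi> h) = Dom C j"
    if "iso_arrow C h" "Dom C h = Cod C i" for h
    using iso_Arr[OF that(1)] that(2) assms by simp
  then have *: "Dom C (fst c) = Dom C i" "Dom C (snd c) = Dom C j" if "c \<in> K i j" for c
    using that unfolding cospan_class_def by auto
  have ne: "K i j \<noteq> {}" using cospan_class_self[OF assms] by auto
  have "(\<lambda>c. Dom C (fst c)) ` K i j = (\<lambda>c. Dom C i) ` K i j"
    "(\<lambda>c. Dom C (snd c)) ` K i j = (\<lambda>c. Dom C j) ` K i j"
    by (rule image_cong[OF refl], erule *)+
  with ne have "(\<lambda>c. Dom C (fst c)) ` K i j = {Dom C i}" "(\<lambda>c. Dom C (snd c)) ` K i j = {Dom C j}"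
    by (simp_all add: image_constant_conv)
  then show "Dom B (K i j) = Dom C i" "Cod B (K i j) = Dom C j" by (simp_all add: cospan_pcb_def)
qed

lemma cospan_pcb_ArrE:
  assumes "S \<in> Arr B"
  obtains i j where "i \<in> Arr C" "j \<in> Arr C" "Cod C i = Cod C j" "S = K i j"
  using assms by (auto simp: cospan_pcb_def cospan_def)

lemma cospan_pcb_HomE:
  assumes "S \<in> Hom B X Y"
  obtains i j where "i \<in> Arr C" "j \<in> Arr C" "Cod C i = Cod C j" "Dom C i = X" "Dom C j = Y" "S = K i j"
proof -
  from assms obtain i j where "i \<in> Arr C" "j \<in> Arr C" "Cod C i = Cod C j" "S = K i j"
    by (auto simp: Hom_def elim: cospan_pcb_ArrE)
  with assms that show ?thesis by (auto simp: Hom_def)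
qed

text \<open>The defining set ranges over all representatives and all pushouts, yet one choice of
  each suffices: different representatives only alter the pushout by isomorphisms, and pushouts are
  unique up to isomorphism.\<close>

lemma cospan_class_seq:
  assumes "i \<in> Arr C" "j \<in> Arr C" "Cod C i = Cod C j" "i' \<in> Arr C" "j' \<in> Arr C" "Cod C i' = Cod C j'"
    and po: "is_pushout C j i' p q"
  shows "K i j \<Zsemi>\<^bsub>B\<^esub> K i' j' = K (i \<Zsemi> p) (j' \<Zsemi> q)"
proof -
  note a = is_pushoutD[OF po]
  have seq: "K i j \<Zsemi>\<^bsub>B\<^esub> K i' j' = {(k \<Zsemi> r, l' \<Zsemi> s) | k l k' l' r s.
        (k, l) \<in> K i j \<and> (k', l') \<in> K i' j' \<and> is_pushout C l k' r s}"
    by (simp add: cospan_pcb_def)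
  show ?thesis
  proof (intro subset_antisym subsetI)
    fix x assume "x \<in> K i j \<Zsemi>\<^bsub>B\<^esub> K i' j'"
    then obtain k l k' l' r s where x: "x = (k \<Zsemi> r, l' \<Zsemi> s)" "(k, l) \<in> K i j" "(k', l') \<in> K i' j'"
      "is_pushout C l k' r s" unfolding seq by auto
    obtain h where h: "iso_arrow C h" "Dom C h = Cod C i" "k = i \<Zsemi> h" "l = j \<Zsemi> h"
      using x(2) by (rule cospan_class_memE)
    obtain h' where h': "iso_arrow C h'" "Dom C h' = Cod C i'" "k' = i' \<Zsemi> h'" "l' = j' \<Zsemi> h'"
      using x(3) by (rule cospan_class_memE)
    note ah = iso_Arr[OF h(1)] iso_Arr[OF h'(1)]
    \<comment> \<open>The arbitrary pushout is transported back to the fixed representatives, where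
      uniqueness compares it with \<open>p\<close>, \<open>q\<close>.\<close>
    have "is_pushout C j i' (h \<Zsemi> r) (h' \<Zsemi> s)"
      by (rule is_pushout_iso_seq) (use x(4) h h' assms in auto)
    then obtain u where u: "iso_arrow C u" "Dom C u = Cod C p" "p \<Zsemi> u = h \<Zsemi> r" "q \<Zsemi> u = h' \<Zsemi> s"
      using is_pushout_unique[OF po] by metis
    have b: "r \<in> Arr C" "s \<in> Arr C" "Dom C r = Cod C h" "Dom C s = Cod C h'"
      using is_pushoutD[OF x(4)] h h' ah assms by auto
    have "x = (i \<Zsemi> (p \<Zsemi> u), j' \<Zsemi> (q \<Zsemi> u))"
      unfolding u(3,4) x(1) h(3) h'(4) using assms(1-6) ah b h(2) h'(2) by simp
    then have "x = ((i \<Zsemi> p) \<Zsemi> u, (j' \<Zsemi> q) \<Zsemi> u)"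
      using assms(1-6) a(1-8) iso_Arr[OF u(1)] u(2) by simp
    then show "x \<in> K (i \<Zsemi> p) (j' \<Zsemi> q)"
      unfolding cospan_class_def using u(1,2) assms(1-6) a(1-8) by auto
  next
    fix x assume "x \<in> K (i \<Zsemi> p) (j' \<Zsemi> q)"
    then obtain u where u: "iso_arrow C u" "Dom C u = Cod C p" "x = ((i \<Zsemi> p) \<Zsemi> u, (j' \<Zsemi> q) \<Zsemi> u)"
      unfolding cospan_class_def using assms(1-6) a(1-8) by auto
    then have "x = (i \<Zsemi> (p \<Zsemi> u), j' \<Zsemi> (q \<Zsemi> u))"
      using assms(1-6) a(1-8) iso_Arr[OF u(1)] by simp
    \<comment> \<open>Conversely, \<open>u\<close> is absorbed into the pushout while the
      representatives \<open>(i, j)\<close> and \<open>(i', j')\<close> stay unchanged.\<close>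
    moreover have "is_pushout C j i' (p \<Zsemi> u) (q \<Zsemi> u)"
      by (rule is_pushout_seq_iso[OF po u(1,2)])
    ultimately show "x \<in> K i j \<Zsemi>\<^bsub>B\<^esub> K i' j'"
      unfolding seq using cospan_class_self[of i j] cospan_class_self[of i' j'] assms by blast
  qed
qed

lemma category_cospan: "category B"
proof
  fix f assume "f \<in> Arr B"
  then show "Dom B f \<in> Obj B" "Cod B f \<in> Obj B"
    by (auto elim!: cospan_pcb_ArrE)
next
  fix X assume "X \<in> Obj B"
  then show "ident B X \<in> Hom B X X" by (auto simp: Hom_def cospan_pcb_ident)
next
  fix f g X Y Z assume f: "f \<in> Hom B X Y" and g: "g \<in> Hom B Y Z"
  obtain i j where f: "i \<in> Arr C" "j \<in> Arr C" "Cod C i = Cod C j" "Dom C i = X" "Dom C j = Y" "f = K i j"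
    using f by (rule cospan_pcb_HomE)
  obtain i' j' where g: "i' \<in> Arr C" "j' \<in> Arr C" "Cod C i' = Cod C j'" "Dom C i' = Y" "Dom C j' = Z" "g = K i' j'"
    using g by (rule cospan_pcb_HomE)
  obtain p q where po: "is_pushout C j i' p q" using pushout_ex[of j i'] f g by auto
  note a = is_pushoutD(1-8)[OF po]
  show "f \<Zsemi>\<^bsub>B\<^esub> g \<in> Hom B X Z"
    using a f g cospan_class_seq[OF f(1-3) g(1-3) po] by (auto simp: Hom_def)
next
  fix f X Y assume f: "f \<in> Hom B X Y"
  obtain i j where f: "i \<in> Arr C" "j \<in> Arr C" "Cod C i = Cod C j" "Dom C i = X" "Dom C j = Y" "f = K i j"
    using f by (rule cospan_pcb_HomE)
  show "ident B X \<Zsemi>\<^bsub>B\<^esub> f = f"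
    unfolding cospan_pcb_ident f(6)
    by (subst cospan_class_seq[where p = i and q = "ident C (Cod C i)"])
      (use f in \<open>auto intro: is_pushout_ident\<close>)
  show "f \<Zsemi>\<^bsub>B\<^esub> ident B Y = f"
    unfolding cospan_pcb_ident f(6)
    by (subst cospan_class_seq[where q = j and p = "ident C (Cod C i)"])
      (use f in \<open>auto intro: is_pushout_ident\<close>)
next
  fix f g h W X Y Z assume f: "f \<in> Hom B W X" and g: "g \<in> Hom B X Y" and h: "h \<in> Hom B Y Z"
  obtain i1 j1 where f: "i1 \<in> Arr C" "j1 \<in> Arr C" "Cod C i1 = Cod C j1" "Dom C i1 = W" "Dom C j1 = X" "f = K i1 j1"
    using f by (rule cospan_pcb_HomE)
  obtain i2 j2 where g: "i2 \<in> Arr C" "j2 \<in> Arr C" "Cod C i2 = Cod C j2" "Dom C i2 = X" "Dom C j2 = Y" "g = K i2 j2"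
    using g by (rule cospan_pcb_HomE)
  obtain i3 j3 where h: "i3 \<in> Arr C" "j3 \<in> Arr C" "Cod C i3 = Cod C j3" "Dom C i3 = Y" "Dom C j3 = Z" "h = K i3 j3"
    using h by (rule cospan_pcb_HomE)
  obtain p q where pq: "is_pushout C j1 i2 p q" using pushout_ex[of j1 i2] f g by auto
  note a = is_pushoutD(1-8)[OF pq]
  obtain r s where rs: "is_pushout C j2 i3 r s" using pushout_ex[of j2 i3] g h by auto
  note b = is_pushoutD(1-8)[OF rs]
  \<comment> \<open>The third pushout completes the staircase over the middle apex; reading it by
    columns or by rows computes the two bracketings.\<close>
  obtain u v where uv: "is_pushout C q r u v" using pushout_ex[of q r] a b g by auto
  note c = is_pushoutD(1-8)[OF uv]
  have 1: "is_pushout C (j2 \<Zsemi> q) i3 u (s \<Zsemi> v)"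
    by (rule is_pushout_sym, rule is_pushout_paste[OF is_pushout_sym[OF rs] is_pushout_sym[OF uv]])
  have 2: "is_pushout C j1 (i2 \<Zsemi> r) (p \<Zsemi> u) v" by (rule is_pushout_paste[OF pq uv])
  have "f \<Zsemi>\<^bsub>B\<^esub> g \<Zsemi>\<^bsub>B\<^esub> h = K (i1 \<Zsemi> p) (j2 \<Zsemi> q) \<Zsemi>\<^bsub>B\<^esub> K i3 j3"
    unfolding f g h using cospan_class_seq[OF f(1-3) g(1-3) pq] by simp
  also have "\<dots> = K ((i1 \<Zsemi> p) \<Zsemi> u) (j3 \<Zsemi> (s \<Zsemi> v))"
    by (rule cospan_class_seq[OF _ _ _ _ _ _ 1]) (use f g h a b c in auto)
  also have "\<dots> = K (i1 \<Zsemi> (p \<Zsemi> u)) ((j3 \<Zsemi> s) \<Zsemi> v)" using f g h a b c by simp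
  also have "\<dots> = K i1 j1 \<Zsemi>\<^bsub>B\<^esub> K (i2 \<Zsemi> r) (j3 \<Zsemi> s)"
    by (rule cospan_class_seq[OF _ _ _ _ _ _ 2, symmetric]) (use f g h a b c in auto)
  also have "\<dots> = f \<Zsemi>\<^bsub>B\<^esub> (g \<Zsemi>\<^bsub>B\<^esub> h)"
    unfolding f g h using cospan_class_seq[OF g(1-3) h(1-3) rs] by simp
  finally show "f \<Zsemi>\<^bsub>B\<^esub> g \<Zsemi>\<^bsub>B\<^esub> h = f \<Zsemi>\<^bsub>B\<^esub> (g \<Zsemi>\<^bsub>B\<^esub> h)" .
qed

sublocale cospans: category B
  by (rule category_cospan)

lemma cospan_class_tarr [simp]:
  assumes "i \<in> Arr C" "j \<in> Arr C" "Cod C i = Cod C j" "i' \<in> Arr C" "j' \<in> Arr C" "Cod C i' = Cod C j'"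
  shows "K i j \<otimes>\<^bsub>B\<^esub> K i' j' = K (arrow_sum C P i i') (arrow_sum C P j j')"
proof -
  have t: "K i j \<otimes>\<^bsub>B\<^esub> K i' j' = \<Union>{K (arrow_sum C P k k') (arrow_sum C P l l') | k l k' l'.
        (k, l) \<in> K i j \<and> (k', l') \<in> K i' j'}"
    by (simp add: cospan_pcb_def)
  have "K (arrow_sum C P k k') (arrow_sum C P l l') = K (arrow_sum C P i i') (arrow_sum C P j j')"
    if kl: "(k, l) \<in> K i j" "(k', l') \<in> K i' j'" for k l k' l'
  proof -
    obtain h where h: "iso_arrow C h" "Dom C h = Cod C i" "k = i \<Zsemi> h" "l = j \<Zsemi> h"
      using kl(1) by (rule cospan_class_memE)
    obtain h' where h': "iso_arrow C h'" "Dom C h' = Cod C i'" "k' = i' \<Zsemi> h'" "l' = j' \<Zsemi> h'"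
      using kl(2) by (rule cospan_class_memE)
    have "K (arrow_sum C P i i' \<Zsemi> arrow_sum C P h h') (arrow_sum C P j j' \<Zsemi> arrow_sum C P h h') =
      K (arrow_sum C P i i') (arrow_sum C P j j')"
      by (rule cospan_class_iso)
        (use assms h h' iso_Arr[OF h(1)] iso_Arr[OF h'(1)] in \<open>auto intro: iso_arrow_sum\<close>)
    then show ?thesis using h h' assms iso_Arr[OF h(1)] iso_Arr[OF h'(1)] by simp
  qed
  then have "K i j \<otimes>\<^bsub>B\<^esub> K i' j' \<subseteq> K (arrow_sum C P i i') (arrow_sum C P j j')"
    unfolding t by blast
  moreover have "K (arrow_sum C P i i') (arrow_sum C P j j') \<subseteq> K i j \<otimes>\<^bsub>B\<^esub> K i' j'"
    unfolding t using cospan_class_self[OF assms(1-3)] cospan_class_self[OF assms(4-6)] by blast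
  ultimately show ?thesis by (rule subset_antisym)
qed

text \<open>The order asks for a witness between some representatives. Conjugating it with the
  isomorphisms to the given representatives produces a witness for those.\<close>

lemma cospan_class_leq:
  assumes "i \<in> Arr C" "j \<in> Arr C" "Cod C i = Cod C j" "i' \<in> Arr C" "j' \<in> Arr C" "Cod C i' = Cod C j'"
  shows "K i j \<lesssim>\<^bsub>B\<^esub> K i' j' \<longleftrightarrow>
    (\<exists>h. h \<in> Arr C \<and> Dom C h = Cod C i' \<and> Cod C h = Cod C i \<and> i' \<Zsemi> h = i \<and> j' \<Zsemi> h = j)"
    (is "_ \<longleftrightarrow> ?R")
proof -
  have leq: "K i j \<lesssim>\<^bsub>B\<^esub> K i' j' \<longleftrightarrow> (\<exists>k l k' l' x. (k, l) \<in> K i j \<and> (k', l') \<in> K i' j' \<and>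
    x \<in> Hom C (Cod C k') (Cod C k) \<and> k' \<Zsemi> x = k \<and> l' \<Zsemi> x = l)"
    by (simp add: cospan_pcb_def Bex_def)
  show ?thesis
  proof
    assume "K i j \<lesssim>\<^bsub>B\<^esub> K i' j'"
    then obtain k l k' l' x where kl: "(k, l) \<in> K i j" "(k', l') \<in> K i' j'"
      and x: "x \<in> Hom C (Cod C k') (Cod C k)" "k' \<Zsemi> x = k" "l' \<Zsemi> x = l"
      unfolding leq by auto
    obtain h where h: "iso_arrow C h" "Dom C h = Cod C i" "k = i \<Zsemi> h" "l = j \<Zsemi> h"
      using kl(1) by (rule cospan_class_memE)
    obtain g where g: "h \<in> Arr C" "g \<in> Arr C" "Dom C g = Cod C h" "Cod C g = Dom C h"
      "h \<Zsemi> g = ident C (Dom C h)"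
      using h(1) by (rule iso_arrowE)
    obtain h' where h': "iso_arrow C h'" "Dom C h' = Cod C i'" "k' = i' \<Zsemi> h'" "l' = j' \<Zsemi> h'"
      using kl(2) by (rule cospan_class_memE)
    note ah' = iso_Arr[OF h'(1)]
    have x': "x \<in> Arr C" "Dom C x = Cod C h'" "Cod C x = Cod C h"
      using x(1) h(3) h'(3) g(1) ah' h(2) h'(2) assms by (auto simp: Hom_def)
    have "i' \<Zsemi> (h' \<Zsemi> (x \<Zsemi> g)) = (k' \<Zsemi> x) \<Zsemi> g"
      using h'(2,3) ah' x' g(1-4) assms by simp
    also have "\<dots> = i" unfolding x(2) h(3) using g h(2) assms by simp
    finally have "i' \<Zsemi> (h' \<Zsemi> (x \<Zsemi> g)) = i" .
    moreover have "j' \<Zsemi> (h' \<Zsemi> (x \<Zsemi> g)) = (l' \<Zsemi> x) \<Zsemi> g"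
      using h'(2,4) ah' x' g(1-4) assms by simp
    then have "j' \<Zsemi> (h' \<Zsemi> (x \<Zsemi> g)) = j" unfolding x(3) h(4) using g h(2) assms by simp
    ultimately show ?R
      using ah' x' g(1-4) h(2) h'(2) assms by (intro exI[of _ "h' \<Zsemi> (x \<Zsemi> g)"]) simp
  next
    assume ?R
    then obtain h where "h \<in> Hom C (Cod C i') (Cod C i)" "i' \<Zsemi> h = i" "j' \<Zsemi> h = j"
      by (auto simp: Hom_def)
    then show "K i j \<lesssim>\<^bsub>B\<^esub> K i' j'"
      unfolding leq using cospan_class_self[OF assms(1-3)] cospan_class_self[OF assms(4-6)] by blast
  qed
qed

text \<open>\<open>star\<close> embeds the arrows of \<open>C\<close> covariantly as cospans,
  \<open>costar\<close> contravariantly. Monoid operations and structure isomorphisms are of the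
  first kind and comonoid operations of the second, so most bicategory laws reduce to equations
  between arrows of \<open>C\<close>.\<close>

definition star where "star f = K f (ident C (Cod C f))"
definition costar where "costar f = K (ident C (Cod C f)) f"

lemma star_arr [simp]:
  assumes "f \<in> Arr C"
  shows "star f \<in> Arr B" "Dom B (star f) = Dom C f" "Cod B (star f) = Cod C f"
  using assms unfolding star_def by auto

lemma costar_arr [simp]:
  assumes "f \<in> Arr C"
  shows "costar f \<in> Arr B" "Dom B (costar f) = Cod C f" "Cod B (costar f) = Dom C f"
  using assms unfolding costar_def by auto

lemma star_costar:
  assumes "i \<in> Arr C" "j \<in> Arr C" "Cod C i = Cod C j"
  shows "star i \<Zsemi>\<^bsub>B\<^esub> costar j = K i j"
  unfolding star_def costar_def
  by (subst cospan_class_seq[where p = "ident C (Cod C i)" and q = "ident C (Cod C i)"])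
    (use assms in \<open>auto intro: is_pushout_ident\<close>)

text \<open>A Beck-Chevalley rule: going back along \<open>f\<close> and then forward along
  \<open>g\<close> amounts to going forward and then back along the pushout. It supplies the only
  places where pushouts enter the bimonoid laws.\<close>

lemma costar_star:
  assumes "is_pushout C f g p q"
  shows "costar f \<Zsemi>\<^bsub>B\<^esub> star g = K p q"
  unfolding star_def costar_def
  by (subst cospan_class_seq[OF _ _ _ _ _ _ assms])
    (use is_pushoutD(1-8)[OF assms] in auto)

lemma cospan_class_star:
  assumes "i \<in> Arr C" "j \<in> Arr C" "Cod C i = Cod C j" "is_pushout C j g p q"
  shows "K i j \<Zsemi>\<^bsub>B\<^esub> star g = K (i \<Zsemi> p) q"
  unfolding star_def
  by (subst cospan_class_seq[OF _ _ _ _ _ _ assms(4)])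
    (use is_pushoutD(1-8)[OF assms(4)] assms in auto)

lemma star_cospan_class:
  assumes "i \<in> Arr C" "j \<in> Arr C" "Cod C i = Cod C j" "f \<in> Arr C" "Cod C f = Dom C i"
  shows "star f \<Zsemi>\<^bsub>B\<^esub> K i j = K (f \<Zsemi> i) j"
  unfolding star_def
  by (subst cospan_class_seq[where p = i and q = "ident C (Cod C i)"])
    (use assms in \<open>auto intro: is_pushout_ident\<close>)

lemma cospan_class_costar:
  assumes "i \<in> Arr C" "j \<in> Arr C" "Cod C i = Cod C j" "f \<in> Arr C" "Cod C f = Dom C j"
  shows "K i j \<Zsemi>\<^bsub>B\<^esub> costar f = K i (f \<Zsemi> j)"
  unfolding costar_def
  by (subst cospan_class_seq[where q = j and p = "ident C (Cod C i)"])
    (use assms in \<open>auto intro: is_pushout_ident\<close>)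

lemma star_seq [simp]:
  "f \<in> Arr C \<Longrightarrow> g \<in> Arr C \<Longrightarrow> Cod C f = Dom C g \<Longrightarrow> star f \<Zsemi>\<^bsub>B\<^esub> star g = star (f \<Zsemi> g)"
  using star_cospan_class[of g "ident C (Cod C g)" f] by (simp add: star_def)

lemma costar_seq [simp]:
  "f \<in> Arr C \<Longrightarrow> g \<in> Arr C \<Longrightarrow> Cod C f = Dom C g \<Longrightarrow> costar g \<Zsemi>\<^bsub>B\<^esub> costar f = costar (f \<Zsemi> g)"
  using cospan_class_costar[of "ident C (Cod C g)" g f] by (simp add: costar_def)

lemma star_tarr [simp]:
  "f \<in> Arr C \<Longrightarrow> g \<in> Arr C \<Longrightarrow> star f \<otimes>\<^bsub>B\<^esub> star g = star (arrow_sum C P f g)"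
  unfolding star_def by simp

lemma costar_tarr [simp]:
  "f \<in> Arr C \<Longrightarrow> g \<in> Arr C \<Longrightarrow> costar f \<otimes>\<^bsub>B\<^esub> costar g = costar (arrow_sum C P f g)"
  unfolding costar_def by simp

text \<open>Both sides are the same cospan up to rescaling the apex by \<open>b\<close>. This moves
  an isomorphism to the contravariant side, where it can be composed with comonoid
  operations.\<close>

lemma star_iso:
  assumes "a \<in> Arr C" "b \<in> Arr C" "Dom C b = Cod C a" "Cod C b = Dom C a"
    "a \<Zsemi> b = ident C (Dom C a)" "b \<Zsemi> a = ident C (Cod C a)"
  shows "star a = costar b"
proof -
  have "iso_arrow C b" by (rule iso_arrowI[of b a]) (use assms in auto)
  then have "K (a \<Zsemi> b) (ident C (Cod C a) \<Zsemi> b) = K a (ident C (Cod C a))"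
    using assms by (intro cospan_class_iso) auto
  then show ?thesis using assms by (simp add: star_def costar_def)
qed

lemma inverse_arrows_star:
  assumes "a \<in> Arr C" "b \<in> Arr C" "Dom C b = Cod C a" "Cod C b = Dom C a"
    "a \<Zsemi> b = ident C (Dom C a)" "b \<Zsemi> a = ident C (Cod C a)"
  shows "inverse_arrows B (star a) (star b)"
  unfolding inverse_arrows_def using assms
  by (auto simp: Hom_def) (auto simp: star_def cospan_pcb_ident)

lemma iso_arrow_star: "iso_arrow C a \<Longrightarrow> iso_arrow B (star a)"
  unfolding iso_arrow_def[of B]
  by (rule iso_arrowE, assumption) (blast intro: inverse_arrows_star)

text \<open>A common criterion for naturality squares: the arrows \<open>b\<close>,
  \<open>a\<close>, \<open>c\<close> form a map of cospans, and since \<open>a\<close> and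
  \<open>c\<close> are invertible, \<open>a\<close> and \<open>j'\<close> are a pushout of
  \<open>j\<close> and \<open>c\<close>. Both composites then have the right leg \<open>j'\<close>
  and equal left legs.\<close>

lemma cospan_class_natural:
  assumes "i \<in> Arr C" "j \<in> Arr C" "Cod C i = Cod C j" "i' \<in> Arr C" "j' \<in> Arr C" "Cod C i' = Cod C j'"
    "iso_arrow C a" "iso_arrow C c" "b \<in> Arr C" "Dom C b = Dom C i" "Cod C b = Dom C i'"
    "Dom C a = Cod C j" "Cod C a = Cod C j'" "Dom C c = Dom C j" "Cod C c = Dom C j'"
    "i \<Zsemi> a = b \<Zsemi> i'" "j \<Zsemi> a = c \<Zsemi> j'"
  shows "K i j \<Zsemi>\<^bsub>B\<^esub> star c = star b \<Zsemi>\<^bsub>B\<^esub> K i' j'"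
proof -
  have po: "is_pushout C j c a j'" by (rule is_pushout_iso_square) (use assms in auto)
  show ?thesis
    using cospan_class_star[OF assms(1-3) po] star_cospan_class[OF assms(4-6,9,11)] assms(16) by simp
qed

section \<open>Structure isomorphisms and the symmetric monoidal laws\<close>

definition assoc where
  "assoc X Y Z = copair C P
          (copair C P (leg1 P X (bin P Y Z)) (leg1 P Y Z \<Zsemi> leg2 P X (bin P Y Z)))
          (leg2 P Y Z \<Zsemi> leg2 P X (bin P Y Z))"

text \<open>The inverse is explicit because it is needed as an arrow of \<open>C\<close>, both for
  the right Frobenius law and to write the associator as a \<open>costar\<close>.\<close>

definition assoc_inv where
  "assoc_inv X Y Z = copair C P
          (leg1 P X Y \<Zsemi> leg1 P (bin P X Y) Z)
          (copair C P (leg2 P X Y \<Zsemi> leg1 P (bin P X Y) Z) (leg2 P (bin P X Y) Z))"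

lemma assoc_arr [simp]:
  assumes "X \<in> Obj C" "Y \<in> Obj C" "Z \<in> Obj C"
  shows "assoc X Y Z \<in> Arr C" "Dom C (assoc X Y Z) = bin P (bin P X Y) Z" "Cod C (assoc X Y Z) = bin P X (bin P Y Z)"
    "assoc_inv X Y Z \<in> Arr C" "Cod C (assoc_inv X Y Z) = bin P (bin P X Y) Z" "Dom C (assoc_inv X Y Z) = bin P X (bin P Y Z)"
  using assms unfolding assoc_def assoc_inv_def by auto

lemma assoc_inverse [simp]:
  assumes "X \<in> Obj C" "Y \<in> Obj C" "Z \<in> Obj C"
  shows "assoc X Y Z \<Zsemi> assoc_inv X Y Z = ident C (bin P (bin P X Y) Z)"
    "assoc_inv X Y Z \<Zsemi> assoc X Y Z = ident C (bin P X (bin P Y Z))"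
  using assms unfolding assoc_def assoc_inv_def by auto

lemma iso_assoc: "X \<in> Obj C \<Longrightarrow> Y \<in> Obj C \<Longrightarrow> Z \<in> Obj C \<Longrightarrow> iso_arrow C (assoc X Y Z)"
  by (rule iso_arrowI[of _ "assoc_inv X Y Z"]) auto

lemma iso_lunitor:
  assumes "X \<in> Obj C"
  shows "iso_arrow C (copair C P (initial_arrow C P X) (ident C X))"
proof (rule iso_arrowI[of _ "leg2 P (neutral P) X"])
  have "copair C P (initial_arrow C P (bin P (neutral P) X)) (leg2 P (neutral P) X) = ident C (bin P (neutral P) X)"
    by (rule bin_eqI[of _ _ "neutral P" X]) (use assms in \<open>auto intro: initial_eq\<close>)
  then show "copair C P (initial_arrow C P X) (ident C X) \<Zsemi> leg2 P (neutral P) X =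
      ident C (Dom C (copair C P (initial_arrow C P X) (ident C X)))"
    using assms by simp
qed (use assms in simp_all)

lemma iso_runitor:
  assumes "X \<in> Obj C"
  shows "iso_arrow C (copair C P (ident C X) (initial_arrow C P X))"
proof (rule iso_arrowI[of _ "leg1 P X (neutral P)"])
  have "copair C P (leg1 P X (neutral P)) (initial_arrow C P (bin P X (neutral P))) = ident C (bin P X (neutral P))"
    by (rule bin_eqI[of _ _ X "neutral P"]) (use assms in \<open>auto intro: initial_eq\<close>)
  then show "copair C P (ident C X) (initial_arrow C P X) \<Zsemi> leg1 P X (neutral P) =
      ident C (Dom C (copair C P (ident C X) (initial_arrow C P X)))"
    using assms by simp
qed (use assms in simp_all)

definition sym where "sym X Y = copair C P (leg2 P Y X) (leg1 P Y X)"

lemma sym_arr [simp]: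
  assumes "X \<in> Obj C" "Y \<in> Obj C"
  shows "sym X Y \<in> Arr C" "Dom C (sym X Y) = bin P X Y" "Cod C (sym X Y) = bin P Y X"
  using assms unfolding sym_def by auto

lemma sym_sym [simp]: "X \<in> Obj C \<Longrightarrow> Y \<in> Obj C \<Longrightarrow> sym X Y \<Zsemi> sym Y X = ident C (bin P X Y)"
  unfolding sym_def by simp

lemma iso_sym: "X \<in> Obj C \<Longrightarrow> Y \<in> Obj C \<Longrightarrow> iso_arrow C (sym X Y)"
  by (rule iso_arrowI[of _ "sym Y X"]) auto

abbreviation codiag where "codiag X \<equiv> copair C P (ident C X) (ident C X)"

text \<open>The identity appears both as a \<open>star\<close> and as a \<open>costar\<close>, so
  that it can join computations on either side; the proofs select the suitable equation by its
  index.\<close>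

lemma cospan_structure:
  "X \<in> Obj C \<Longrightarrow> ident B X = star (ident C X)"
  "X \<in> Obj C \<Longrightarrow> ident B X = costar (ident C X)"
  "X \<in> Obj C \<Longrightarrow> Y \<in> Obj C \<Longrightarrow> Z \<in> Obj C \<Longrightarrow> associator B X Y Z = star (assoc X Y Z)"
  "X \<in> Obj C \<Longrightarrow> lunitor B X = star (copair C P (initial_arrow C P X) (ident C X))"
  "X \<in> Obj C \<Longrightarrow> runitor B X = star (copair C P (ident C X) (initial_arrow C P X))"
  "X \<in> Obj C \<Longrightarrow> Y \<in> Obj C \<Longrightarrow> symmetry B X Y = star (sym X Y)"
  "X \<in> Obj C \<Longrightarrow> mult B X = star (codiag X)"
  "X \<in> Obj C \<Longrightarrow> unit_of B X = star (initial_arrow C P X)"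
  "X \<in> Obj C \<Longrightarrow> comult B X = costar (codiag X)"
  "X \<in> Obj C \<Longrightarrow> counit B X = costar (initial_arrow C P X)"
  by (simp_all add: star_def costar_def cospan_pcb_def assoc_def sym_def)

lemma symmetric_monoidal_cospan: "symmetric_monoidal_category B"
proof
  show "tunit B \<in> Obj B" by simp
  show "X \<oplus>\<^bsub>B\<^esub> Y \<in> Obj B" if "X \<in> Obj B" "Y \<in> Obj B" for X Y using that by simp
  show "f \<otimes>\<^bsub>B\<^esub> g \<in> Hom B (X \<oplus>\<^bsub>B\<^esub> Y) (X' \<oplus>\<^bsub>B\<^esub> Y')" if f: "f \<in> Hom B X X'" and g: "g \<in> Hom B Y Y'" for f g X X' Y Y'
  proof -
    obtain i1 j1 where 1: "i1 \<in> Arr C" "j1 \<in> Arr C" "Cod C i1 = Cod C j1" "Dom C i1 = X" "Dom C j1 = X'" "f = K i1 j1"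
      using f by (rule cospan_pcb_HomE)
    obtain i2 j2 where 2: "i2 \<in> Arr C" "j2 \<in> Arr C" "Cod C i2 = Cod C j2" "Dom C i2 = Y" "Dom C j2 = Y'" "g = K i2 j2"
      using g by (rule cospan_pcb_HomE)
    show ?thesis using 1 2 by (simp add: Hom_def)
  qed
  show "ident B X \<otimes>\<^bsub>B\<^esub> ident B Y = ident B (X \<oplus>\<^bsub>B\<^esub> Y)" if "X \<in> Obj B" "Y \<in> Obj B" for X Y
    using that by (simp add: cospan_structure)
  show "(f \<Zsemi>\<^bsub>B\<^esub> f') \<otimes>\<^bsub>B\<^esub> (g \<Zsemi>\<^bsub>B\<^esub> g') = (f \<otimes>\<^bsub>B\<^esub> g) \<Zsemi>\<^bsub>B\<^esub> (f' \<otimes>\<^bsub>B\<^esub> g')"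
    if f: "f \<in> Hom B X X'" and f': "f' \<in> Hom B X' X''" and g: "g \<in> Hom B Y Y'" and g': "g' \<in> Hom B Y' Y''"
    for f f' g g' X X' X'' Y Y' Y''
  proof -
    obtain i1 j1 where 1: "i1 \<in> Arr C" "j1 \<in> Arr C" "Cod C i1 = Cod C j1" "Dom C i1 = X" "Dom C j1 = X'" "f = K i1 j1"
      using f by (rule cospan_pcb_HomE)
    obtain i2 j2 where 2: "i2 \<in> Arr C" "j2 \<in> Arr C" "Cod C i2 = Cod C j2" "Dom C i2 = X'" "Dom C j2 = X''" "f' = K i2 j2"
      using f' by (rule cospan_pcb_HomE)
    obtain i3 j3 where 3: "i3 \<in> Arr C" "j3 \<in> Arr C" "Cod C i3 = Cod C j3" "Dom C i3 = Y" "Dom C j3 = Y'" "g = K i3 j3"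
      using g by (rule cospan_pcb_HomE)
    obtain i4 j4 where 4: "i4 \<in> Arr C" "j4 \<in> Arr C" "Cod C i4 = Cod C j4" "Dom C i4 = Y'" "Dom C j4 = Y''" "g' = K i4 j4"
      using g' by (rule cospan_pcb_HomE)
    obtain p q where pq: "is_pushout C j1 i2 p q" using pushout_ex[of j1 i2] 1 2 by auto
    obtain r s where rs: "is_pushout C j3 i4 r s" using pushout_ex[of j3 i4] 3 4 by auto
    note a = is_pushoutD(1-8)[OF pq] and b = is_pushoutD(1-8)[OF rs]
    \<comment> \<open>Summing the two chosen pushouts gives a pushout for the composite of the sums,
      hence both sides have the same representative.\<close>
    show ?thesis
      unfolding 1(6) 2(6) 3(6) 4(6) cospan_class_seq[OF 1(1-3) 2(1-3) pq] cospan_class_seq[OF 3(1-3) 4(1-3) rs]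
      by (subst (2 3) cospan_class_tarr, simp_all add: 1 2 3 4)
        (subst cospan_class_seq[OF _ _ _ _ _ _ is_pushout_sum[OF pq rs]], use 1 2 3 4 a b in simp_all)
  qed
  show "associator B X Y Z \<in> Hom B ((X \<oplus>\<^bsub>B\<^esub> Y) \<oplus>\<^bsub>B\<^esub> Z) (X \<oplus>\<^bsub>B\<^esub> (Y \<oplus>\<^bsub>B\<^esub> Z))"
    "iso_arrow B (associator B X Y Z)"
    if "X \<in> Obj B" "Y \<in> Obj B" "Z \<in> Obj B" for X Y Z
    using that by (auto simp: cospan_structure Hom_def intro: iso_arrow_star iso_assoc)
  show "((f \<otimes>\<^bsub>B\<^esub> g) \<otimes>\<^bsub>B\<^esub> h) \<Zsemi>\<^bsub>B\<^esub> associator B X' Y' Z' = associator B X Y Z \<Zsemi>\<^bsub>B\<^esub> (f \<otimes>\<^bsub>B\<^esub> (g \<otimes>\<^bsub>B\<^esub> h))"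
    if f: "f \<in> Hom B X X'" and g: "g \<in> Hom B Y Y'" and h: "h \<in> Hom B Z Z'" for f g h X X' Y Y' Z Z'
  proof -
    obtain i1 j1 where 1: "i1 \<in> Arr C" "j1 \<in> Arr C" "Cod C i1 = Cod C j1" "Dom C i1 = X" "Dom C j1 = X'" "f = K i1 j1"
      using f by (rule cospan_pcb_HomE)
    obtain i2 j2 where 2: "i2 \<in> Arr C" "j2 \<in> Arr C" "Cod C i2 = Cod C j2" "Dom C i2 = Y" "Dom C j2 = Y'" "g = K i2 j2"
      using g by (rule cospan_pcb_HomE)
    obtain i3 j3 where 3: "i3 \<in> Arr C" "j3 \<in> Arr C" "Cod C i3 = Cod C j3" "Dom C i3 = Z" "Dom C j3 = Z'" "h = K i3 j3"
      using h by (rule cospan_pcb_HomE)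
    have o: "X \<in> Obj C" "Y \<in> Obj C" "Z \<in> Obj C" "X' \<in> Obj C" "Y' \<in> Obj C" "Z' \<in> Obj C"
      using 1 2 3 by auto
    have as: "associator B X Y Z = star (assoc X Y Z)" "associator B X' Y' Z' = star (assoc X' Y' Z')"
      using o by (simp_all add: cospan_structure)
    \<comment> \<open>The map between apexes required for naturality is the same rebracketing arrow,
      taken at the three apexes instead of the feet.\<close>
    show ?thesis
      unfolding as 1(6) 2(6) 3(6) using 1 2 3 o apply (simp)
      by (rule cospan_class_natural[where a = "assoc (Cod C j1) (Cod C j2) (Cod C j3)"])
        (simp_all add: iso_assoc, simp_all add: assoc_def arrow_sum_def)
  qed
  show "lunitor B X \<in> Hom B (tunit B \<oplus>\<^bsub>B\<^esub> X) X" "iso_arrow B (lunitor B X)"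
    "runitor B X \<in> Hom B (X \<oplus>\<^bsub>B\<^esub> tunit B) X" "iso_arrow B (runitor B X)" if "X \<in> Obj B" for X
    using that by (auto simp: cospan_structure Hom_def intro!: iso_arrow_star iso_lunitor iso_runitor)
  show "ident B (tunit B) \<otimes>\<^bsub>B\<^esub> f \<Zsemi>\<^bsub>B\<^esub> lunitor B Y = lunitor B X \<Zsemi>\<^bsub>B\<^esub> f"
    "f \<otimes>\<^bsub>B\<^esub> ident B (tunit B) \<Zsemi>\<^bsub>B\<^esub> runitor B Y = runitor B X \<Zsemi>\<^bsub>B\<^esub> f"
    if f: "f \<in> Hom B X Y" for f X Y
  proof -
    obtain i j where 1: "i \<in> Arr C" "j \<in> Arr C" "Cod C i = Cod C j" "Dom C i = X" "Dom C j = Y" "f = K i j"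
      using f by (rule cospan_pcb_HomE)
    have o: "X \<in> Obj C" "Y \<in> Obj C" using 1 by auto
    have as: "lunitor B X = star (copair C P (initial_arrow C P X) (ident C X))"
      "lunitor B Y = star (copair C P (initial_arrow C P Y) (ident C Y))"
      "runitor B X = star (copair C P (ident C X) (initial_arrow C P X))"
      "runitor B Y = star (copair C P (ident C Y) (initial_arrow C P Y))"
      using o by (simp_all add: cospan_structure)
    show "ident B (tunit B) \<otimes>\<^bsub>B\<^esub> f \<Zsemi>\<^bsub>B\<^esub> lunitor B Y = lunitor B X \<Zsemi>\<^bsub>B\<^esub> f"
      unfolding as 1(6) cospan_pcb_ident using 1 o apply simp
      by (rule cospan_class_natural[where a = "copair C P (initial_arrow C P (Cod C j)) (ident C (Cod C j))"])
        (simp_all add: iso_lunitor)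
    show "f \<otimes>\<^bsub>B\<^esub> ident B (tunit B) \<Zsemi>\<^bsub>B\<^esub> runitor B Y = runitor B X \<Zsemi>\<^bsub>B\<^esub> f"
      unfolding as 1(6) cospan_pcb_ident using 1 o apply simp
      by (rule cospan_class_natural[where a = "copair C P (ident C (Cod C j)) (initial_arrow C P (Cod C j))"])
        (simp_all add: iso_runitor)
  qed
  show "symmetry B X Y \<in> Hom B (X \<oplus>\<^bsub>B\<^esub> Y) (Y \<oplus>\<^bsub>B\<^esub> X)"
    "symmetry B X Y \<Zsemi>\<^bsub>B\<^esub> symmetry B Y X = ident B (X \<oplus>\<^bsub>B\<^esub> Y)"
    if "X \<in> Obj B" "Y \<in> Obj B" for X Y
    using that by (auto simp: cospan_structure Hom_def)
  show "f \<otimes>\<^bsub>B\<^esub> g \<Zsemi>\<^bsub>B\<^esub> symmetry B X' Y' = symmetry B X Y \<Zsemi>\<^bsub>B\<^esub> (g \<otimes>\<^bsub>B\<^esub> f)"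
    if f: "f \<in> Hom B X X'" and g: "g \<in> Hom B Y Y'" for f g X X' Y Y'
  proof -
    obtain i1 j1 where 1: "i1 \<in> Arr C" "j1 \<in> Arr C" "Cod C i1 = Cod C j1" "Dom C i1 = X" "Dom C j1 = X'" "f = K i1 j1"
      using f by (rule cospan_pcb_HomE)
    obtain i2 j2 where 2: "i2 \<in> Arr C" "j2 \<in> Arr C" "Cod C i2 = Cod C j2" "Dom C i2 = Y" "Dom C j2 = Y'" "g = K i2 j2"
      using g by (rule cospan_pcb_HomE)
    have o: "X \<in> Obj C" "Y \<in> Obj C" "X' \<in> Obj C" "Y' \<in> Obj C" using 1 2 by auto
    have as: "symmetry B X Y = star (sym X Y)" "symmetry B X' Y' = star (sym X' Y')"
      using o by (simp_all add: cospan_structure)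
    show ?thesis
      unfolding as 1(6) 2(6) using 1 2 o apply (simp)
      by (rule cospan_class_natural[where a = "sym (Cod C j1) (Cod C j2)"])
        (simp_all add: iso_sym, simp_all add: sym_def arrow_sum_def)
  qed
  \<comment> \<open>In the three coherence laws every factor is a \<open>star\<close>, so each side
    collapses to the \<open>star\<close> of one arrow of \<open>C\<close>; unfolding
    \<open>assoc\<close> then compares nested copairs.\<close>
  show "associator B (W \<oplus>\<^bsub>B\<^esub> X) Y Z \<Zsemi>\<^bsub>B\<^esub> associator B W X (Y \<oplus>\<^bsub>B\<^esub> Z) =
      associator B W X Y \<otimes>\<^bsub>B\<^esub> ident B Z \<Zsemi>\<^bsub>B\<^esub> associator B W (X \<oplus>\<^bsub>B\<^esub> Y) Z \<Zsemi>\<^bsub>B\<^esub>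
        (ident B W \<otimes>\<^bsub>B\<^esub> associator B X Y Z)"
    if "W \<in> Obj B" "X \<in> Obj B" "Y \<in> Obj B" "Z \<in> Obj B" for W X Y Z
    using that by (simp add: cospan_structure) (simp add: assoc_def arrow_sum_def)
  show "associator B X (tunit B) Y \<Zsemi>\<^bsub>B\<^esub> (ident B X \<otimes>\<^bsub>B\<^esub> lunitor B Y) = runitor B X \<otimes>\<^bsub>B\<^esub> ident B Y"
    if "X \<in> Obj B" "Y \<in> Obj B" for X Y
    using that by (simp add: cospan_structure) (simp add: assoc_def arrow_sum_def)
  show "associator B X Y Z \<Zsemi>\<^bsub>B\<^esub> symmetry B X (Y \<oplus>\<^bsub>B\<^esub> Z) \<Zsemi>\<^bsub>B\<^esub> associator B Y Z X =
      symmetry B X Y \<otimes>\<^bsub>B\<^esub> ident B Z \<Zsemi>\<^bsub>B\<^esub> associator B Y X Z \<Zsemi>\<^bsub>B\<^esub> (ident B Y \<otimes>\<^bsub>B\<^esub> symmetry B X Z)"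
    if "X \<in> Obj B" "Y \<in> Obj B" "Z \<in> Obj B" for X Y Z
    using that by (simp add: cospan_structure) (simp add: assoc_def arrow_sum_def sym_def)
qed

text \<open>The two legs glue three copies of \<open>X\<close> in overlapping pairs: first with
  second, and second with third. The pushout therefore identifies all of them, and both cocone legs
  are the codiagonal, which is also the cospan of multiplication followed by
  comultiplication.\<close>

lemma is_pushout_frobenius:
  assumes X: "X \<in> Obj C"
  shows "is_pushout C (arrow_sum C P (codiag X) (ident C X)) (assoc X X X \<Zsemi> arrow_sum C P (ident C X) (codiag X))
    (codiag X) (codiag X)"
    and "is_pushout C (arrow_sum C P (ident C X) (codiag X)) (assoc_inv X X X \<Zsemi> arrow_sum C P (codiag X) (ident C X))
    (codiag X) (codiag X)"
proof -
  have eqI: "h = k" if "h \<in> Arr C" "k \<in> Arr C" "Dom C h = X" "Dom C k = X" "codiag X \<Zsemi> h = codiag X \<Zsemi> k" for h k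
  proof -
    have "leg1 P X X \<Zsemi> (codiag X \<Zsemi> h) = leg1 P X X \<Zsemi> (codiag X \<Zsemi> k)" using that(5) by simp
    then show ?thesis using that(1-4) X by simp
  qed
  \<comment> \<open>From the outer two summands come the two equations giving \<open>p = q\<close>;
    the middle summand makes the two restrictions of \<open>p\<close> coincide, so \<open>p\<close>
    factors through the codiagonal by its first restriction.\<close>
  have ex: "\<exists>h. h \<in> Arr C \<and> Dom C h = X \<and> Cod C h = Cod C q \<and> codiag X \<Zsemi> h = p \<and> codiag X \<Zsemi> h = q"
    if *: "p \<in> Arr C" "q \<in> Arr C" "Dom C p = bin P X X" "Dom C q = bin P X X" "Cod C p = Cod C q"
      "leg1 P X X \<Zsemi> p = leg1 P X X \<Zsemi> q" "leg2 P X X \<Zsemi> p = leg2 P X X \<Zsemi> q"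
      "leg1 P X X \<Zsemi> p = leg2 P X X \<Zsemi> p" for p q
  proof -
    have "p = q" by (rule bin_eqI[of _ _ X X]) (use * X in auto)
    moreover have "codiag X \<Zsemi> (leg1 P X X \<Zsemi> p) = p"
      by (rule bin_eqI[of _ _ X X]) (use *(1-5,8) X in simp_all)
    ultimately show ?thesis using * X by (intro exI[of _ "leg1 P X X \<Zsemi> p"]) simp
  qed
  show "is_pushout C (arrow_sum C P (codiag X) (ident C X)) (assoc X X X \<Zsemi> arrow_sum C P (ident C X) (codiag X))
    (codiag X) (codiag X)"
  proof (rule is_pushoutI)
    fix p q assume *: "p \<in> Arr C" "q \<in> Arr C" "Dom C p = Cod C (arrow_sum C P (codiag X) (ident C X))"
      "Dom C q = Cod C (assoc X X X \<Zsemi> arrow_sum C P (ident C X) (codiag X))" "Cod C p = Cod C q"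
      "arrow_sum C P (codiag X) (ident C X) \<Zsemi> p = (assoc X X X \<Zsemi> arrow_sum C P (ident C X) (codiag X)) \<Zsemi> q"
    let ?l = "leg1 P (bin P X X) X" and ?r = "leg2 P (bin P X X) X"
    \<comment> \<open>The cocone equation is tested on each of the three copies of
      \<open>X\<close>.\<close>
    have "(leg1 P X X \<Zsemi> ?l) \<Zsemi> (arrow_sum C P (codiag X) (ident C X) \<Zsemi> p) =
        (leg1 P X X \<Zsemi> ?l) \<Zsemi> ((assoc X X X \<Zsemi> arrow_sum C P (ident C X) (codiag X)) \<Zsemi> q)"
      "(leg2 P X X \<Zsemi> ?l) \<Zsemi> (arrow_sum C P (codiag X) (ident C X) \<Zsemi> p) =
        (leg2 P X X \<Zsemi> ?l) \<Zsemi> ((assoc X X X \<Zsemi> arrow_sum C P (ident C X) (codiag X)) \<Zsemi> q)"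
      "?r \<Zsemi> (arrow_sum C P (codiag X) (ident C X) \<Zsemi> p) =
        ?r \<Zsemi> ((assoc X X X \<Zsemi> arrow_sum C P (ident C X) (codiag X)) \<Zsemi> q)"
      unfolding *(6) by (rule refl)+
    then have "leg1 P X X \<Zsemi> p = leg1 P X X \<Zsemi> q" "leg1 P X X \<Zsemi> p = leg2 P X X \<Zsemi> q"
      "leg2 P X X \<Zsemi> p = leg2 P X X \<Zsemi> q"
      using *(1-5) X by (simp_all add: assoc_def arrow_sum_def)
    then have "\<exists>h. h \<in> Arr C \<and> Dom C h = X \<and> Cod C h = Cod C q \<and> codiag X \<Zsemi> h = p \<and> codiag X \<Zsemi> h = q"
      using *(1-5) X by (intro ex) simp_all
    then show "\<exists>h. h \<in> Arr C \<and> Dom C h = Cod C (codiag X) \<and> Cod C h = Cod C q \<and> codiag X \<Zsemi> h = p \<and> codiag X \<Zsemi> h = q"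
      using X by simp
  qed (use X eqI in \<open>simp_all add: assoc_def arrow_sum_def\<close>)
  show "is_pushout C (arrow_sum C P (ident C X) (codiag X)) (assoc_inv X X X \<Zsemi> arrow_sum C P (codiag X) (ident C X))
    (codiag X) (codiag X)"
  proof (rule is_pushoutI)
    fix p q assume *: "p \<in> Arr C" "q \<in> Arr C" "Dom C p = Cod C (arrow_sum C P (ident C X) (codiag X))"
      "Dom C q = Cod C (assoc_inv X X X \<Zsemi> arrow_sum C P (codiag X) (ident C X))" "Cod C p = Cod C q"
      "arrow_sum C P (ident C X) (codiag X) \<Zsemi> p = (assoc_inv X X X \<Zsemi> arrow_sum C P (codiag X) (ident C X)) \<Zsemi> q"
    let ?l = "leg1 P X (bin P X X)" and ?r = "leg2 P X (bin P X X)"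
    have "(leg1 P X X \<Zsemi> ?r) \<Zsemi> (arrow_sum C P (ident C X) (codiag X) \<Zsemi> p) =
        (leg1 P X X \<Zsemi> ?r) \<Zsemi> ((assoc_inv X X X \<Zsemi> arrow_sum C P (codiag X) (ident C X)) \<Zsemi> q)"
      "(leg2 P X X \<Zsemi> ?r) \<Zsemi> (arrow_sum C P (ident C X) (codiag X) \<Zsemi> p) =
        (leg2 P X X \<Zsemi> ?r) \<Zsemi> ((assoc_inv X X X \<Zsemi> arrow_sum C P (codiag X) (ident C X)) \<Zsemi> q)"
      "?l \<Zsemi> (arrow_sum C P (ident C X) (codiag X) \<Zsemi> p) =
        ?l \<Zsemi> ((assoc_inv X X X \<Zsemi> arrow_sum C P (codiag X) (ident C X)) \<Zsemi> q)"
      unfolding *(6) by (rule refl)+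
    then have "leg1 P X X \<Zsemi> p = leg1 P X X \<Zsemi> q" "leg2 P X X \<Zsemi> p = leg1 P X X \<Zsemi> q"
      "leg2 P X X \<Zsemi> p = leg2 P X X \<Zsemi> q"
      using *(1-5) X by (simp_all add: assoc_inv_def arrow_sum_def)
    then have "\<exists>h. h \<in> Arr C \<and> Dom C h = X \<and> Cod C h = Cod C q \<and> codiag X \<Zsemi> h = p \<and> codiag X \<Zsemi> h = q"
      using *(1-5) X by (intro ex) simp_all
    then show "\<exists>h. h \<in> Arr C \<and> Dom C h = Cod C (codiag X) \<and> Cod C h = Cod C q \<and> codiag X \<Zsemi> h = p \<and> codiag X \<Zsemi> h = q"
      using X by simp
  qed (use X eqI in \<open>simp_all add: assoc_inv_def arrow_sum_def\<close>)
qed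

section \<open>Compatibility of the preorder with the structure\<close>

lemma cospan_seq_mono:
  assumes f: "f \<in> Hom B X Y" and f': "f' \<in> Hom B X Y" and g: "g \<in> Hom B Y Z" and g': "g' \<in> Hom B Y Z"
    and ff': "f \<lesssim>\<^bsub>B\<^esub> f'" and gg': "g \<lesssim>\<^bsub>B\<^esub> g'"
  shows "f \<Zsemi>\<^bsub>B\<^esub> g \<lesssim>\<^bsub>B\<^esub> f' \<Zsemi>\<^bsub>B\<^esub> g'"
proof -
  obtain i1 j1 where 1: "i1 \<in> Arr C" "j1 \<in> Arr C" "Cod C i1 = Cod C j1" "Dom C i1 = X" "Dom C j1 = Y" "f = K i1 j1"
    using f by (rule cospan_pcb_HomE)
  obtain i2 j2 where 2: "i2 \<in> Arr C" "j2 \<in> Arr C" "Cod C i2 = Cod C j2" "Dom C i2 = X" "Dom C j2 = Y" "f' = K i2 j2"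
    using f' by (rule cospan_pcb_HomE)
  obtain i3 j3 where 3: "i3 \<in> Arr C" "j3 \<in> Arr C" "Cod C i3 = Cod C j3" "Dom C i3 = Y" "Dom C j3 = Z" "g = K i3 j3"
    using g by (rule cospan_pcb_HomE)
  obtain i4 j4 where 4: "i4 \<in> Arr C" "j4 \<in> Arr C" "Cod C i4 = Cod C j4" "Dom C i4 = Y" "Dom C j4 = Z" "g' = K i4 j4"
    using g' by (rule cospan_pcb_HomE)
  obtain p q where pq: "is_pushout C j1 i3 p q" using pushout_ex[of j1 i3] 1 3 by auto
  obtain r s where rs: "is_pushout C j2 i4 r s" using pushout_ex[of j2 i4] 2 4 by auto
  note a = is_pushoutD[OF pq] and b = is_pushoutD[OF rs]
  obtain h where h: "h \<in> Arr C" "Dom C h = Cod C i2" "Cod C h = Cod C i1" "i2 \<Zsemi> h = i1" "j2 \<Zsemi> h = j1"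
    using ff' unfolding 1(6) 2(6) cospan_class_leq[OF 1(1-3) 2(1-3)] by auto
  obtain k where k: "k \<in> Arr C" "Dom C k = Cod C i4" "Cod C k = Cod C i3" "i4 \<Zsemi> k = i3" "j4 \<Zsemi> k = j3"
    using gg' unfolding 3(6) 4(6) cospan_class_leq[OF 3(1-3) 4(1-3)] by auto
  \<comment> \<open>The witnesses \<open>h\<close> and \<open>k\<close>, followed by the smaller
    composite's pushout legs, form a cocone over the larger composite's inner legs. Its mediating
    arrow witnesses the inequality.\<close>
  have "j2 \<Zsemi> (h \<Zsemi> p) = (j2 \<Zsemi> h) \<Zsemi> p" using 1 2 h(1-3) a(1-8) by simp
  also have "\<dots> = i3 \<Zsemi> q" unfolding h(5) by (rule a)
  also have "\<dots> = i4 \<Zsemi> (k \<Zsemi> q)" unfolding k(4)[symmetric] using 3(3-) 4 k(1-3) a(2-8) by simp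
  finally have eq: "j2 \<Zsemi> (h \<Zsemi> p) = i4 \<Zsemi> (k \<Zsemi> q)" .
  obtain u where u: "u \<in> Arr C" "Dom C u = Cod C r" "Cod C u = Cod C p" "r \<Zsemi> u = h \<Zsemi> p" "s \<Zsemi> u = k \<Zsemi> q"
    by (rule is_pushout_ex[OF rs _ _ _ _ _ eq]) (use 1 2 3 4 h(1-3) k(1-3) a(1-8) in simp_all)
  have "i2 \<Zsemi> (r \<Zsemi> u) = (i2 \<Zsemi> h) \<Zsemi> p" unfolding u(4) using 1 2 h(1-3) a(1-8) by simp
  then have e1: "i2 \<Zsemi> (r \<Zsemi> u) = i1 \<Zsemi> p" unfolding h(4) .
  have "j4 \<Zsemi> (s \<Zsemi> u) = (j4 \<Zsemi> k) \<Zsemi> q" unfolding u(5) using 3 4 k(1-3) a(1-8) by simp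
  then have e2: "j4 \<Zsemi> (s \<Zsemi> u) = j3 \<Zsemi> q" unfolding k(5) .
  show ?thesis
    unfolding 1(6) 2(6) 3(6) 4(6) cospan_class_seq[OF 1(1-3) 3(1-3) pq] cospan_class_seq[OF 2(1-3) 4(1-3) rs]
    by (subst cospan_class_leq) (use 1 2 3 4 a(1-8) b(1-8) u(1-3) e1 e2 in auto)
qed

lemma cospan_tarr_mono:
  assumes f: "f \<in> Hom B X Y" and f': "f' \<in> Hom B X Y" and g: "g \<in> Hom B W Z" and g': "g' \<in> Hom B W Z"
    and ff': "f \<lesssim>\<^bsub>B\<^esub> f'" and gg': "g \<lesssim>\<^bsub>B\<^esub> g'"
  shows "f \<otimes>\<^bsub>B\<^esub> g \<lesssim>\<^bsub>B\<^esub> f' \<otimes>\<^bsub>B\<^esub> g'"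
proof -
  obtain i1 j1 where 1: "i1 \<in> Arr C" "j1 \<in> Arr C" "Cod C i1 = Cod C j1" "Dom C i1 = X" "Dom C j1 = Y" "f = K i1 j1"
    using f by (rule cospan_pcb_HomE)
  obtain i2 j2 where 2: "i2 \<in> Arr C" "j2 \<in> Arr C" "Cod C i2 = Cod C j2" "Dom C i2 = X" "Dom C j2 = Y" "f' = K i2 j2"
    using f' by (rule cospan_pcb_HomE)
  obtain i3 j3 where 3: "i3 \<in> Arr C" "j3 \<in> Arr C" "Cod C i3 = Cod C j3" "Dom C i3 = W" "Dom C j3 = Z" "g = K i3 j3"
    using g by (rule cospan_pcb_HomE)
  obtain i4 j4 where 4: "i4 \<in> Arr C" "j4 \<in> Arr C" "Cod C i4 = Cod C j4" "Dom C i4 = W" "Dom C j4 = Z" "g' = K i4 j4"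
    using g' by (rule cospan_pcb_HomE)
  obtain h where h: "h \<in> Arr C" "Dom C h = Cod C i2" "Cod C h = Cod C i1" "i2 \<Zsemi> h = i1" "j2 \<Zsemi> h = j1"
    using ff' unfolding 1(6) 2(6) cospan_class_leq[OF 1(1-3) 2(1-3)] by auto
  obtain k where k: "k \<in> Arr C" "Dom C k = Cod C i4" "Cod C k = Cod C i3" "i4 \<Zsemi> k = i3" "j4 \<Zsemi> k = j3"
    using gg' unfolding 3(6) 4(6) cospan_class_leq[OF 3(1-3) 4(1-3)] by auto
  have "arrow_sum C P i2 i4 \<Zsemi> arrow_sum C P h k = arrow_sum C P i1 i3"
    "arrow_sum C P j2 j4 \<Zsemi> arrow_sum C P h k = arrow_sum C P j1 j3"
    using 1 2 3 4 h k by simp_all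
  then show ?thesis
    unfolding 1(6) 2(6) 3(6) 4(6) using 1 2 3 4 h(1-3) k(1-3)
    by (simp add: cospan_class_leq) (intro exI[of _ "arrow_sum C P h k"], simp)
qed

lemma cospan_comult_lax:
  assumes R: "R \<in> Hom B X Y"
  shows "R \<Zsemi>\<^bsub>B\<^esub> \<delta>\<^bsub>B\<^esub> Y \<lesssim>\<^bsub>B\<^esub> \<delta>\<^bsub>B\<^esub> X \<Zsemi>\<^bsub>B\<^esub> (R \<otimes>\<^bsub>B\<^esub> R)"
proof -
  obtain i j where 1: "i \<in> Arr C" "j \<in> Arr C" "Cod C i = Cod C j" "Dom C i = X" "Dom C j = Y" "R = K i j"
    using R by (rule cospan_pcb_HomE)
  have o: "X \<in> Obj C" "Y \<in> Obj C" using 1 by auto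
  have d: "\<delta>\<^bsub>B\<^esub> X = K (ident C X) (codiag X)" "\<delta>\<^bsub>B\<^esub> Y = costar (codiag Y)"
    using o by (simp_all add: cospan_structure) (simp add: costar_def)
  obtain p q where pq: "is_pushout C (codiag X) (arrow_sum C P i i) p q"
    using pushout_ex[of "codiag X" "arrow_sum C P i i"] 1 o by auto
  note a = is_pushoutD(1-8)[OF pq]
  have ac: "Dom C q = bin P (Cod C j) (Cod C j)" "Cod C q = Cod C p" "p \<in> Arr C" "q \<in> Arr C" "Dom C p = X"
    using a 1 o by auto
  \<comment> \<open>Naturality of the codiagonal makes \<open>i\<close> and the codiagonal of the
    apex a cocone on the pushout that defines the right-hand side. The mediating arrow merges its
    copies of the apex into one.\<close>
  have eq: "codiag X \<Zsemi> i = arrow_sum C P i i \<Zsemi> codiag (Cod C j)" using 1 o by simp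
  obtain h where h: "h \<in> Arr C" "Dom C h = Cod C p" "Cod C h = Cod C i" "p \<Zsemi> h = i" "q \<Zsemi> h = codiag (Cod C j)"
    by (rule is_pushout_ex[OF pq _ _ _ _ _ eq]) (use 1 o in simp_all)
  have l: "R \<Zsemi>\<^bsub>B\<^esub> \<delta>\<^bsub>B\<^esub> Y = K i (codiag Y \<Zsemi> j)"
    unfolding d 1(6) by (rule cospan_class_costar) (use 1 o in auto)
  have r: "\<delta>\<^bsub>B\<^esub> X \<Zsemi>\<^bsub>B\<^esub> (R \<otimes>\<^bsub>B\<^esub> R) = K p (arrow_sum C P j j \<Zsemi> q)"
    unfolding d 1(6) cospan_class_tarr[OF 1(1-3) 1(1-3)]
    by (subst cospan_class_seq[OF _ _ _ _ _ _ pq]) (use 1 o ac in auto)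
  have e: "(arrow_sum C P j j \<Zsemi> q) \<Zsemi> h = codiag Y \<Zsemi> j"
    using 1 o ac h(1-3,5) by simp
  show ?thesis
    unfolding l r
  proof (subst cospan_class_leq)
    show "\<exists>h. h \<in> Arr C \<and> Dom C h = Cod C p \<and> Cod C h = Cod C i \<and> p \<Zsemi> h = i \<and>
      (arrow_sum C P j j \<Zsemi> q) \<Zsemi> h = codiag Y \<Zsemi> j"
      using h e by blast
  qed (use 1 o ac in simp_all)
qed

lemma cospan_counit_lax:
  assumes R: "R \<in> Hom B X Y"
  shows "R \<Zsemi>\<^bsub>B\<^esub> \<epsilon>\<^bsub>B\<^esub> Y \<lesssim>\<^bsub>B\<^esub> \<epsilon>\<^bsub>B\<^esub> X"
proof -
  obtain i j where 1: "i \<in> Arr C" "j \<in> Arr C" "Cod C i = Cod C j" "Dom C i = X" "Dom C j = Y" "R = K i j"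
    using R by (rule cospan_pcb_HomE)
  have o: "X \<in> Obj C" "Y \<in> Obj C" using 1 by auto
  have d: "\<epsilon>\<^bsub>B\<^esub> X = K (ident C X) (initial_arrow C P X)" "\<epsilon>\<^bsub>B\<^esub> Y = costar (initial_arrow C P Y)"
    using o by (simp_all add: cospan_structure) (simp add: costar_def)
  have l: "R \<Zsemi>\<^bsub>B\<^esub> \<epsilon>\<^bsub>B\<^esub> Y = K i (initial_arrow C P Y \<Zsemi> j)"
    unfolding d 1(6) by (rule cospan_class_costar) (use 1 o in auto)
  show ?thesis
    unfolding l d(1)
  proof (subst cospan_class_leq)
    show "\<exists>h. h \<in> Arr C \<and> Dom C h = Cod C (ident C X) \<and> Cod C h = Cod C i \<and> ident C X \<Zsemi> h = i \<and>
      initial_arrow C P X \<Zsemi> h = initial_arrow C P Y \<Zsemi> j"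
      \<comment> \<open>The left leg \<open>i\<close> is itself the witness; the condition on the
        right legs compares two arrows out of the initial object.\<close>
      using 1 o by (intro exI[of _ i]) simp
  qed (use 1 o in simp_all)
qed

theorem pcb_cospan: "preordered_cartesian_bicategory B"
proof -
  interpret symmetric_monoidal_category B by (rule symmetric_monoidal_cospan)
  show ?thesis
  proof
    show "f \<lesssim>\<^bsub>B\<^esub> f" if f: "f \<in> Hom B X Y" for f X Y
    proof -
      obtain i j where 1: "i \<in> Arr C" "j \<in> Arr C" "Cod C i = Cod C j" "Dom C i = X" "Dom C j = Y" "f = K i j"
        using f by (rule cospan_pcb_HomE)
      show ?thesis unfolding 1(6) cospan_class_leq[OF 1(1-3) 1(1-3)]
        using 1 by (intro exI[of _ "ident C (Cod C j)"]) auto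
    qed
    show "f \<lesssim>\<^bsub>B\<^esub> h" if f: "f \<in> Hom B X Y" and g: "g \<in> Hom B X Y" and h: "h \<in> Hom B X Y"
      and fg: "f \<lesssim>\<^bsub>B\<^esub> g" and gh: "g \<lesssim>\<^bsub>B\<^esub> h" for f g h X Y
    proof -
      obtain i1 j1 where 1: "i1 \<in> Arr C" "j1 \<in> Arr C" "Cod C i1 = Cod C j1" "Dom C i1 = X" "Dom C j1 = Y" "f = K i1 j1"
        using f by (rule cospan_pcb_HomE)
      obtain i2 j2 where 2: "i2 \<in> Arr C" "j2 \<in> Arr C" "Cod C i2 = Cod C j2" "Dom C i2 = X" "Dom C j2 = Y" "g = K i2 j2"
        using g by (rule cospan_pcb_HomE)
      obtain i3 j3 where 3: "i3 \<in> Arr C" "j3 \<in> Arr C" "Cod C i3 = Cod C j3" "Dom C i3 = X" "Dom C j3 = Y" "h = K i3 j3"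
        using h by (rule cospan_pcb_HomE)
      obtain x where x: "x \<in> Arr C" "Dom C x = Cod C i2" "Cod C x = Cod C i1" "i2 \<Zsemi> x = i1" "j2 \<Zsemi> x = j1"
        using fg unfolding 1(6) 2(6) cospan_class_leq[OF 1(1-3) 2(1-3)] by auto
      obtain y where y: "y \<in> Arr C" "Dom C y = Cod C i3" "Cod C y = Cod C i2" "i3 \<Zsemi> y = i2" "j3 \<Zsemi> y = j2"
        using gh unfolding 2(6) 3(6) cospan_class_leq[OF 2(1-3) 3(1-3)] by auto
      have "i3 \<Zsemi> (y \<Zsemi> x) = (i3 \<Zsemi> y) \<Zsemi> x" "j3 \<Zsemi> (y \<Zsemi> x) = (j3 \<Zsemi> y) \<Zsemi> x"
        using 1 2 3 x(1-3) y(1-3) by simp_all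
      then have "i3 \<Zsemi> (y \<Zsemi> x) = i1" "j3 \<Zsemi> (y \<Zsemi> x) = j1"
        unfolding x(4,5) y(4,5) .
      then show ?thesis unfolding 1(6) 3(6) cospan_class_leq[OF 1(1-3) 3(1-3)]
        using x(1-3) y(1-3) 2(3) by (intro exI[of _ "y \<Zsemi> x"]) simp
    qed
  next
    fix X assume X: "X \<in> Obj B"
    then have o: "X \<in> Obj C" by simp
    have "copair C P (initial_arrow C P (bin P (neutral P) X)) (leg2 P (neutral P) X) = ident C (bin P (neutral P) X)"
      by (rule bin_eqI[of _ _ "neutral P" X]) (use o in \<open>auto intro: initial_eq\<close>)
    \<comment> \<open>Comonoid laws mix contravariant operations with structure isomorphisms.
      Rewriting the latter as \<open>costar\<close> of their inverses makes every factor
      contravariant.\<close>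
    then have inv1: "star (copair C P (initial_arrow C P X) (ident C X)) = costar (leg2 P (neutral P) X)"
      using o by (intro star_iso) simp_all
    have "copair C P (leg1 P X (neutral P)) (initial_arrow C P (bin P X (neutral P))) = ident C (bin P X (neutral P))"
      by (rule bin_eqI[of _ _ X "neutral P"]) (use o in \<open>auto intro: initial_eq\<close>)
    then have inv2: "star (copair C P (ident C X) (initial_arrow C P X)) = costar (leg1 P X (neutral P))"
      using o by (intro star_iso) simp_all
    have "star (assoc X X X) = costar (assoc_inv X X X)" "star (sym X X) = costar (sym X X)"
      using o by (intro star_iso; simp)+
    note inv = this inv1 inv2
    have id1: "ident B X = star (ident C X)" using o by (simp add: cospan_structure(1))
    have id: "ident B X = costar (ident C X)" using o by (simp add: cospan_structure(2))
    show "\<mu>\<^bsub>B\<^esub> X \<in> Hom B (X \<oplus>\<^bsub>B\<^esub> X) X" "\<eta>\<^bsub>B\<^esub> X \<in> Hom B (tunit B) X"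
      "\<delta>\<^bsub>B\<^esub> X \<in> Hom B X (X \<oplus>\<^bsub>B\<^esub> X)" "\<epsilon>\<^bsub>B\<^esub> X \<in> Hom B X (tunit B)"
      using o by (simp_all add: Hom_def cospan_structure)
    show "\<mu>\<^bsub>B\<^esub> X \<otimes>\<^bsub>B\<^esub> ident B X \<Zsemi>\<^bsub>B\<^esub> \<mu>\<^bsub>B\<^esub> X =
      associator B X X X \<Zsemi>\<^bsub>B\<^esub> (ident B X \<otimes>\<^bsub>B\<^esub> \<mu>\<^bsub>B\<^esub> X) \<Zsemi>\<^bsub>B\<^esub> \<mu>\<^bsub>B\<^esub> X"
      unfolding id1 using o by (simp add: cospan_structure(3,7)) (simp add: assoc_def)
    show "\<eta>\<^bsub>B\<^esub> X \<otimes>\<^bsub>B\<^esub> ident B X \<Zsemi>\<^bsub>B\<^esub> \<mu>\<^bsub>B\<^esub> X = lunitor B X"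
      "ident B X \<otimes>\<^bsub>B\<^esub> \<eta>\<^bsub>B\<^esub> X \<Zsemi>\<^bsub>B\<^esub> \<mu>\<^bsub>B\<^esub> X = runitor B X"
      "symmetry B X X \<Zsemi>\<^bsub>B\<^esub> \<mu>\<^bsub>B\<^esub> X = \<mu>\<^bsub>B\<^esub> X"
      unfolding id1 using o by (simp_all add: cospan_structure(3-)) (simp_all add: sym_def)
    show "\<delta>\<^bsub>B\<^esub> X \<Zsemi>\<^bsub>B\<^esub> (\<delta>\<^bsub>B\<^esub> X \<otimes>\<^bsub>B\<^esub> ident B X) \<Zsemi>\<^bsub>B\<^esub> associator B X X X =
      \<delta>\<^bsub>B\<^esub> X \<Zsemi>\<^bsub>B\<^esub> (ident B X \<otimes>\<^bsub>B\<^esub> \<delta>\<^bsub>B\<^esub> X)"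
      unfolding id using o by (simp add: cospan_structure(3-) inv) (simp add: assoc_inv_def)
    show "\<delta>\<^bsub>B\<^esub> X \<Zsemi>\<^bsub>B\<^esub> (\<epsilon>\<^bsub>B\<^esub> X \<otimes>\<^bsub>B\<^esub> ident B X) \<Zsemi>\<^bsub>B\<^esub> lunitor B X = ident B X"
      "\<delta>\<^bsub>B\<^esub> X \<Zsemi>\<^bsub>B\<^esub> (ident B X \<otimes>\<^bsub>B\<^esub> \<epsilon>\<^bsub>B\<^esub> X) \<Zsemi>\<^bsub>B\<^esub> runitor B X = ident B X"
      "\<delta>\<^bsub>B\<^esub> X \<Zsemi>\<^bsub>B\<^esub> symmetry B X X = \<delta>\<^bsub>B\<^esub> X"
      unfolding id using o by (simp_all add: cospan_structure(3-) inv) (simp_all add: sym_def)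
    have md: "\<mu>\<^bsub>B\<^esub> X \<Zsemi>\<^bsub>B\<^esub> \<delta>\<^bsub>B\<^esub> X = K (codiag X) (codiag X)"
      using o by (simp add: cospan_structure star_costar)
    have dm: "\<delta>\<^bsub>B\<^esub> X \<Zsemi>\<^bsub>B\<^esub> \<mu>\<^bsub>B\<^esub> X = K (ident C X) (ident C X)"
      using o by (simp add: cospan_structure costar_star[OF is_pushout_codiagonal])
    \<comment> \<open>The same identity must act as a \<open>costar\<close> next to a
      comultiplication and as a \<open>star\<close> next to a multiplication; hence the separate
      equations instead of one simplification rule.\<close>
    have id': "\<delta>\<^bsub>B\<^esub> X \<otimes>\<^bsub>B\<^esub> ident B X = costar (arrow_sum C P (codiag X) (ident C X))"
      "ident B X \<otimes>\<^bsub>B\<^esub> \<delta>\<^bsub>B\<^esub> X = costar (arrow_sum C P (ident C X) (codiag X))"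
      unfolding id using o by (simp_all add: cospan_structure(9))
    have id'': "\<mu>\<^bsub>B\<^esub> X \<otimes>\<^bsub>B\<^esub> ident B X = star (arrow_sum C P (codiag X) (ident C X))"
      "ident B X \<otimes>\<^bsub>B\<^esub> \<mu>\<^bsub>B\<^esub> X = star (arrow_sum C P (ident C X) (codiag X))"
      unfolding id1 using o by (simp_all add: cospan_structure(7))
    show "\<delta>\<^bsub>B\<^esub> X \<otimes>\<^bsub>B\<^esub> ident B X \<Zsemi>\<^bsub>B\<^esub> associator B X X X \<Zsemi>\<^bsub>B\<^esub> (ident B X \<otimes>\<^bsub>B\<^esub> \<mu>\<^bsub>B\<^esub> X) = \<mu>\<^bsub>B\<^esub> X \<Zsemi>\<^bsub>B\<^esub> \<delta>\<^bsub>B\<^esub> X"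
      unfolding id' id'' md using o
      by (simp add: cospan_structure(3) costar_star[OF is_pushout_frobenius(1)])
    have "inverse_of B (associator B X X X) = star (assoc_inv X X X)"
      using o by (intro cospans.inverse_of_eq) (simp add: cospan_structure(3) inverse_arrows_star)
    then show "ident B X \<otimes>\<^bsub>B\<^esub> \<delta>\<^bsub>B\<^esub> X \<Zsemi>\<^bsub>B\<^esub> inverse_of B (associator B X X X) \<Zsemi>\<^bsub>B\<^esub> (\<mu>\<^bsub>B\<^esub> X \<otimes>\<^bsub>B\<^esub> ident B X) = \<mu>\<^bsub>B\<^esub> X \<Zsemi>\<^bsub>B\<^esub> \<delta>\<^bsub>B\<^esub> X"
      unfolding id' id'' md using o
      by (simp add: costar_star[OF is_pushout_frobenius(2)])
    show "\<delta>\<^bsub>B\<^esub> X \<Zsemi>\<^bsub>B\<^esub> \<mu>\<^bsub>B\<^esub> X = ident B X" unfolding dm cospan_pcb_ident ..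
    \<comment> \<open>The inequalities point against arrows of apexes. Their witnesses leave the
      larger side: an identity here, the codiagonal for the next two, and the initial arrow for the
      last.\<close>
    show "ident B X \<lesssim>\<^bsub>B\<^esub> \<delta>\<^bsub>B\<^esub> X \<Zsemi>\<^bsub>B\<^esub> \<mu>\<^bsub>B\<^esub> X"
      unfolding dm cospan_pcb_ident using o
      by (subst cospan_class_leq) (auto intro!: exI[of _ "ident C X"])
    show "\<mu>\<^bsub>B\<^esub> X \<Zsemi>\<^bsub>B\<^esub> \<delta>\<^bsub>B\<^esub> X \<lesssim>\<^bsub>B\<^esub> ident B (X \<oplus>\<^bsub>B\<^esub> X)"
      unfolding md cospan_pcb_ident using o
      by (subst cospan_class_leq) (auto intro!: exI[of _ "codiag X"])
    have "\<epsilon>\<^bsub>B\<^esub> X \<Zsemi>\<^bsub>B\<^esub> \<eta>\<^bsub>B\<^esub> X = K (leg1 P X X) (leg2 P X X)"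
      using o by (simp add: cospan_structure costar_star[OF is_pushout_initial])
    then show "ident B X \<lesssim>\<^bsub>B\<^esub> \<epsilon>\<^bsub>B\<^esub> X \<Zsemi>\<^bsub>B\<^esub> \<eta>\<^bsub>B\<^esub> X"
      unfolding cospan_pcb_ident using o
      by (simp add: cospan_class_leq) (auto intro!: exI[of _ "codiag X"])
    have "\<eta>\<^bsub>B\<^esub> X \<Zsemi>\<^bsub>B\<^esub> \<epsilon>\<^bsub>B\<^esub> X = K (initial_arrow C P X) (initial_arrow C P X)"
      using o by (simp add: cospan_structure star_costar)
    then show "\<eta>\<^bsub>B\<^esub> X \<Zsemi>\<^bsub>B\<^esub> \<epsilon>\<^bsub>B\<^esub> X \<lesssim>\<^bsub>B\<^esub> ident B (tunit B)"
      unfolding cospan_pcb_ident using o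
      by (simp add: cospan_class_leq) (auto intro!: exI[of _ "initial_arrow C P X"])
  qed (fact cospan_seq_mono cospan_tarr_mono cospan_comult_lax cospan_counit_lax)+
qed

end

section \<open>Functors preserving finite colimits\<close>

text \<open>Preservation is stated for initial object, binary coproducts and pushouts: the first two
  match the tensor unit and tensor, the third is what composition of cospans uses. The coproduct
  conditions refer to the canonical comparison arrows since chosen coproducts are not preserved
  strictly.\<close>

locale cocontinuous_functor =
  S: finitely_cocomplete C P + T: finitely_cocomplete D Q
  for C :: "('o, 'a) cat" and P and D :: "('p, 'b) cat" and Q +
  fixes Fo :: "'o \<Rightarrow> 'p" and F :: "'a \<Rightarrow> 'b"
  assumes F_Obj [simp]: "X \<in> Obj C \<Longrightarrow> Fo X \<in> Obj D"
    and F_Hom: "f \<in> Hom C X Y \<Longrightarrow> F f \<in> Hom D (Fo X) (Fo Y)"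
    and F_ident [simp]: "X \<in> Obj C \<Longrightarrow> F (ident C X) = ident D (Fo X)"
    and F_Hom_seq: "f \<in> Hom C X Y \<Longrightarrow> g \<in> Hom C Y Z \<Longrightarrow> F (f \<Zsemi>\<^bsub>C\<^esub> g) = F f \<Zsemi>\<^bsub>D\<^esub> F g"
    and F_initial: "iso_arrow D (initial_arrow D Q (Fo (neutral P)))"
    and F_bin: "X \<in> Obj C \<Longrightarrow> Y \<in> Obj C \<Longrightarrow> iso_arrow D (copair D Q (F (leg1 P X Y)) (F (leg2 P X Y)))"
    and F_pushout: "is_pushout C f g p q \<Longrightarrow> is_pushout D (F f) (F g) (F p) (F q)"
begin

lemma F_arr [simp]:
  assumes "f \<in> Arr C"
  shows "F f \<in> Arr D" "Dom D (F f) = Fo (Dom C f)" "Cod D (F f) = Fo (Cod C f)"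
  using F_Hom[of f "Dom C f" "Cod C f"] assms by (auto simp: Hom_def)

lemma F_seq [simp]:
  "f \<in> Arr C \<Longrightarrow> g \<in> Arr C \<Longrightarrow> Cod C f = Dom C g \<Longrightarrow> F (f \<Zsemi>\<^bsub>C\<^esub> g) = F f \<Zsemi>\<^bsub>D\<^esub> F g"
  using F_Hom_seq[of f "Dom C f" "Cod C f" g "Cod C g"] by (auto simp: Hom_def)

lemma F_iso: "iso_arrow C h \<Longrightarrow> iso_arrow D (F h)"
proof (erule S.iso_arrowE)
  fix g assume g: "h \<in> Arr C" "g \<in> Arr C" "Dom C g = Cod C h" "Cod C g = Dom C h"
    "h \<Zsemi>\<^bsub>C\<^esub> g = ident C (Dom C h)" "g \<Zsemi>\<^bsub>C\<^esub> h = ident C (Cod C h)"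
  have "F h \<Zsemi>\<^bsub>D\<^esub> F g = F (h \<Zsemi>\<^bsub>C\<^esub> g)" "F g \<Zsemi>\<^bsub>D\<^esub> F h = F (g \<Zsemi>\<^bsub>C\<^esub> h)"
    using g(1-4) by simp_all
  then show ?thesis using g by (intro T.iso_arrowI[of "F h" "F g"]) simp_all
qed

text \<open>A map on isomorphism classes without a choice of representative: all representatives
  have images in one class, so the union collapses to that class.\<close>

definition Fcospan where "Fcospan R = \<Union>{T.K (F i) (F j) | i j. (i, j) \<in> R}"
definition sum_comparison where "sum_comparison X Y = copair D Q (F (leg1 P X Y)) (F (leg2 P X Y))"
definition unit_comparison where "unit_comparison = initial_arrow D Q (Fo (neutral P))"

lemma Fcospan_class [simp]:
  assumes "i \<in> Arr C" "j \<in> Arr C" "Cod C i = Cod C j"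
  shows "Fcospan (S.K i j) = T.K (F i) (F j)"
proof -
  have "T.K (F i') (F j') = T.K (F i) (F j)" if ij: "(i', j') \<in> S.K i j" for i' j'
  proof -
    obtain h where h: "iso_arrow C h" "Dom C h = Cod C i" "i' = i \<Zsemi>\<^bsub>C\<^esub> h" "j' = j \<Zsemi>\<^bsub>C\<^esub> h"
      using ij by (rule S.cospan_class_memE)
    have "T.K (F i \<Zsemi>\<^bsub>D\<^esub> F h) (F j \<Zsemi>\<^bsub>D\<^esub> F h) = T.K (F i) (F j)"
      using assms h(1,2) S.iso_Arr[OF h(1)] by (intro T.cospan_class_iso) (simp_all add: F_iso)
    then show ?thesis using h assms S.iso_Arr[OF h(1)] by simp
  qed
  then have "Fcospan (S.K i j) \<subseteq> T.K (F i) (F j)" unfolding Fcospan_def by blast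
  moreover have "T.K (F i) (F j) \<subseteq> Fcospan (S.K i j)"
    unfolding Fcospan_def using S.cospan_class_self[OF assms] by blast
  ultimately show ?thesis by (rule subset_antisym)
qed

lemma Fcospan_star [simp]: "f \<in> Arr C \<Longrightarrow> Fcospan (S.star f) = T.star (F f)"
  and Fcospan_costar [simp]: "f \<in> Arr C \<Longrightarrow> Fcospan (S.costar f) = T.costar (F f)"
  by (simp_all add: S.star_def T.star_def S.costar_def T.costar_def)

lemma comparison_arr [simp]:
  assumes "X \<in> Obj C" "Y \<in> Obj C"
  shows "sum_comparison X Y \<in> Arr D" "Dom D (sum_comparison X Y) = bin Q (Fo X) (Fo Y)"
    "Cod D (sum_comparison X Y) = Fo (bin P X Y)"
  using assms unfolding sum_comparison_def by simp_all

lemma unit_comparison_arr [simp]: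
  "unit_comparison \<in> Arr D" "Dom D unit_comparison = neutral Q" "Cod D unit_comparison = Fo (neutral P)"
  unfolding unit_comparison_def by simp_all

lemma unit_comparison_seq [simp]:
  "h \<in> Arr D \<Longrightarrow> Dom D h = Fo (neutral P) \<Longrightarrow> unit_comparison \<Zsemi>\<^bsub>D\<^esub> h = initial_arrow D Q (Cod D h)"
  unfolding unit_comparison_def by simp

text \<open>The comparison arrow is characterised by its restrictions to the two injections, and so
  is any composite with it. Preservation of multiplication and the coherence laws are instances of
  this computation.\<close>

lemma comparison_copair [simp]:
  assumes "f \<in> Arr C" "g \<in> Arr C" "Cod C f = Cod C g" "X = Dom C f" "Y = Dom C g"
  shows "sum_comparison X Y \<Zsemi>\<^bsub>D\<^esub> F (copair C P f g) = copair D Q (F f) (F g)"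
proof -
  have "F (leg1 P X Y) \<Zsemi>\<^bsub>D\<^esub> F (copair C P f g) = F f" "F (leg2 P X Y) \<Zsemi>\<^bsub>D\<^esub> F (copair C P f g) = F g"
    using assms by (simp_all flip: F_seq)
  then show ?thesis using assms unfolding sum_comparison_def by simp
qed

lemma leg_comparison [simp]:
  assumes "X \<in> Obj C" "Y \<in> Obj C"
  shows "leg1 Q (Fo X) (Fo Y) \<Zsemi>\<^bsub>D\<^esub> sum_comparison X Y = F (leg1 P X Y)"
    "leg2 Q (Fo X) (Fo Y) \<Zsemi>\<^bsub>D\<^esub> sum_comparison X Y = F (leg2 P X Y)"
  using assms unfolding sum_comparison_def by simp_all

lemma leg_comparison_seq [simp]:
  assumes "X \<in> Obj C" "Y \<in> Obj C" "h \<in> Arr D" "Dom D h = Fo (bin P X Y)"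
  shows "leg1 Q (Fo X) (Fo Y) \<Zsemi>\<^bsub>D\<^esub> (sum_comparison X Y \<Zsemi>\<^bsub>D\<^esub> h) = F (leg1 P X Y) \<Zsemi>\<^bsub>D\<^esub> h"
    "leg2 Q (Fo X) (Fo Y) \<Zsemi>\<^bsub>D\<^esub> (sum_comparison X Y \<Zsemi>\<^bsub>D\<^esub> h) = F (leg2 P X Y) \<Zsemi>\<^bsub>D\<^esub> h"
  using assms unfolding sum_comparison_def by simp_all

lemma comparison_natural [simp]:
  assumes "f \<in> Arr C" "g \<in> Arr C" "X = Dom C f" "Y = Dom C g" "X' = Cod C f" "Y' = Cod C g"
  shows "sum_comparison X Y \<Zsemi>\<^bsub>D\<^esub> F (arrow_sum C P f g) = arrow_sum D Q (F f) (F g) \<Zsemi>\<^bsub>D\<^esub> sum_comparison X' Y'"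
  using assms unfolding arrow_sum_def by simp

text \<open>Functoriality is preservation of pushouts, and monotonicity is functoriality of
  \<open>F\<close> on witnesses. Coherence and monoids are computed among \<open>star\<close>
  cospans. Comonoids are contravariant, so there the comparison arrows have to be inverted.\<close>

theorem pcb_morphism_Fcospan:
  "pcb_morphism (cospan_pcb C P) (cospan_pcb D Q) Fo Fcospan
    (\<lambda>X Y. T.star (sum_comparison X Y)) (T.star unit_comparison)"
proof -
  interpret SB: preordered_cartesian_bicategory "cospan_pcb C P" by (rule S.pcb_cospan)
  interpret TB: preordered_cartesian_bicategory "cospan_pcb D Q" by (rule T.pcb_cospan)
  show ?thesis
  proof
    fix X assume "X \<in> Obj S.B"
    then have X: "X \<in> Obj C" by simp
    show "Fo X \<in> Obj T.B" using X by simp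
    show "Fcospan (ident S.B X) = ident T.B (Fo X)"
      using X by (simp add: S.cospan_pcb_ident T.cospan_pcb_ident)
    show "T.star unit_comparison \<otimes>\<^bsub>T.B\<^esub> ident T.B (Fo X) \<Zsemi>\<^bsub>T.B\<^esub> T.star (sum_comparison (tunit S.B) X) \<Zsemi>\<^bsub>T.B\<^esub>
        Fcospan (lunitor S.B X) = lunitor T.B (Fo X)"
      using X by (simp add: S.cospan_structure(4) T.cospan_structure(1,4))
    show "ident T.B (Fo X) \<otimes>\<^bsub>T.B\<^esub> T.star unit_comparison \<Zsemi>\<^bsub>T.B\<^esub> T.star (sum_comparison X (tunit S.B)) \<Zsemi>\<^bsub>T.B\<^esub>
        Fcospan (runitor S.B X) = runitor T.B (Fo X)"
      using X by (simp add: S.cospan_structure(5) T.cospan_structure(1,5))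
    show "T.star (sum_comparison X X) \<Zsemi>\<^bsub>T.B\<^esub> Fcospan (\<mu>\<^bsub>S.B\<^esub> X) = \<mu>\<^bsub>T.B\<^esub> (Fo X)"
      using X by (simp add: S.cospan_structure(7) T.cospan_structure(7))
    show "T.star unit_comparison \<Zsemi>\<^bsub>T.B\<^esub> Fcospan (\<eta>\<^bsub>S.B\<^esub> X) = \<eta>\<^bsub>T.B\<^esub> (Fo X)"
      using X by (simp add: S.cospan_structure(8) T.cospan_structure(8))
    have iso: "iso_arrow D (sum_comparison X X)" using F_bin X unfolding sum_comparison_def by simp
    obtain g where g: "g \<in> Arr D" "Dom D g = Fo (bin P X X)" "Cod D g = bin Q (Fo X) (Fo X)"
        "sum_comparison X X \<Zsemi>\<^bsub>D\<^esub> g = ident D (bin Q (Fo X) (Fo X))"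
        "g \<Zsemi>\<^bsub>D\<^esub> sum_comparison X X = ident D (Fo (bin P X X))"
      using X by (rule_tac T.iso_arrowE[OF iso]) simp
    \<comment> \<open>On the contravariant side the comparison is represented by its inverse
      \<open>g\<close>; what remains is that \<open>g\<close> followed by the codiagonal is the
      image of the codiagonal.\<close>
    have st: "T.star (sum_comparison X X) = T.costar g" using X g by (intro T.star_iso) simp_all
    have "g \<Zsemi>\<^bsub>D\<^esub> T.codiag (Fo X) = g \<Zsemi>\<^bsub>D\<^esub> (sum_comparison X X \<Zsemi>\<^bsub>D\<^esub> F (S.codiag X))"
      using X g by simp
    also have "\<dots> = F (S.codiag X)"
      using X g(1-3) T.seq_cancel_left[OF g(5)] by (simp del: comparison_copair)
    finally have e: "g \<Zsemi>\<^bsub>D\<^esub> T.codiag (Fo X) = F (S.codiag X)" .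
    have "\<delta>\<^bsub>T.B\<^esub> (Fo X) = T.costar (T.codiag (Fo X))" "\<delta>\<^bsub>S.B\<^esub> X = S.costar (S.codiag X)"
      using X by (simp_all add: S.cospan_structure(9) T.cospan_structure(9))
    then show "Fcospan (\<delta>\<^bsub>S.B\<^esub> X) = \<delta>\<^bsub>T.B\<^esub> (Fo X) \<Zsemi>\<^bsub>T.B\<^esub> T.star (sum_comparison X X)"
      unfolding st using X g(1-3) e by simp
    obtain k where k: "k \<in> Arr D" "Dom D k = Fo (neutral P)" "Cod D k = neutral Q"
        "unit_comparison \<Zsemi>\<^bsub>D\<^esub> k = ident D (neutral Q)"
        "k \<Zsemi>\<^bsub>D\<^esub> unit_comparison = ident D (Fo (neutral P))"
      using F_initial[folded unit_comparison_def] by (rule T.iso_arrowE) simp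
    \<comment> \<open>The counit is handled as the comultiplication was, with \<open>k\<close>
      inverting the comparison of initial objects.\<close>
    have stk: "T.star unit_comparison = T.costar k" using k by (intro T.star_iso) simp_all
    have ue: "unit_comparison \<Zsemi>\<^bsub>D\<^esub> F (initial_arrow C P X) = initial_arrow D Q (Fo X)"
      using X by simp
    have "k \<Zsemi>\<^bsub>D\<^esub> initial_arrow D Q (Fo X) = k \<Zsemi>\<^bsub>D\<^esub> (unit_comparison \<Zsemi>\<^bsub>D\<^esub> F (initial_arrow C P X))"
      unfolding ue ..
    also have "\<dots> = F (initial_arrow C P X)"
      using X k(1-3) T.seq_cancel_left[OF k(5)] by (simp del: unit_comparison_seq)
    finally have e: "k \<Zsemi>\<^bsub>D\<^esub> initial_arrow D Q (Fo X) = F (initial_arrow C P X)" .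
    have "\<epsilon>\<^bsub>T.B\<^esub> (Fo X) = T.costar (initial_arrow D Q (Fo X))" "\<epsilon>\<^bsub>S.B\<^esub> X = S.costar (initial_arrow C P X)"
      using X by (simp_all add: S.cospan_structure(10) T.cospan_structure(10))
    then show "Fcospan (\<epsilon>\<^bsub>S.B\<^esub> X) = \<epsilon>\<^bsub>T.B\<^esub> (Fo X) \<Zsemi>\<^bsub>T.B\<^esub> T.star unit_comparison"
      unfolding stk using X k(1-3) e by simp
  next
    fix f X Y assume f: "f \<in> Hom S.B X Y"
    obtain i j where 1: "i \<in> Arr C" "j \<in> Arr C" "Cod C i = Cod C j" "Dom C i = X" "Dom C j = Y" "f = S.K i j"
      using f by (rule S.cospan_pcb_HomE)
    then show "Fcospan f \<in> Hom T.B (Fo X) (Fo Y)" by (simp add: Hom_def)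
  next
    fix f g X Y Z assume f: "f \<in> Hom S.B X Y" and g: "g \<in> Hom S.B Y Z"
    obtain i1 j1 where 1: "i1 \<in> Arr C" "j1 \<in> Arr C" "Cod C i1 = Cod C j1" "Dom C i1 = X" "Dom C j1 = Y" "f = S.K i1 j1"
      using f by (rule S.cospan_pcb_HomE)
    obtain i2 j2 where 2: "i2 \<in> Arr C" "j2 \<in> Arr C" "Cod C i2 = Cod C j2" "Dom C i2 = Y" "Dom C j2 = Z" "g = S.K i2 j2"
      using g by (rule S.cospan_pcb_HomE)
    obtain p q where pq: "is_pushout C j1 i2 p q" using S.pushout_ex[of j1 i2] 1 2 by auto
    note a = S.is_pushoutD(1-8)[OF pq]
    have "Fcospan f \<Zsemi>\<^bsub>T.B\<^esub> Fcospan g = T.K (F i1 \<Zsemi>\<^bsub>D\<^esub> F p) (F j2 \<Zsemi>\<^bsub>D\<^esub> F q)"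
      unfolding 1(6) 2(6) using 1(1-5) 2(1-5)
      by (simp add: T.cospan_class_seq[OF _ _ _ _ _ _ F_pushout[OF pq]])
    moreover have "f \<Zsemi>\<^bsub>S.B\<^esub> g = S.K (i1 \<Zsemi>\<^bsub>C\<^esub> p) (j2 \<Zsemi>\<^bsub>C\<^esub> q)"
      unfolding 1(6) 2(6) by (rule S.cospan_class_seq[OF 1(1-3) 2(1-3) pq])
    ultimately show "Fcospan (f \<Zsemi>\<^bsub>S.B\<^esub> g) = Fcospan f \<Zsemi>\<^bsub>T.B\<^esub> Fcospan g"
      using 1(1-5) 2(1-5) a by simp
  next
    fix X Y assume "X \<in> Obj S.B" "Y \<in> Obj S.B"
    then have o: "X \<in> Obj C" "Y \<in> Obj C" by simp_all
    then show "T.star (sum_comparison X Y) \<in> Hom T.B (Fo X \<oplus>\<^bsub>T.B\<^esub> Fo Y) (Fo (X \<oplus>\<^bsub>S.B\<^esub> Y))"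
      by (simp add: Hom_def)
    show "iso_arrow T.B (T.star (sum_comparison X Y))"
      using o by (intro T.iso_arrow_star) (simp add: sum_comparison_def F_bin)
  next
    fix f g X X' Y Y' assume f: "f \<in> Hom S.B X X'" and g: "g \<in> Hom S.B Y Y'"
    obtain i1 j1 where 1: "i1 \<in> Arr C" "j1 \<in> Arr C" "Cod C i1 = Cod C j1" "Dom C i1 = X" "Dom C j1 = X'" "f = S.K i1 j1"
      using f by (rule S.cospan_pcb_HomE)
    obtain i2 j2 where 2: "i2 \<in> Arr C" "j2 \<in> Arr C" "Cod C i2 = Cod C j2" "Dom C i2 = Y" "Dom C j2 = Y'" "g = S.K i2 j2"
      using g by (rule S.cospan_pcb_HomE)
    have o: "X \<in> Obj C" "Y \<in> Obj C" "X' \<in> Obj C" "Y' \<in> Obj C" "Cod C j1 \<in> Obj C" "Cod C j2 \<in> Obj C"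
      using 1 2 by auto
    have iso: "iso_arrow D (sum_comparison A A')" if "A \<in> Obj C" "A' \<in> Obj C" for A A'
      using that by (simp add: sum_comparison_def F_bin)
    \<comment> \<open>The comparison taken at the two apexes, an isomorphism, commutes with both
      sums of legs, so the general naturality criterion applies.\<close>
    show "Fcospan f \<otimes>\<^bsub>T.B\<^esub> Fcospan g \<Zsemi>\<^bsub>T.B\<^esub> T.star (sum_comparison X' Y') =
        T.star (sum_comparison X Y) \<Zsemi>\<^bsub>T.B\<^esub> Fcospan (f \<otimes>\<^bsub>S.B\<^esub> g)"
      unfolding 1(6) 2(6) using 1(1-5) 2(1-5) o apply simp
      by (rule T.cospan_class_natural[where a = "sum_comparison (Cod C j1) (Cod C j2)"])
        (simp_all add: iso)
  next
    show "T.star unit_comparison \<in> Hom T.B (tunit T.B) (Fo (tunit S.B))" by (simp add: Hom_def)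
    show "iso_arrow T.B (T.star unit_comparison)"
      by (rule T.iso_arrow_star) (simp add: unit_comparison_def F_initial)
  next
    fix X Y Z assume "X \<in> Obj S.B" "Y \<in> Obj S.B" "Z \<in> Obj S.B"
    then have o: "X \<in> Obj C" "Y \<in> Obj C" "Z \<in> Obj C" by simp_all
    have "arrow_sum D Q (sum_comparison X Y) (ident D (Fo Z)) \<Zsemi>\<^bsub>D\<^esub> (sum_comparison (bin P X Y) Z \<Zsemi>\<^bsub>D\<^esub> F (S.assoc X Y Z))
      = T.assoc (Fo X) (Fo Y) (Fo Z) \<Zsemi>\<^bsub>D\<^esub> (arrow_sum D Q (ident D (Fo X)) (sum_comparison Y Z) \<Zsemi>\<^bsub>D\<^esub> sum_comparison X (bin P Y Z))"
      using o by (simp add: S.assoc_def T.assoc_def)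
    then show "T.star (sum_comparison X Y) \<otimes>\<^bsub>T.B\<^esub> ident T.B (Fo Z) \<Zsemi>\<^bsub>T.B\<^esub> T.star (sum_comparison (X \<oplus>\<^bsub>S.B\<^esub> Y) Z) \<Zsemi>\<^bsub>T.B\<^esub>
        Fcospan (associator S.B X Y Z) =
      associator T.B (Fo X) (Fo Y) (Fo Z) \<Zsemi>\<^bsub>T.B\<^esub> (ident T.B (Fo X) \<otimes>\<^bsub>T.B\<^esub> T.star (sum_comparison Y Z)) \<Zsemi>\<^bsub>T.B\<^esub>
        T.star (sum_comparison X (Y \<oplus>\<^bsub>S.B\<^esub> Z))"
      using o by (simp add: S.cospan_structure(3) T.cospan_structure(1,3))
  next
    fix f g X Y assume f: "f \<in> Hom S.B X Y" and g: "g \<in> Hom S.B X Y" and le: "f \<lesssim>\<^bsub>S.B\<^esub> g"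
    obtain i1 j1 where 1: "i1 \<in> Arr C" "j1 \<in> Arr C" "Cod C i1 = Cod C j1" "Dom C i1 = X" "Dom C j1 = Y" "f = S.K i1 j1"
      using f by (rule S.cospan_pcb_HomE)
    obtain i2 j2 where 2: "i2 \<in> Arr C" "j2 \<in> Arr C" "Cod C i2 = Cod C j2" "Dom C i2 = X" "Dom C j2 = Y" "g = S.K i2 j2"
      using g by (rule S.cospan_pcb_HomE)
    obtain h where h: "h \<in> Arr C" "Dom C h = Cod C i2" "Cod C h = Cod C i1" "i2 \<Zsemi>\<^bsub>C\<^esub> h = i1" "j2 \<Zsemi>\<^bsub>C\<^esub> h = j1"
      using le unfolding 1(6) 2(6) S.cospan_class_leq[OF 1(1-3) 2(1-3)] by auto
    have "F i2 \<Zsemi>\<^bsub>D\<^esub> F h = F (i2 \<Zsemi>\<^bsub>C\<^esub> h)" "F j2 \<Zsemi>\<^bsub>D\<^esub> F h = F (j2 \<Zsemi>\<^bsub>C\<^esub> h)"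
      using 2(1-3) h(1-3) by simp_all
    then have e: "F i2 \<Zsemi>\<^bsub>D\<^esub> F h = F i1" "F j2 \<Zsemi>\<^bsub>D\<^esub> F h = F j1" unfolding h(4,5) .
    show "Fcospan f \<lesssim>\<^bsub>T.B\<^esub> Fcospan g"
      unfolding 1(6) 2(6) Fcospan_class[OF 1(1-3)] Fcospan_class[OF 2(1-3)]
    proof (subst T.cospan_class_leq)
      show "\<exists>h. h \<in> Arr D \<and> Dom D h = Cod D (F i2) \<and> Cod D h = Cod D (F i1) \<and> F i2 \<Zsemi>\<^bsub>D\<^esub> h = F i1 \<and> F j2 \<Zsemi>\<^bsub>D\<^esub> h = F j1"
        using e h(1-3) 1(1-3) 2(1-3) by (intro exI[of _ "F h"]) simp
    qed (use 1(1-3) 2(1-3) in simp_all)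
  qed
qed

end

section \<open>Full subcategories\<close>

lemma full_subcat_Obj: "X \<in> Obj (full_subcat C S) \<longleftrightarrow> X \<in> Obj C \<and> X \<in> S"
  and full_subcat_Arr: "f \<in> Arr (full_subcat C S) \<longleftrightarrow> f \<in> Arr C \<and> Dom C f \<in> S \<and> Cod C f \<in> S"
  and full_subcat_Hom: "f \<in> Hom (full_subcat C S) X Y \<longleftrightarrow> f \<in> Hom C X Y \<and> X \<in> S \<and> Y \<in> S"
  by (auto simp: full_subcat_def Hom_def)

lemma full_subcat_fields:
  fixes C :: "('o, 'a, 'z) cat_scheme"
  shows "Dom (full_subcat C S) = Dom C" "Cod (full_subcat C S) = Cod C"
    "ident (full_subcat C S) = ident C" "seq (full_subcat C S) = seq C"
  by (auto simp: full_subcat_def)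

lemma full_subcat_pcb_fields:
  fixes B :: "('o, 'a, 'z) pcb_scheme"
  shows "tunit (full_subcat B S) = tunit B" "tobj (full_subcat B S) = tobj B" "tarr (full_subcat B S) = tarr B"
    "associator (full_subcat B S) = associator B" "lunitor (full_subcat B S) = lunitor B"
    "runitor (full_subcat B S) = runitor B" "symmetry (full_subcat B S) = symmetry B"
    "leq (full_subcat B S) = leq B" "mult (full_subcat B S) = mult B" "unit_of (full_subcat B S) = unit_of B"
    "comult (full_subcat B S) = comult B" "counit (full_subcat B S) = counit B"
  by (auto simp: full_subcat_def)

lemma full_subcat_inverse_arrows:
  "inverse_arrows (full_subcat C S) f g \<longleftrightarrow> inverse_arrows C f g \<and> Dom C f \<in> S \<and> Cod C f \<in> S"
  unfolding inverse_arrows_def full_subcat_Arr full_subcat_Hom full_subcat_fields by auto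

lemma full_subcat_iso_arrow:
  "iso_arrow (full_subcat C S) f \<longleftrightarrow> iso_arrow C f \<and> Dom C f \<in> S \<and> Cod C f \<in> S"
  unfolding iso_arrow_def full_subcat_inverse_arrows by auto

text \<open>The definite description is taken in a different category, but an inverse of an arrow
  between objects of \<open>S\<close> again has both ends in \<open>S\<close>, so the defining
  condition is unchanged.\<close>

lemma full_subcat_inverse_of:
  "f \<in> Hom C X Y \<Longrightarrow> X \<in> S \<Longrightarrow> Y \<in> S \<Longrightarrow> inverse_of (full_subcat C S) f = inverse_of C f"
  unfolding inverse_of_def full_subcat_inverse_arrows by (simp add: Hom_def)

text \<open>Fullness keeps hom-sets, composition and order, so each law is inherited once the
  objects involved stay in \<open>S\<close>; hence only closure under unit and tensor is
  assumed.\<close>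

lemma pcb_full_subcat:
  fixes B :: "('o, 'a, 'z) pcb_scheme"
  assumes "preordered_cartesian_bicategory B"
    and unit: "tunit B \<in> S" and tensor: "\<And>X Y. X \<in> S \<Longrightarrow> Y \<in> S \<Longrightarrow> tobj B X Y \<in> S"
  shows "preordered_cartesian_bicategory (full_subcat B S)"
proof -
  interpret B: preordered_cartesian_bicategory B by fact
  have iso: "iso_arrow (full_subcat B S) f"
    if "iso_arrow B f" "f \<in> Hom B X Y" "X \<in> S" "Y \<in> S" for f X Y
    using that by (simp add: full_subcat_iso_arrow Hom_def)
  have iso_structure:
    "\<lbrakk>X \<in> Obj B; Y \<in> Obj B; Z \<in> Obj B; X \<in> S; Y \<in> S; Z \<in> S\<rbrakk> \<Longrightarrow> iso_arrow (full_subcat B S) (associator B X Y Z)"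
    "\<lbrakk>X \<in> Obj B; X \<in> S\<rbrakk> \<Longrightarrow> iso_arrow (full_subcat B S) (lunitor B X)"
    "\<lbrakk>X \<in> Obj B; X \<in> S\<rbrakk> \<Longrightarrow> iso_arrow (full_subcat B S) (runitor B X)" for X Y Z
    using iso[OF B.associator_iso B.associator_Hom] iso[OF B.lunitor_iso B.lunitor_Hom] iso[OF B.runitor_iso B.runitor_Hom]
      unit tensor by auto
  have inv: "inverse_of (full_subcat B S) (associator B X X X) = inverse_of B (associator B X X X)"
    if "X \<in> Obj B" "X \<in> S" for X
    by (rule full_subcat_inverse_of[OF B.associator_Hom]) (use that tensor in auto)
  \<comment> \<open>The right Frobenius law contains an inverse computed in the ambient category,
    hence it is restated for the subcategory before it can be matched.\<close>
  have fr: "tarr B (ident B X) (comult B X) \<Zsemi>\<^bsub>B\<^esub> inverse_of (full_subcat B S) (associator B X X X) \<Zsemi>\<^bsub>B\<^esub>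
      tarr B (mult B X) (ident B X) = mult B X \<Zsemi>\<^bsub>B\<^esub> comult B X" if "X \<in> Obj B" "X \<in> S" for X
    unfolding inv[OF that] by (rule B.frobenius_right[OF that(1)])
  note axs = B.ident_left B.ident_right B.seq_assoc B.tarr_seq B.tarr_ident B.associator_natural
    B.lunitor_natural B.runitor_natural B.symmetry_natural B.symmetry_involutive B.pentagon
    B.triangle B.hexagon B.leq_refl B.leq_trans B.seq_mono B.tarr_mono B.mult_assoc
    B.mult_unit_left B.mult_unit_right B.mult_comm B.comult_assoc B.comult_counit_left
    B.comult_counit_right B.comult_comm B.frobenius_left fr B.special B.counit_unit
    B.unit_counit B.comult_mult B.mult_comult B.comult_lax B.counit_lax
    iso_structure
    B.ident_Hom B.seq_Hom B.tunit_Obj B.tobj_Obj B.tarr_Hom B.associator_Hom B.lunitor_Hom B.runitor_Hom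
    B.symmetry_Hom B.mult_Hom B.unit_Hom B.comult_Hom B.counit_Hom B.Dom_Obj B.Cod_Obj tensor unit
  show ?thesis
  proof (unfold_locales, unfold full_subcat_fields full_subcat_pcb_fields full_subcat_Hom full_subcat_Obj full_subcat_Arr)
  qed ((elim conjE)?; (intro conjI)?; (assumption | rule unit | rule axs; (assumption | rule unit | rule tensor; (assumption | rule unit | rule tensor; assumption))))+
qed

lemma pcb_morphism_full_subcat:
  fixes B :: "('o, 'a, 'y) pcb_scheme" and C :: "('p, 'b, 'z) pcb_scheme"
  assumes "pcb_morphism B C Fo F \<phi> \<phi>0"
    and unit: "tunit B \<in> S" and tensor: "\<And>X Y. X \<in> S \<Longrightarrow> Y \<in> S \<Longrightarrow> tobj B X Y \<in> S"
  shows "pcb_morphism (full_subcat B S) C Fo F \<phi> \<phi>0"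
proof -
  interpret pcb_morphism B C Fo F \<phi> \<phi>0 by fact
  interpret S: preordered_cartesian_bicategory "full_subcat B S"
    by (rule pcb_full_subcat) (fact B.preordered_cartesian_bicategory_axioms unit tensor)+
  note axs = functor_Obj functor_Hom functor_ident functor_seq tensor_coh_Hom tensor_coh_iso
    tensor_coh_natural unit_coh_Hom unit_coh_iso coh_associator coh_lunitor coh_runitor functor_mono
    functor_mult functor_unit functor_comult functor_counit
  show ?thesis
  proof (unfold_locales, unfold full_subcat_fields full_subcat_pcb_fields full_subcat_Hom full_subcat_Obj full_subcat_Arr)
  qed ((elim conjE)?; (rule axs; assumption))+
qed

section \<open>The opposite of the category of sets\<close>

lemma op_Set_fields [simp]:
  "Obj (op_cat Set_cat) = UNIV" "f \<in> Arr (op_cat Set_cat) \<longleftrightarrow> sfun f \<in> sdom f \<rightarrow>\<^sub>E scod f"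
  "Dom (op_cat Set_cat) = scod" "Cod (op_cat Set_cat) = sdom"
  "ident (op_cat Set_cat) X = \<lparr>sdom = X, sfun = (\<lambda>x\<in>X. x), scod = X\<rparr>"
  "f \<Zsemi>\<^bsub>op_cat Set_cat\<^esub> g = \<lparr>sdom = sdom g, sfun = compose (sdom g) (sfun f) (sfun g), scod = scod f\<rparr>"
  by (simp_all add: op_cat_def Set_cat_def)

text \<open>An arrow from \<open>X\<close> to \<open>Y\<close> is a function from \<open>Y\<close>
  to \<open>X\<close>. Working in the opposite throughout lets the results on cospans apply to spans
  without a dual version.\<close>

lemma op_Set_Hom [simp]:
  "f \<in> Hom (op_cat Set_cat) X Y \<longleftrightarrow> sfun f \<in> Y \<rightarrow>\<^sub>E X \<and> sdom f = Y \<and> scod f = X"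
  by (auto simp: Hom_def)

lemma Set_products_fields [simp]:
  "neutral Set_products = {Star}" "bin Set_products = set_prod"
  "leg1 Set_products X Y = \<lparr>sdom = set_prod X Y, sfun = restrict tup_fst (set_prod X Y), scod = X\<rparr>"
  "leg2 Set_products X Y = \<lparr>sdom = set_prod X Y, sfun = restrict tup_snd (set_prod X Y), scod = Y\<rparr>"
  by (simp_all add: Set_products_def)

text \<open>Functions are extensional outside their domain, so pointwise agreement on it gives
  equality of the records.\<close>

lemma set_map_eqI:
  assumes "f \<in> Hom (op_cat Set_cat) X Y" "g \<in> Hom (op_cat Set_cat) X Y" "\<And>y. y \<in> Y \<Longrightarrow> sfun f y = sfun g y"
  shows "f = g"
proof -
  have "sfun f = sfun g" by (rule extensionalityI[of _ Y]) (use assms in \<open>auto simp: PiE_def\<close>)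
  then show ?thesis using assms by (intro set_map.equality) auto
qed

lemma set_map_appI: "f = g \<Longrightarrow> sfun f y = sfun g y"
  by simp

lemma category_op_Set: "category (op_cat Set_cat)"
proof
  fix f :: "'a set_map" and X Y assume f: "f \<in> Hom (op_cat Set_cat) X Y"
  show "ident (op_cat Set_cat) X \<Zsemi>\<^bsub>op_cat Set_cat\<^esub> f = f" "f \<Zsemi>\<^bsub>op_cat Set_cat\<^esub> ident (op_cat Set_cat) Y = f"
    by (rule set_map_eqI[of _ X Y], use f in \<open>auto simp: compose_def PiE_iff extensional_def\<close>)+
next
  fix f g h :: "'a set_map" and W X Y Z
  assume "f \<in> Hom (op_cat Set_cat) W X" "g \<in> Hom (op_cat Set_cat) X Y" "h \<in> Hom (op_cat Set_cat) Y Z"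
  then show "f \<Zsemi>\<^bsub>op_cat Set_cat\<^esub> g \<Zsemi>\<^bsub>op_cat Set_cat\<^esub> h = f \<Zsemi>\<^bsub>op_cat Set_cat\<^esub> (g \<Zsemi>\<^bsub>op_cat Set_cat\<^esub> h)"
    by (intro set_map_eqI[of _ W Z]) (auto simp: compose_def PiE_iff)
qed (auto simp: compose_def PiE_iff)

text \<open>Colimits in the opposite are limits: the coequalizer below is an equalizer of sets.\<close>

lemma finitely_cocomplete_op_Set: "finitely_cocomplete (op_cat Set_cat) Set_products"
proof -
  interpret category "op_cat Set_cat :: ('a elem set, 'a set_map) cat" by (rule category_op_Set)
  show "finitely_cocomplete (op_cat Set_cat) (Set_products :: ('a elem set, 'a set_map) chosen_bin)"
  proof
    fix X :: "'a elem set"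
    show "\<exists>!f. f \<in> Hom (op_cat Set_cat) (neutral Set_products) X"
    proof (rule ex1I[of _ "\<lparr>sdom = X, sfun = (\<lambda>x\<in>X. Star), scod = {Star}\<rparr>"])
      fix f assume f: "f \<in> Hom (op_cat Set_cat) (neutral Set_products) X"
      show "f = \<lparr>sdom = X, sfun = (\<lambda>x\<in>X. Star), scod = {Star}\<rparr>"
        by (rule set_map_eqI[of _ "{Star}" X]) (use f in \<open>auto simp: PiE_iff\<close>)
    qed auto
  next
    fix f g :: "'a set_map" and X Y Z
    assume f: "f \<in> Hom (op_cat Set_cat) X Z" and g: "g \<in> Hom (op_cat Set_cat) Y Z"
    let ?h = "\<lparr>sdom = Z, sfun = (\<lambda>z\<in>Z. Tup (sfun f z) (sfun g z)), scod = set_prod X Y\<rparr>"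
    show "\<exists>!h. h \<in> Hom (op_cat Set_cat) (bin Set_products X Y) Z \<and>
      leg1 Set_products X Y \<Zsemi>\<^bsub>op_cat Set_cat\<^esub> h = f \<and> leg2 Set_products X Y \<Zsemi>\<^bsub>op_cat Set_cat\<^esub> h = g"
    proof (rule ex1I[of _ ?h], intro conjI)
      show "?h \<in> Hom (op_cat Set_cat) (bin Set_products X Y) Z"
        using f g by (auto simp: set_prod_def PiE_iff)
      show "leg1 Set_products X Y \<Zsemi>\<^bsub>op_cat Set_cat\<^esub> ?h = f" "leg2 Set_products X Y \<Zsemi>\<^bsub>op_cat Set_cat\<^esub> ?h = g"
        by (rule set_map_eqI[of _ X Z] set_map_eqI[of _ Y Z], use f g in \<open>auto simp: compose_def set_prod_def PiE_iff\<close>)+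
    next
      fix h assume h: "h \<in> Hom (op_cat Set_cat) (bin Set_products X Y) Z \<and>
        leg1 Set_products X Y \<Zsemi>\<^bsub>op_cat Set_cat\<^esub> h = f \<and> leg2 Set_products X Y \<Zsemi>\<^bsub>op_cat Set_cat\<^esub> h = g"
      show "h = ?h"
      proof (rule set_map_eqI[of _ "set_prod X Y" Z])
        fix z assume z: "z \<in> Z"
        have "sdom h = Z" "sfun h z \<in> set_prod X Y" using h z by auto
        then obtain a b where ab: "sfun h z = Tup a b" "Tup a b \<in> set_prod X Y"
          by (auto simp: set_prod_def)
        have e: "leg1 Set_products X Y \<Zsemi>\<^bsub>op_cat Set_cat\<^esub> h = f" "leg2 Set_products X Y \<Zsemi>\<^bsub>op_cat Set_cat\<^esub> h = g"
          using h by blast+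
        have "sfun f z = a" "sfun g z = b"
          unfolding e[symmetric] using z ab \<open>sdom h = Z\<close> by (simp_all add: compose_def)
        then show "sfun h z = sfun ?h z" using ab z by simp
      qed (use h f g in \<open>auto simp: set_prod_def PiE_iff\<close>)
    qed
  next
    fix f g :: "'a set_map" and X Y
    assume f: "f \<in> Hom (op_cat Set_cat) X Y" and g: "g \<in> Hom (op_cat Set_cat) X Y"
    let ?E = "{y \<in> Y. sfun f y = sfun g y}"
    let ?q = "\<lparr>sdom = ?E, sfun = (\<lambda>y\<in>?E. y), scod = Y\<rparr>"
    have "\<exists>!k. k \<in> Hom (op_cat Set_cat) (Cod (op_cat Set_cat) ?q) (Cod (op_cat Set_cat) h) \<and> ?q \<Zsemi>\<^bsub>op_cat Set_cat\<^esub> k = h"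
      if h: "h \<in> Arr (op_cat Set_cat)" "Dom (op_cat Set_cat) h = Y" and eq: "f \<Zsemi>\<^bsub>op_cat Set_cat\<^esub> h = g \<Zsemi>\<^bsub>op_cat Set_cat\<^esub> h" for h
    proof -
      have mem: "sfun h z \<in> ?E" if z: "z \<in> sdom h" for z
        using set_map_appI[OF eq, of z] z h f g by (auto simp: compose_def)
      let ?k = "\<lparr>sdom = sdom h, sfun = sfun h, scod = ?E\<rparr>"
      show ?thesis
      proof (rule ex1I[of _ ?k], intro conjI)
        show "?k \<in> Hom (op_cat Set_cat) (Cod (op_cat Set_cat) ?q) (Cod (op_cat Set_cat) h)"
          using mem h by (auto simp: PiE_iff)
        show "?q \<Zsemi>\<^bsub>op_cat Set_cat\<^esub> ?k = h"
          by (rule set_map_eqI[of _ Y "sdom h"]) (use mem h in \<open>auto simp: PiE_iff compose_def\<close>)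
      next
        fix k assume k: "k \<in> Hom (op_cat Set_cat) (Cod (op_cat Set_cat) ?q) (Cod (op_cat Set_cat) h) \<and>
          ?q \<Zsemi>\<^bsub>op_cat Set_cat\<^esub> k = h"
        show "k = ?k"
        proof (rule set_map_eqI[of _ ?E "sdom h"])
          fix z assume z: "z \<in> sdom h"
          have e: "?q \<Zsemi>\<^bsub>op_cat Set_cat\<^esub> k = h" using k by blast
          have "sdom k = sdom h" "sfun k z \<in> ?E" using k z by auto
          then show "sfun k z = sfun ?k z" using set_map_appI[OF e, of z] z by (simp add: compose_def)
        qed (use k mem h in \<open>auto simp: PiE_iff\<close>)
      qed
    qed
    moreover have "f \<Zsemi>\<^bsub>op_cat Set_cat\<^esub> ?q = g \<Zsemi>\<^bsub>op_cat Set_cat\<^esub> ?q"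
      by (rule set_map_eqI[of _ X ?E]) (use f g in \<open>auto simp: compose_def\<close>)
    moreover have "?q \<in> Arr (op_cat Set_cat)" "Dom (op_cat Set_cat) ?q = Y" by auto
    ultimately show "\<exists>q. q \<in> Arr (op_cat Set_cat) \<and> Dom (op_cat Set_cat) q = Y \<and>
      f \<Zsemi>\<^bsub>op_cat Set_cat\<^esub> q = g \<Zsemi>\<^bsub>op_cat Set_cat\<^esub> q \<and>
      (\<forall>h\<in>Arr (op_cat Set_cat). Dom (op_cat Set_cat) h = Y \<longrightarrow> f \<Zsemi>\<^bsub>op_cat Set_cat\<^esub> h = g \<Zsemi>\<^bsub>op_cat Set_cat\<^esub> h \<longrightarrow>
        (\<exists>!k. k \<in> Hom (op_cat Set_cat) (Cod (op_cat Set_cat) q) (Cod (op_cat Set_cat) h) \<and> q \<Zsemi>\<^bsub>op_cat Set_cat\<^esub> k = h))"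
      by (intro exI[of _ ?q] conjI ballI impI) blast+
  qed (auto simp: set_prod_def)
qed

lemma op_Set_isoI:
  assumes f: "f \<in> Arr (op_cat Set_cat)" and b: "bij_betw (sfun f) (sdom f) (scod f)"
  shows "iso_arrow (op_cat Set_cat) f"
proof -
  interpret category "op_cat Set_cat :: ('a elem set, 'a set_map) cat" by (rule category_op_Set)
  let ?g = "\<lparr>sdom = scod f, sfun = (\<lambda>y\<in>scod f. inv_into (sdom f) (sfun f) y), scod = sdom f\<rparr>"
  have s: "sfun f ` sdom f = scod f" and i: "inj_on (sfun f) (sdom f)" using b by (auto simp: bij_betw_def)
  have g: "inv_into (sdom f) (sfun f) y \<in> sdom f" "sfun f (inv_into (sdom f) (sfun f) y) = y" if "y \<in> scod f" for y
    using that s by (metis inv_into_into, metis f_inv_into_f)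
  show ?thesis
  proof (rule iso_arrowI[of f ?g])
    show "f \<Zsemi>\<^bsub>op_cat Set_cat\<^esub> ?g = ident (op_cat Set_cat) (Dom (op_cat Set_cat) f)"
      by (rule set_map_eqI[of _ "scod f" "scod f"]) (use f g in \<open>auto simp: compose_def PiE_iff\<close>)
    show "?g \<Zsemi>\<^bsub>op_cat Set_cat\<^esub> f = ident (op_cat Set_cat) (Cod (op_cat Set_cat) f)"
      by (rule set_map_eqI[of _ "sdom f" "sdom f"]) (use f g i in \<open>auto simp: compose_def PiE_iff\<close>)
  qed (use f g in auto)
qed

section \<open>Finite hypergraphs\<close>

lemma Hyp_fields [simp]:
  "Obj (Hyp \<Sigma>) = {G. finite_hypergraph \<Sigma> G}" "Dom (Hyp \<Sigma>) = hdom" "Cod (Hyp \<Sigma>) = hcod"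
  "ident (Hyp \<Sigma>) G = \<lparr>hdom = G, vmap = (\<lambda>v\<in>verts G. v), emap = (\<lambda>R\<in>syms \<Sigma>. \<lambda>e\<in>edges G R. e), hcod = G\<rparr>"
  "f \<Zsemi>\<^bsub>Hyp \<Sigma>\<^esub> g = \<lparr>hdom = hdom f, vmap = compose (verts (hdom f)) (vmap g) (vmap f),
        emap = (\<lambda>R\<in>syms \<Sigma>. compose (edges (hdom f) R) (emap g R) (emap f R)), hcod = hcod g\<rparr>"
  by (simp_all add: Hyp_def)

section \<open>The category of finite hypergraphs\<close>

lemma Hyp_HomD:
  assumes "f \<in> Hom (Hyp \<Sigma>) X Y"
  shows "hdom f = X" "hcod f = Y" "finite_hypergraph \<Sigma> X" "finite_hypergraph \<Sigma> Y"
    "v \<in> verts X \<Longrightarrow> vmap f v \<in> verts Y"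
    "R \<in> syms \<Sigma> \<Longrightarrow> e \<in> edges X R \<Longrightarrow> emap f R e \<in> edges Y R"
    "R \<in> syms \<Sigma> \<Longrightarrow> e \<in> edges X R \<Longrightarrow> source Y R (emap f R e) = map (vmap f) (source X R e)"
    "R \<in> syms \<Sigma> \<Longrightarrow> e \<in> edges X R \<Longrightarrow> target Y R (emap f R e) = map (vmap f) (target X R e)"
    "vmap f \<in> extensional (verts X)" "emap f \<in> extensional (syms \<Sigma>)"
    "R \<in> syms \<Sigma> \<Longrightarrow> emap f R \<in> extensional (edges X R)"
proof -
  have f: "hypergraph_morphism \<Sigma> f" "hdom f = X" "hcod f = Y" "finite_hypergraph \<Sigma> X" "finite_hypergraph \<Sigma> Y"
    using assms by (auto simp: Hom_def Hyp_def)
  then have v: "vmap f \<in> verts X \<rightarrow>\<^sub>E verts Y" and e: "emap f \<in> (\<Pi>\<^sub>E R \<in> syms \<Sigma>. edges X R \<rightarrow>\<^sub>E edges Y R)"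
    unfolding hypergraph_morphism_def by auto
  have eR: "emap f R \<in> edges X R \<rightarrow>\<^sub>E edges Y R" if "R \<in> syms \<Sigma>" for R using e that by (rule PiE_mem)
  show "hdom f = X" "hcod f = Y" "finite_hypergraph \<Sigma> X" "finite_hypergraph \<Sigma> Y" by fact+
  show "v \<in> verts X \<Longrightarrow> vmap f v \<in> verts Y" using v by (rule PiE_mem)
  show "R \<in> syms \<Sigma> \<Longrightarrow> e \<in> edges X R \<Longrightarrow> emap f R e \<in> edges Y R" using eR by (rule PiE_mem)
  show "R \<in> syms \<Sigma> \<Longrightarrow> e \<in> edges X R \<Longrightarrow> source Y R (emap f R e) = map (vmap f) (source X R e)"
    "R \<in> syms \<Sigma> \<Longrightarrow> e \<in> edges X R \<Longrightarrow> target Y R (emap f R e) = map (vmap f) (target X R e)"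
    using f unfolding hypergraph_morphism_def by auto
  show "vmap f \<in> extensional (verts X)" "emap f \<in> extensional (syms \<Sigma>)" using v e by (auto simp: PiE_def)
  show "R \<in> syms \<Sigma> \<Longrightarrow> emap f R \<in> extensional (edges X R)" using eR[of R] by (auto simp: PiE_def)
qed

lemma hyp_map_eqI:
  assumes f: "f \<in> Hom (Hyp \<Sigma>) X Y" and g: "g \<in> Hom (Hyp \<Sigma>) X Y"
    and v: "\<And>v. v \<in> verts X \<Longrightarrow> vmap f v = vmap g v"
    and e: "\<And>R e. R \<in> syms \<Sigma> \<Longrightarrow> e \<in> edges X R \<Longrightarrow> emap f R e = emap g R e"
  shows "f = g"
proof -
  have "vmap f = vmap g"
    by (rule extensionalityI[OF Hyp_HomD(9)[OF f] Hyp_HomD(9)[OF g] v])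
  moreover have "emap f R = emap g R" if "R \<in> syms \<Sigma>" for R
    by (rule extensionalityI[OF Hyp_HomD(11)[OF f that] Hyp_HomD(11)[OF g that] e[OF that]])
  then have "emap f = emap g"
    by (rule extensionalityI[OF Hyp_HomD(10)[OF f] Hyp_HomD(10)[OF g]])
  ultimately show ?thesis using Hyp_HomD(1,2)[OF f] Hyp_HomD(1,2)[OF g] by (intro hyp_map.equality) auto
qed

text \<open>Restriction makes arbitrary functions extensional, as membership in hom-sets demands.
  Candidate arrows can then be given by formulas that are meaningful only on vertices and
  edges.\<close>

definition mk_hyp_map where
  "mk_hyp_map \<Sigma> X u w Y = \<lparr>hdom = X, vmap = restrict u (verts X),
    emap = (\<lambda>R\<in>syms \<Sigma>. restrict (w R) (edges X R)), hcod = Y\<rparr>"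

lemma mk_hyp_map_app [simp]:
  "v \<in> verts X \<Longrightarrow> vmap (mk_hyp_map \<Sigma> X u w Y) v = u v"
  "R \<in> syms \<Sigma> \<Longrightarrow> e \<in> edges X R \<Longrightarrow> emap (mk_hyp_map \<Sigma> X u w Y) R e = w R e"
  "hdom (mk_hyp_map \<Sigma> X u w Y) = X" "hcod (mk_hyp_map \<Sigma> X u w Y) = Y"
  by (simp_all add: mk_hyp_map_def)

lemma finite_hypergraphD:
  assumes "finite_hypergraph \<Sigma> X" "R \<in> syms \<Sigma>" "e \<in> edges X R"
  shows "length (source X R e) = arity \<Sigma> R" "length (target X R e) = coarity \<Sigma> R"
    "v \<in> set (source X R e) \<Longrightarrow> v \<in> verts X" "v \<in> set (target X R e) \<Longrightarrow> v \<in> verts X"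
  using assms by (auto simp: finite_hypergraph_def)

lemma mk_hyp_map_Hom:
  assumes X: "finite_hypergraph \<Sigma> X" and Y: "finite_hypergraph \<Sigma> Y"
    and "\<And>v. v \<in> verts X \<Longrightarrow> u v \<in> verts Y"
    and "\<And>R e. R \<in> syms \<Sigma> \<Longrightarrow> e \<in> edges X R \<Longrightarrow> w R e \<in> edges Y R"
    and "\<And>R e. R \<in> syms \<Sigma> \<Longrightarrow> e \<in> edges X R \<Longrightarrow> source Y R (w R e) = map u (source X R e)"
    and "\<And>R e. R \<in> syms \<Sigma> \<Longrightarrow> e \<in> edges X R \<Longrightarrow> target Y R (w R e) = map u (target X R e)"
  shows "mk_hyp_map \<Sigma> X u w Y \<in> Hom (Hyp \<Sigma>) X Y"
  using assms finite_hypergraphD(3,4)[OF X]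
  by (auto simp: Hom_def Hyp_def hypergraph_morphism_def mk_hyp_map_def)

text \<open>Pointwise evaluation of composites. Many later proofs remove \<open>Hyp_fields\<close>
  from the simplifier so that composites keep their shape and these rules can fire.\<close>

lemma Hyp_seq_app [simp]:
  "hdom f = X \<Longrightarrow> v \<in> verts X \<Longrightarrow> vmap (f \<Zsemi>\<^bsub>Hyp \<Sigma>\<^esub> g) v = vmap g (vmap f v)"
  "hdom f = X \<Longrightarrow> R \<in> syms \<Sigma> \<Longrightarrow> e \<in> edges X R \<Longrightarrow> emap (f \<Zsemi>\<^bsub>Hyp \<Sigma>\<^esub> g) R e = emap g R (emap f R e)"
  by (simp_all add: compose_def)

lemma Hyp_seq_Hom:
  assumes f: "f \<in> Hom (Hyp \<Sigma>) X Y" and g: "g \<in> Hom (Hyp \<Sigma>) Y Z"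
  shows "f \<Zsemi>\<^bsub>Hyp \<Sigma>\<^esub> g \<in> Hom (Hyp \<Sigma>) X Z"
proof -
  have "f \<Zsemi>\<^bsub>Hyp \<Sigma>\<^esub> g = mk_hyp_map \<Sigma> X (\<lambda>v. vmap g (vmap f v)) (\<lambda>R e. emap g R (emap f R e)) Z"
    using Hyp_HomD(1,2)[OF f] Hyp_HomD(1,2)[OF g] by (auto simp: mk_hyp_map_def compose_def)
  also have "\<dots> \<in> Hom (Hyp \<Sigma>) X Z"
    by (rule mk_hyp_map_Hom) (auto simp: Hyp_HomD[OF f] Hyp_HomD[OF g])
  finally show ?thesis .
qed

lemma Hyp_ident_Hom: "finite_hypergraph \<Sigma> X \<Longrightarrow> ident (Hyp \<Sigma>) X \<in> Hom (Hyp \<Sigma>) X X"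
  using mk_hyp_map_Hom[of \<Sigma> X X "\<lambda>v. v" "\<lambda>R e. e"] by (simp add: mk_hyp_map_def)

lemma category_Hyp: "category (Hyp \<Sigma>)"
proof
  fix f assume "f \<in> Arr (Hyp \<Sigma>)"
  then show "Dom (Hyp \<Sigma>) f \<in> Obj (Hyp \<Sigma>)" "Cod (Hyp \<Sigma>) f \<in> Obj (Hyp \<Sigma>)" by (auto simp: Hyp_def)
next
  fix X assume "X \<in> Obj (Hyp \<Sigma>)"
  then show "ident (Hyp \<Sigma>) X \<in> Hom (Hyp \<Sigma>) X X" using Hyp_ident_Hom by simp
next
  fix f g X Y Z assume "f \<in> Hom (Hyp \<Sigma>) X Y" "g \<in> Hom (Hyp \<Sigma>) Y Z"
  then show "f \<Zsemi>\<^bsub>Hyp \<Sigma>\<^esub> g \<in> Hom (Hyp \<Sigma>) X Z" by (rule Hyp_seq_Hom)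
next
  fix f X Y assume f: "f \<in> Hom (Hyp \<Sigma>) X Y"
  note D = Hyp_HomD[OF f]
  show "ident (Hyp \<Sigma>) X \<Zsemi>\<^bsub>Hyp \<Sigma>\<^esub> f = f"
    by (rule hyp_map_eqI[OF Hyp_seq_Hom[OF Hyp_ident_Hom f] f]) (use D in \<open>auto simp: compose_def\<close>)
  show "f \<Zsemi>\<^bsub>Hyp \<Sigma>\<^esub> ident (Hyp \<Sigma>) Y = f"
    by (rule hyp_map_eqI[OF Hyp_seq_Hom[OF f Hyp_ident_Hom] f]) (use D in \<open>auto simp: compose_def\<close>)
next
  fix f g h W X Y Z
  assume f: "f \<in> Hom (Hyp \<Sigma>) W X" and g: "g \<in> Hom (Hyp \<Sigma>) X Y" and h: "h \<in> Hom (Hyp \<Sigma>) Y Z"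
  show "f \<Zsemi>\<^bsub>Hyp \<Sigma>\<^esub> g \<Zsemi>\<^bsub>Hyp \<Sigma>\<^esub> h = f \<Zsemi>\<^bsub>Hyp \<Sigma>\<^esub> (g \<Zsemi>\<^bsub>Hyp \<Sigma>\<^esub> h)"
    by (rule hyp_map_eqI[OF Hyp_seq_Hom[OF Hyp_seq_Hom[OF f g] h] Hyp_seq_Hom[OF f Hyp_seq_Hom[OF g h]]])
      (auto simp: Hyp_HomD[OF f] Hyp_HomD[OF g] compose_def)
qed

section \<open>Disjoint sums by shifting, and finite ordinals\<close>

lemma less_bound: "finite A \<Longrightarrow> a \<in> A \<Longrightarrow> a < bound A"
proof -
  assume A: "finite A" "a \<in> A"
  have "A \<subseteq> {..<Suc (Max A)}" using A by (auto simp: less_Suc_eq_le)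
  then have "A \<subseteq> {..<bound A}" unfolding bound_def by (rule LeastI)
  then show ?thesis using A by auto
qed

lemma finite_edges:
  assumes "finite_hypergraph \<Sigma> X" "R \<in> syms \<Sigma>"
  shows "finite (edges X R)"
proof -
  have "edges X R \<subseteq> snd ` (SIGMA R : syms \<Sigma>. edges X R)" using assms(2) by force
  then show ?thesis using assms(1) unfolding finite_hypergraph_def by (meson finite_imageI finite_subset)
qed

lemma finite_verts: "finite_hypergraph \<Sigma> X \<Longrightarrow> finite (verts X)"
  by (simp add: finite_hypergraph_def)

lemma hyp_sum_fields [simp]:
  "verts (hyp_sum X Y) = verts X \<union> (+) (bound (verts X)) ` verts Y"
  "edges (hyp_sum X Y) R = edges X R \<union> (+) (bound (edges X R)) ` edges Y R"
  "source (hyp_sum X Y) R (bound (edges X R) + e) = map ((+) (bound (verts X))) (source Y R e)"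
  "target (hyp_sum X Y) R (bound (edges X R) + e) = map ((+) (bound (verts X))) (target Y R e)"
  by (simp_all add: hyp_sum_def)

text \<open>Edges of the first summand lie below the bound because there are finitely many of them,
  so the case distinction in \<open>hyp_sum\<close> takes its first branch.\<close>

lemma hyp_sum_left [simp]:
  assumes "finite_hypergraph \<Sigma> X" "R \<in> syms \<Sigma>" "e \<in> edges X R"
  shows "source (hyp_sum X Y) R e = source X R e" "target (hyp_sum X Y) R e = target X R e"
  using less_bound[OF finite_edges[OF assms(1,2)] assms(3)] by (simp_all add: hyp_sum_def)

lemma finite_hyp_sum:
  assumes X: "finite_hypergraph \<Sigma> X" and Y: "finite_hypergraph \<Sigma> Y"
  shows "finite_hypergraph \<Sigma> (hyp_sum X Y)"
proof -
  have "(SIGMA R : syms \<Sigma>. edges (hyp_sum X Y) R) = (SIGMA R : syms \<Sigma>. edges X R) \<union>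
    (\<lambda>(R, e). (R, bound (edges X R) + e)) ` (SIGMA R : syms \<Sigma>. edges Y R)"
    by force
  then have "finite (SIGMA R : syms \<Sigma>. edges (hyp_sum X Y) R)"
    using X Y unfolding finite_hypergraph_def by simp
  moreover have "finite (verts (hyp_sum X Y))" using X Y by (simp add: finite_hypergraph_def)
  ultimately show ?thesis
    unfolding finite_hypergraph_def
  proof (intro conjI ballI)
    fix R e assume R: "R \<in> syms \<Sigma>" and e: "e \<in> edges (hyp_sum X Y) R"
    show "length (source (hyp_sum X Y) R e) = arity \<Sigma> R" "length (target (hyp_sum X Y) R e) = coarity \<Sigma> R"
      "set (source (hyp_sum X Y) R e) \<subseteq> verts (hyp_sum X Y)" "set (target (hyp_sum X Y) R e) \<subseteq> verts (hyp_sum X Y)"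
      using e finite_hypergraphD[OF X R] finite_hypergraphD[OF Y R] hyp_sum_left[OF X R] by auto
  qed
qed

lemma finite_discrete: "finite_hypergraph \<Sigma> (discrete n)"
  by (simp add: finite_hypergraph_def discrete_def)

text \<open>Vertices and edges of a quotient must again be natural numbers, so classes of the
  equivalence generated by \<open>r\<close> are replaced by selected representatives. Quotients
  become subsets of the original carrier, and finiteness is inherited.\<close>

definition class_rep :: "'b rel \<Rightarrow> 'b \<Rightarrow> 'b" where
  "class_rep r x = (SOME y. (x, y) \<in> (r \<union> r\<inverse>)\<^sup>*)"

lemma class_rep_related: "(x, class_rep r x) \<in> (r \<union> r\<inverse>)\<^sup>*"
  unfolding class_rep_def by (rule someI[of _ x]) simp

text \<open>Related elements are related to the same elements, hence the choice operator is applied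
  to the same predicate and returns the same representative.\<close>

lemma class_rep_eq:
  assumes "(x, y) \<in> (r \<union> r\<inverse>)\<^sup>*"
  shows "class_rep r x = class_rep r y"
proof -
  have "sym ((r \<union> r\<inverse>)\<^sup>*)" by (intro sym_rtrancl) (auto simp: sym_def)
  then have "(x, z) \<in> (r \<union> r\<inverse>)\<^sup>* \<longleftrightarrow> (y, z) \<in> (r \<union> r\<inverse>)\<^sup>*" for z
    using assms by (meson rtrancl_trans symD)
  then show ?thesis unfolding class_rep_def by simp
qed

lemma class_rep_rel: "(x, y) \<in> r \<Longrightarrow> class_rep r x = class_rep r y"
  by (rule class_rep_eq) auto

text \<open>The universal property of the quotient in elementary form: a function that identifies
  the generating pairs is constant along every zigzag, so it can be evaluated at
  representatives.\<close>

lemma class_rep_invariant: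
  assumes "\<And>x y. (x, y) \<in> r \<Longrightarrow> k x = k y"
  shows "k (class_rep r x) = k x"
  using class_rep_related[of x r] by (induction rule: rtrancl_induct) (auto dest: assms)

text \<open>Membership in \<open>A\<close> is itself an invariant function, since both ends of every
  generating pair lie in \<open>A\<close>.\<close>

lemma class_rep_closed:
  assumes "r \<subseteq> A \<times> A" "x \<in> A"
  shows "class_rep r x \<in> A"
  using class_rep_invariant[of r "\<lambda>x. x \<in> A" x] assms by auto

text \<open>Vertices and the edges of each symbol are quotiented separately by the pairs that
  \<open>f\<close> and \<open>g\<close> require to be identified. Compatibility of \<open>f\<close>
  and \<open>g\<close> with sources and targets makes incidence descend to the quotient.\<close>

lemma Hyp_coequalizer:
  assumes f: "f \<in> Hom (Hyp \<Sigma>) X Y" and g: "g \<in> Hom (Hyp \<Sigma>) X Y"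
  obtains q Q where "q \<in> Hom (Hyp \<Sigma>) Y Q" "f \<Zsemi>\<^bsub>Hyp \<Sigma>\<^esub> q = g \<Zsemi>\<^bsub>Hyp \<Sigma>\<^esub> q"
    "\<And>h Z. h \<in> Hom (Hyp \<Sigma>) Y Z \<Longrightarrow> f \<Zsemi>\<^bsub>Hyp \<Sigma>\<^esub> h = g \<Zsemi>\<^bsub>Hyp \<Sigma>\<^esub> h \<Longrightarrow>
      \<exists>!k. k \<in> Hom (Hyp \<Sigma>) Q Z \<and> q \<Zsemi>\<^bsub>Hyp \<Sigma>\<^esub> k = h"
proof -
  note F = Hyp_HomD[OF f] and G = Hyp_HomD[OF g]
  have X: "finite_hypergraph \<Sigma> X" and Y: "finite_hypergraph \<Sigma> Y" using F by auto
  define rv where "rv = (\<lambda>v. (vmap f v, vmap g v)) ` verts X"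
  define re where "re = (\<lambda>R. (\<lambda>e. (emap f R e, emap g R e)) ` edges X R)"
  define u where "u = class_rep rv"
  define w where "w = (\<lambda>R. class_rep (re R))"
  have u_in: "u v \<in> verts Y" if "v \<in> verts Y" for v
    unfolding u_def by (rule class_rep_closed) (use that F G in \<open>auto simp: rv_def\<close>)
  have w_in: "w R e \<in> edges Y R" if "R \<in> syms \<Sigma>" "e \<in> edges Y R" for R e
    unfolding w_def by (rule class_rep_closed) (use that F G in \<open>auto simp: re_def\<close>)
  have u_eq: "u (vmap f v) = u (vmap g v)" if "v \<in> verts X" for v
    unfolding u_def by (rule class_rep_rel) (use that in \<open>auto simp: rv_def\<close>)
  have w_eq: "w R (emap f R e) = w R (emap g R e)" if "e \<in> edges X R" for R e
    unfolding w_def by (rule class_rep_rel) (use that in \<open>auto simp: re_def\<close>)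
  have u_inv: "k (u v) = k v" if "\<And>v. v \<in> verts X \<Longrightarrow> k (vmap f v) = k (vmap g v)" for k :: "nat \<Rightarrow> nat" and v
    unfolding u_def by (rule class_rep_invariant) (use that in \<open>auto simp: rv_def\<close>)
  \<comment> \<open>Representatives of an edge class may have different sources in \<open>Y\<close>,
    but the lists of vertex classes agree: this list is an invariant of the edge relation.\<close>
  have w_src: "map u (source Y R (w R e)) = map u (source Y R e)" "map u (target Y R (w R e)) = map u (target Y R e)"
    if R: "R \<in> syms \<Sigma>" for R e
  proof -
    have "map u (source Y R (emap f R e)) = map u (source Y R (emap g R e))"
      "map u (target Y R (emap f R e)) = map u (target Y R (emap g R e))" if e: "e \<in> edges X R" for e
      using R e F G u_eq finite_hypergraphD(3,4)[OF X R e] by auto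
    note * = this
    show "map u (source Y R (w R e)) = map u (source Y R e)"
      unfolding w_def
      by (rule class_rep_invariant[where k = "\<lambda>e. map u (source Y R e)"]) (use * in \<open>auto simp: re_def\<close>)
    show "map u (target Y R (w R e)) = map u (target Y R e)"
      unfolding w_def
      by (rule class_rep_invariant[where k = "\<lambda>e. map u (target Y R e)"]) (use * in \<open>auto simp: re_def\<close>)
  qed
  \<comment> \<open>Incidence of a class is read off from its representative edge, with endpoints
    replaced by their representatives; the preceding equations make the quotient map a
    morphism.\<close>
  define Q where "Q = \<lparr>verts = u ` verts Y, edges = (\<lambda>R. w R ` edges Y R),
    source = (\<lambda>R e. map u (source Y R e)), target = (\<lambda>R e. map u (target Y R e))\<rparr>"
  have Q_fields: "verts Q = u ` verts Y" "edges Q = (\<lambda>R. w R ` edges Y R)"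
    "source Q = (\<lambda>R e. map u (source Y R e))" "target Q = (\<lambda>R e. map u (target Y R e))"
    by (simp_all add: Q_def)
  have Q: "finite_hypergraph \<Sigma> Q"
  proof -
    have "(SIGMA R : syms \<Sigma>. edges Q R) \<subseteq> (SIGMA R : syms \<Sigma>. edges Y R)"
      using w_in by (auto simp: Q_fields)
    then have "finite (SIGMA R : syms \<Sigma>. edges Q R)"
      using Y unfolding finite_hypergraph_def by (blast intro: finite_subset)
    moreover have "finite (verts Q)" using Y by (simp add: Q_fields finite_hypergraph_def)
    ultimately show ?thesis
      unfolding finite_hypergraph_def using finite_hypergraphD[OF Y _ w_in] by (auto simp: Q_fields)
  qed
  define q where "q = mk_hyp_map \<Sigma> Y u w Q"
  have q: "q \<in> Hom (Hyp \<Sigma>) Y Q"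
    unfolding q_def by (rule mk_hyp_map_Hom) (use Y Q w_src in \<open>auto simp: Q_fields\<close>)
  note qD = Hyp_HomD(1,2)[OF q]
  show ?thesis
  proof (rule that[OF q])
    show "f \<Zsemi>\<^bsub>Hyp \<Sigma>\<^esub> q = g \<Zsemi>\<^bsub>Hyp \<Sigma>\<^esub> q"
      by (rule hyp_map_eqI[OF Hyp_seq_Hom[OF f q] Hyp_seq_Hom[OF g q]])
        (use F G u_eq w_eq in \<open>auto simp: q_def simp del: Hyp_fields\<close>)
  next
    fix h Z assume h: "h \<in> Hom (Hyp \<Sigma>) Y Z" and eq: "f \<Zsemi>\<^bsub>Hyp \<Sigma>\<^esub> h = g \<Zsemi>\<^bsub>Hyp \<Sigma>\<^esub> h"
    note H = Hyp_HomD[OF h]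
    have hv: "vmap h (u v) = vmap h v" for v
    proof (rule u_inv)
      fix v assume "v \<in> verts X"
      then show "vmap h (vmap f v) = vmap h (vmap g v)"
        using arg_cong[OF eq, of "\<lambda>x. vmap x v"] F G by (simp del: Hyp_fields)
    qed
    have he: "emap h R (w R e) = emap h R e" if R: "R \<in> syms \<Sigma>" for R e
      unfolding w_def
    proof (rule class_rep_invariant)
      fix x y assume "(x, y) \<in> re R"
      then obtain e where e: "e \<in> edges X R" "x = emap f R e" "y = emap g R e" by (auto simp: re_def)
      then show "emap h R x = emap h R y"
        using arg_cong[OF eq, of "\<lambda>x. emap x R e"] F G R by (simp del: Hyp_fields)
    qed
    have hu: "vmap h \<circ> u = vmap h" using hv by auto
    have hs: "map (vmap h) (source Y R (w R x)) = map (vmap h) (source Y R x)"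
      "map (vmap h) (target Y R (w R x)) = map (vmap h) (target Y R x)" if "R \<in> syms \<Sigma>" "x \<in> edges Y R" for R x
      using H(7,8)[OF that(1) w_in[OF that]] H(7,8)[OF that] he[OF that(1)] by simp_all
    \<comment> \<open>The mediating morphism is \<open>h\<close> itself restricted to
      representatives, which is correct because \<open>h\<close> is constant on classes.\<close>
    let ?k = "mk_hyp_map \<Sigma> Q (vmap h) (emap h) Z"
    have k: "?k \<in> Hom (Hyp \<Sigma>) Q Z"
      by (rule mk_hyp_map_Hom) (use Q H hv he hu w_in hs in \<open>auto simp: Q_fields\<close>)
    show "\<exists>!k. k \<in> Hom (Hyp \<Sigma>) Q Z \<and> q \<Zsemi>\<^bsub>Hyp \<Sigma>\<^esub> k = h"
    proof (rule ex1I[of _ ?k], intro conjI)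
      show "q \<Zsemi>\<^bsub>Hyp \<Sigma>\<^esub> ?k = h"
        by (rule hyp_map_eqI[OF Hyp_seq_Hom[OF q k] h])
          (use qD hv he in \<open>auto simp: q_def Q_fields simp del: Hyp_fields\<close>)
    next
      fix k assume k': "k \<in> Hom (Hyp \<Sigma>) Q Z \<and> q \<Zsemi>\<^bsub>Hyp \<Sigma>\<^esub> k = h"
      show "k = ?k"
      proof (rule hyp_map_eqI[OF _ k])
        show "k \<in> Hom (Hyp \<Sigma>) Q Z" using k' by simp
        have e: "q \<Zsemi>\<^bsub>Hyp \<Sigma>\<^esub> k = h" using k' by simp
        show "vmap k v = vmap ?k v" if "v \<in> verts Q" for v
        proof -
          from that obtain x where x: "x \<in> verts Y" "v = u x" by (auto simp: Q_fields)
          then show ?thesis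
            using that arg_cong[OF e, of "\<lambda>f. vmap f x"] qD hv by (simp add: q_def del: Hyp_fields)
        qed
        show "emap k R e = emap ?k R e" if "R \<in> syms \<Sigma>" "e \<in> edges Q R" for R e
        proof -
          from that obtain x where x: "x \<in> edges Y R" "e = w R x" by (auto simp: Q_fields)
          then show ?thesis
            using that arg_cong[OF e, of "\<lambda>f. emap f R x"] qD he by (simp add: q_def del: Hyp_fields)
        qed
      qed
    qed (rule k)
  qed
qed

section \<open>Universal property of sums and finite cocompleteness\<close>

lemma Hyp_coproducts_fields [simp]:
  "neutral (Hyp_coproducts \<Sigma>) = discrete 0" "bin (Hyp_coproducts \<Sigma>) = hyp_sum"
  by (simp_all add: Hyp_coproducts_def)

lemma Hyp_legs:
  "leg1 (Hyp_coproducts \<Sigma>) X Y = mk_hyp_map \<Sigma> X (\<lambda>v. v) (\<lambda>R e. e) (hyp_sum X Y)"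
  "leg2 (Hyp_coproducts \<Sigma>) X Y = mk_hyp_map \<Sigma> Y ((+) (bound (verts X))) (\<lambda>R. (+) (bound (edges X R))) (hyp_sum X Y)"
  by (auto simp: Hyp_coproducts_def mk_hyp_map_def)

lemma Hyp_legs_Hom:
  assumes "finite_hypergraph \<Sigma> X" "finite_hypergraph \<Sigma> Y"
  shows "leg1 (Hyp_coproducts \<Sigma>) X Y \<in> Hom (Hyp \<Sigma>) X (hyp_sum X Y)"
    "leg2 (Hyp_coproducts \<Sigma>) X Y \<in> Hom (Hyp \<Sigma>) Y (hyp_sum X Y)"
  unfolding Hyp_legs using assms by (auto intro!: mk_hyp_map_Hom finite_hyp_sum)

lemma Hyp_copair:
  assumes f: "f \<in> Hom (Hyp \<Sigma>) X Z" and g: "g \<in> Hom (Hyp \<Sigma>) Y Z"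
  shows "\<exists>!h. h \<in> Hom (Hyp \<Sigma>) (hyp_sum X Y) Z \<and>
    leg1 (Hyp_coproducts \<Sigma>) X Y \<Zsemi>\<^bsub>Hyp \<Sigma>\<^esub> h = f \<and> leg2 (Hyp_coproducts \<Sigma>) X Y \<Zsemi>\<^bsub>Hyp \<Sigma>\<^esub> h = g"
proof -
  note F = Hyp_HomD[OF f] and G = Hyp_HomD[OF g]
  have X: "finite_hypergraph \<Sigma> X" and Y: "finite_hypergraph \<Sigma> Y" and Z: "finite_hypergraph \<Sigma> Z"
    using F G by auto
  note lv = less_bound[OF finite_verts[OF X]] and le = less_bound[OF finite_edges[OF X]]
  note legs = Hyp_legs_Hom[OF X Y]
  \<comment> \<open>Comparison with the bound decides the summand, and subtraction undoes the shift
    of the second one.\<close>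
  let ?u = "\<lambda>v. if v < bound (verts X) then vmap f v else vmap g (v - bound (verts X))"
  let ?w = "\<lambda>R e. if e < bound (edges X R) then emap f R e else emap g R (e - bound (edges X R))"
  let ?h = "mk_hyp_map \<Sigma> (hyp_sum X Y) ?u ?w Z"
  have h: "?h \<in> Hom (Hyp \<Sigma>) (hyp_sum X Y) Z"
  proof (rule mk_hyp_map_Hom)
    show "?u v \<in> verts Z" if "v \<in> verts (hyp_sum X Y)" for v
      using that F G lv by auto
    fix R e assume R: "R \<in> syms \<Sigma>" and e: "e \<in> edges (hyp_sum X Y) R"
    show "?w R e \<in> edges Z R" using R e F G le by auto
    have "source Z R (?w R e) = map ?u (source (hyp_sum X Y) R e) \<and> target Z R (?w R e) = map ?u (target (hyp_sum X Y) R e)"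
    proof (cases "e \<in> edges X R")
      case True
      then show ?thesis using R F le[OF R True] X lv finite_hypergraphD(3,4)[OF X R True] by auto
    next
      case False
      then obtain x where "x \<in> edges Y R" "e = bound (edges X R) + x" using e by auto
      then show ?thesis using R G by auto
    qed
    then show "source Z R (?w R e) = map ?u (source (hyp_sum X Y) R e)"
      "target Z R (?w R e) = map ?u (target (hyp_sum X Y) R e)" by auto
  qed (use X Y Z finite_hyp_sum in auto)
  show ?thesis
  proof (rule ex1I[of _ ?h], intro conjI)
    show "leg1 (Hyp_coproducts \<Sigma>) X Y \<Zsemi>\<^bsub>Hyp \<Sigma>\<^esub> ?h = f"
      by (rule hyp_map_eqI[OF Hyp_seq_Hom[OF legs(1) h] f])
        (use lv le in \<open>auto simp: Hyp_legs simp del: Hyp_fields\<close>)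
    show "leg2 (Hyp_coproducts \<Sigma>) X Y \<Zsemi>\<^bsub>Hyp \<Sigma>\<^esub> ?h = g"
      by (rule hyp_map_eqI[OF Hyp_seq_Hom[OF legs(2) h] g])
        (auto simp: Hyp_legs simp del: Hyp_fields)
  next
    fix k assume k: "k \<in> Hom (Hyp \<Sigma>) (hyp_sum X Y) Z \<and>
      leg1 (Hyp_coproducts \<Sigma>) X Y \<Zsemi>\<^bsub>Hyp \<Sigma>\<^esub> k = f \<and> leg2 (Hyp_coproducts \<Sigma>) X Y \<Zsemi>\<^bsub>Hyp \<Sigma>\<^esub> k = g"
    have e: "leg1 (Hyp_coproducts \<Sigma>) X Y \<Zsemi>\<^bsub>Hyp \<Sigma>\<^esub> k = f" "leg2 (Hyp_coproducts \<Sigma>) X Y \<Zsemi>\<^bsub>Hyp \<Sigma>\<^esub> k = g"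
      using k by blast+
    have kv: "vmap k v = vmap f v" if "v \<in> verts X" for v
      using arg_cong[OF e(1), of "\<lambda>h. vmap h v"] that by (simp add: Hyp_legs del: Hyp_fields)
    have kv': "vmap k (bound (verts X) + v) = vmap g v" if "v \<in> verts Y" for v
      using arg_cong[OF e(2), of "\<lambda>h. vmap h v"] that by (simp add: Hyp_legs del: Hyp_fields)
    have ke: "emap k R x = emap f R x" if "R \<in> syms \<Sigma>" "x \<in> edges X R" for R x
      using arg_cong[OF e(1), of "\<lambda>h. emap h R x"] that by (simp add: Hyp_legs del: Hyp_fields)
    have ke': "emap k R (bound (edges X R) + x) = emap g R x" if "R \<in> syms \<Sigma>" "x \<in> edges Y R" for R x
      using arg_cong[OF e(2), of "\<lambda>h. emap h R x"] that by (simp add: Hyp_legs del: Hyp_fields)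
    show "k = ?h"
    proof (rule hyp_map_eqI[OF _ h])
      show "k \<in> Hom (Hyp \<Sigma>) (hyp_sum X Y) Z" using k by blast
      show "vmap k v = vmap ?h v" if "v \<in> verts (hyp_sum X Y)" for v
        using that kv kv' lv by auto
      show "emap k R e = emap ?h R e" if "R \<in> syms \<Sigma>" "e \<in> edges (hyp_sum X Y) R" for R e
        using that ke ke' le by auto
    qed
  qed (rule h)
qed

theorem finitely_cocomplete_Hyp: "finitely_cocomplete (Hyp \<Sigma>) (Hyp_coproducts \<Sigma>)"
proof -
  interpret category "Hyp \<Sigma>" by (rule category_Hyp)
  show ?thesis
  proof
    show "neutral (Hyp_coproducts \<Sigma>) \<in> Obj (Hyp \<Sigma>)" by (simp add: finite_discrete)
  next
    fix X assume X: "X \<in> Obj (Hyp \<Sigma>)"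
    let ?h = "mk_hyp_map \<Sigma> (discrete 0) (\<lambda>v. v) (\<lambda>R e. e) X"
    have h: "?h \<in> Hom (Hyp \<Sigma>) (discrete 0) X"
      by (rule mk_hyp_map_Hom[OF finite_discrete]) (use X in \<open>auto simp: discrete_def\<close>)
    show "\<exists>!f. f \<in> Hom (Hyp \<Sigma>) (neutral (Hyp_coproducts \<Sigma>)) X"
      unfolding Hyp_coproducts_fields
    proof (rule ex1I[of _ ?h])
      fix f assume "f \<in> Hom (Hyp \<Sigma>) (discrete 0) X"
      then show "f = ?h" by (rule hyp_map_eqI[OF _ h]) (auto simp: discrete_def)
    qed (rule h)
  next
    fix X Y assume "X \<in> Obj (Hyp \<Sigma>)" "Y \<in> Obj (Hyp \<Sigma>)"
    then show "bin (Hyp_coproducts \<Sigma>) X Y \<in> Obj (Hyp \<Sigma>)"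
      "leg1 (Hyp_coproducts \<Sigma>) X Y \<in> Hom (Hyp \<Sigma>) X (bin (Hyp_coproducts \<Sigma>) X Y)"
      "leg2 (Hyp_coproducts \<Sigma>) X Y \<in> Hom (Hyp \<Sigma>) Y (bin (Hyp_coproducts \<Sigma>) X Y)"
      by (auto simp: finite_hyp_sum Hyp_legs_Hom)
  next
    fix f g X Y Z assume "f \<in> Hom (Hyp \<Sigma>) X Z" "g \<in> Hom (Hyp \<Sigma>) Y Z"
    then show "\<exists>!h. h \<in> Hom (Hyp \<Sigma>) (bin (Hyp_coproducts \<Sigma>) X Y) Z \<and>
      leg1 (Hyp_coproducts \<Sigma>) X Y \<Zsemi>\<^bsub>Hyp \<Sigma>\<^esub> h = f \<and> leg2 (Hyp_coproducts \<Sigma>) X Y \<Zsemi>\<^bsub>Hyp \<Sigma>\<^esub> h = g"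
      unfolding Hyp_coproducts_fields by (rule Hyp_copair)
  next
    fix f g X Y assume f: "f \<in> Hom (Hyp \<Sigma>) X Y" and g: "g \<in> Hom (Hyp \<Sigma>) X Y"
    obtain q Q where q: "q \<in> Hom (Hyp \<Sigma>) Y Q" "f \<Zsemi>\<^bsub>Hyp \<Sigma>\<^esub> q = g \<Zsemi>\<^bsub>Hyp \<Sigma>\<^esub> q"
      "\<And>h Z. h \<in> Hom (Hyp \<Sigma>) Y Z \<Longrightarrow> f \<Zsemi>\<^bsub>Hyp \<Sigma>\<^esub> h = g \<Zsemi>\<^bsub>Hyp \<Sigma>\<^esub> h \<Longrightarrow>
        \<exists>!k. k \<in> Hom (Hyp \<Sigma>) Q Z \<and> q \<Zsemi>\<^bsub>Hyp \<Sigma>\<^esub> k = h"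
      using Hyp_coequalizer[OF f g] by metis
    show "\<exists>q. q \<in> Arr (Hyp \<Sigma>) \<and> Dom (Hyp \<Sigma>) q = Y \<and> f \<Zsemi>\<^bsub>Hyp \<Sigma>\<^esub> q = g \<Zsemi>\<^bsub>Hyp \<Sigma>\<^esub> q \<and>
      (\<forall>h\<in>Arr (Hyp \<Sigma>). Dom (Hyp \<Sigma>) h = Y \<longrightarrow> f \<Zsemi>\<^bsub>Hyp \<Sigma>\<^esub> h = g \<Zsemi>\<^bsub>Hyp \<Sigma>\<^esub> h \<longrightarrow>
        (\<exists>!k. k \<in> Hom (Hyp \<Sigma>) (Cod (Hyp \<Sigma>) q) (Cod (Hyp \<Sigma>) h) \<and> q \<Zsemi>\<^bsub>Hyp \<Sigma>\<^esub> k = h))"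
    proof (intro exI[of _ q] conjI ballI impI)
      show "q \<in> Arr (Hyp \<Sigma>)" "Dom (Hyp \<Sigma>) q = Y" "f \<Zsemi>\<^bsub>Hyp \<Sigma>\<^esub> q = g \<Zsemi>\<^bsub>Hyp \<Sigma>\<^esub> q"
        using q(1,2) by (auto simp: Hom_def simp del: Hyp_fields(5))
      fix h assume "h \<in> Arr (Hyp \<Sigma>)" "Dom (Hyp \<Sigma>) h = Y" and eq: "f \<Zsemi>\<^bsub>Hyp \<Sigma>\<^esub> h = g \<Zsemi>\<^bsub>Hyp \<Sigma>\<^esub> h"
      then have "h \<in> Hom (Hyp \<Sigma>) Y (Cod (Hyp \<Sigma>) h)" by (simp add: Hom_def)
      from q(3)[OF this eq] show "\<exists>!k. k \<in> Hom (Hyp \<Sigma>) (Cod (Hyp \<Sigma>) q) (Cod (Hyp \<Sigma>) h) \<and> q \<Zsemi>\<^bsub>Hyp \<Sigma>\<^esub> k = h"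
        using q(1) by (simp add: Hom_def del: Hyp_fields(5))
    qed
  qed
qed

text \<open>The signature may have infinitely many symbols, so a product over symbols gives no
  finiteness. What is finite is the total set of edges, and a morphism is determined by its values
  on it and on the vertices.\<close>

lemma finite_Hyp_Hom: "finite (Hom (Hyp \<Sigma>) X Y)"
proof (cases "finite_hypergraph \<Sigma> X \<and> finite_hypergraph \<Sigma> Y")
  case True
  let ?E = "SIGMA R : syms \<Sigma>. edges X R" and ?F = "SIGMA R : syms \<Sigma>. edges Y R"
  \<comment> \<open>The edge maps of all symbols are merged into one function on pairs of symbol and
    edge, with values in the finite set of all edge names of \<open>Y\<close>.\<close>
  let ?enc = "\<lambda>f. (vmap f, \<lambda>(R, e)\<in>?E. emap f R e)"
  have fin: "finite (verts X)" "finite (verts Y)" "finite ?E" "finite ?F"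
    using True by (auto simp: finite_hypergraph_def)
  have "?enc ` Hom (Hyp \<Sigma>) X Y \<subseteq> (verts X \<rightarrow>\<^sub>E verts Y) \<times> (?E \<rightarrow>\<^sub>E snd ` ?F)"
  proof
    fix z assume "z \<in> ?enc ` Hom (Hyp \<Sigma>) X Y"
    then obtain f where f: "f \<in> Hom (Hyp \<Sigma>) X Y" "z = ?enc f" by auto
    have "vmap f \<in> verts X \<rightarrow>\<^sub>E verts Y" using Hyp_HomD(5,9)[OF f(1)] by (auto simp: PiE_def)
    moreover have "(\<lambda>(R, e)\<in>?E. emap f R e) \<in> ?E \<rightarrow>\<^sub>E snd ` ?F"
      using Hyp_HomD(6)[OF f(1)] by (force simp: PiE_iff extensional_def)
    ultimately show "z \<in> (verts X \<rightarrow>\<^sub>E verts Y) \<times> (?E \<rightarrow>\<^sub>E snd ` ?F)" using f(2) by simp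
  qed
  moreover have "finite ((verts X \<rightarrow>\<^sub>E verts Y) \<times> (?E \<rightarrow>\<^sub>E snd ` ?F))"
    using fin by (intro finite_cartesian_product finite_PiE) auto
  ultimately have "finite (?enc ` Hom (Hyp \<Sigma>) X Y)" by (rule finite_subset)
  moreover have "inj_on ?enc (Hom (Hyp \<Sigma>) X Y)"
  proof (rule inj_onI)
    fix f g assume f: "f \<in> Hom (Hyp \<Sigma>) X Y" and g: "g \<in> Hom (Hyp \<Sigma>) X Y" and eq: "?enc f = ?enc g"
    have "emap f R e = emap g R e" if "R \<in> syms \<Sigma>" "e \<in> edges X R" for R e
      using fun_cong[of _ _ "(R, e)", OF arg_cong[OF eq, of snd, simplified]] that by simp
    then show "f = g" using eq by (intro hyp_map_eqI[OF f g]) auto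
  qed
  ultimately show ?thesis by (rule finite_imageD)
next
  case False
  then have "Hom (Hyp \<Sigma>) X Y = {}" by (auto simp: Hom_def Hyp_def)
  then show ?thesis by simp
qed

section \<open>Representable functors\<close>

text \<open>Hom-sets into \<open>G\<close> have to become subsets of \<open>'u elem\<close>; the
  injections \<open>enc X\<close> name their elements. Separate encodings for separate
  \<open>X\<close> suffice because elements of different hom-sets are never compared.\<close>

locale representable = finitely_cocomplete C P for C :: "('o, 'a) cat" (structure) and P +
  fixes G :: 'o and enc :: "'o \<Rightarrow> 'a \<Rightarrow> 'u elem"
  assumes G_Obj: "G \<in> Obj C" and enc_inj: "X \<in> Obj C \<Longrightarrow> inj_on (enc X) (Hom C X G)"
begin

definition dec where "dec X = inv_into (Hom C X G) (enc X)"
definition points where "points X = enc X ` Hom C X G"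
text \<open>The action of \<open>Hom(-, G)\<close> on \<open>k\<close> through the encodings. As a
  function it runs from the points of the codomain to those of the domain, so as an arrow of the
  opposite it has the direction of \<open>k\<close>.\<close>

definition precomp where
  "precomp k = \<lparr>sdom = points (Cod C k), sfun = (\<lambda>x\<in>points (Cod C k). enc (Dom C k) (k \<Zsemi> dec (Cod C k) x)),
    scod = points (Dom C k)\<rparr>"

lemma dec_enc [simp]:
  assumes "f \<in> Arr C" "Dom C f = X" "Cod C f = G"
  shows "dec X (enc X f) = f"
proof -
  have "f \<in> Hom C X G" "X \<in> Obj C" using assms by (auto simp: Hom_def)
  then show ?thesis unfolding dec_def using enc_inj by (simp add: inv_into_f_f)
qed

lemma enc_points [simp]: "f \<in> Arr C \<Longrightarrow> Dom C f = X \<Longrightarrow> Cod C f = G \<Longrightarrow> enc X f \<in> points X"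
  by (auto simp: points_def Hom_def)

lemma pointsE:
  assumes "x \<in> points X"
  obtains f where "f \<in> Arr C" "Dom C f = X" "Cod C f = G" "x = enc X f"
  using assms by (auto simp: points_def Hom_def)

lemma dec_arr:
  assumes "x \<in> points X"
  shows "dec X x \<in> Arr C" "Dom C (dec X x) = X" "Cod C (dec X x) = G" "enc X (dec X x) = x"
  using assms by (elim pointsE, simp)+

lemma enc_eqD:
  assumes "enc X f = enc X g" "f \<in> Arr C" "Dom C f = X" "Cod C f = G" "g \<in> Arr C" "Dom C g = X" "Cod C g = G"
  shows "f = g"
  using assms dec_enc by metis

lemma precomp_Hom: "k \<in> Arr C \<Longrightarrow> precomp k \<in> Hom (op_cat Set_cat) (points (Dom C k)) (points (Cod C k))"
  unfolding precomp_def by (auto simp: dec_arr)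

lemma precomp_fields [simp]:
  "sdom (precomp k) = points (Cod C k)" "scod (precomp k) = points (Dom C k)"
  "k \<in> Arr C \<Longrightarrow> Cod C k = X \<Longrightarrow> f \<in> Arr C \<Longrightarrow> Dom C f = X \<Longrightarrow> Cod C f = G \<Longrightarrow>
    sfun (precomp k) (enc X f) = enc (Dom C k) (k \<Zsemi> f)"
  by (auto simp: precomp_def)

lemma precomp_seq:
  assumes "f \<in> Arr C" "g \<in> Arr C" "Cod C f = Dom C g"
  shows "precomp (f \<Zsemi> g) = precomp f \<Zsemi>\<^bsub>op_cat Set_cat\<^esub> precomp g"
proof (rule set_map_eqI[of _ "points (Dom C f)" "points (Cod C g)"])
  show "precomp (f \<Zsemi> g) \<in> Hom (op_cat Set_cat) (points (Dom C f)) (points (Cod C g))"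
    using precomp_Hom[of "f \<Zsemi> g"] assms by simp
  interpret T: category "op_cat Set_cat :: ('u elem set, 'u set_map) cat" by (rule category_op_Set)
  show "precomp f \<Zsemi>\<^bsub>op_cat Set_cat\<^esub> precomp g \<in> Hom (op_cat Set_cat) (points (Dom C f)) (points (Cod C g))"
    using precomp_Hom[of f] precomp_Hom[of g] assms by (intro T.seq_Hom) simp_all
  fix y assume "y \<in> points (Cod C g)"
  then show "sfun (precomp (f \<Zsemi> g)) y = sfun (precomp f \<Zsemi>\<^bsub>op_cat Set_cat\<^esub> precomp g) y"
    using assms by (elim pointsE) (simp add: compose_def)
qed

text \<open>\<open>Hom(-, G)\<close> turns a pushout into a pullback, because a pair of arrows into
  \<open>G\<close> that agree on the common domain is exactly a cocone.\<close>

lemma is_pushout_precomp: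
  assumes po: "is_pushout C f g p q"
  shows "is_pushout (op_cat Set_cat) (precomp f) (precomp g) (precomp p) (precomp q)"
proof -
  interpret T: category "op_cat Set_cat :: ('u elem set, 'u set_map) cat" by (rule category_op_Set)
  note a = is_pushoutD[OF po]
  have arr: "precomp k \<in> Arr (op_cat Set_cat)" if "k \<in> Arr C" for k
    using precomp_Hom[OF that] by simp
  show ?thesis
  proof (rule T.is_pushoutI)
    show "precomp f \<Zsemi>\<^bsub>op_cat Set_cat\<^esub> precomp p = precomp g \<Zsemi>\<^bsub>op_cat Set_cat\<^esub> precomp q"
      using a precomp_seq[of f p] precomp_seq[of g q] by (simp del: op_Set_fields)
  next
    fix p' q' :: "'u set_map"
    assume "p' \<in> Arr (op_cat Set_cat)" "q' \<in> Arr (op_cat Set_cat)" "Dom (op_cat Set_cat) p' = Cod (op_cat Set_cat) (precomp f)"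
      "Dom (op_cat Set_cat) q' = Cod (op_cat Set_cat) (precomp g)" "Cod (op_cat Set_cat) p' = Cod (op_cat Set_cat) q'"
      and eq: "precomp f \<Zsemi>\<^bsub>op_cat Set_cat\<^esub> p' = precomp g \<Zsemi>\<^bsub>op_cat Set_cat\<^esub> q'"
    then have *: "sfun p' \<in> sdom q' \<rightarrow>\<^sub>E points (Cod C f)" "sfun q' \<in> sdom q' \<rightarrow>\<^sub>E points (Cod C g)"
      "scod p' = points (Cod C f)" "scod q' = points (Cod C g)" "sdom p' = sdom q'" by auto
    \<comment> \<open>Each \<open>z\<close> picks a compatible pair of arrows into \<open>G\<close>,
      and the pushout merges it into a single arrow. The function collecting these arrows is the
      mediating map.\<close>
    have "\<exists>u. u \<in> Arr C \<and> Dom C u = Cod C p \<and> Cod C u = G \<and> sfun p' z = enc (Cod C f) (p \<Zsemi> u) \<and> sfun q' z = enc (Cod C g) (q \<Zsemi> u)"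
      if z: "z \<in> sdom q'" for z
    proof -
      have "sfun p' z \<in> points (Cod C f)" "sfun q' z \<in> points (Cod C g)" using * z by auto
      then obtain r s where r: "r \<in> Arr C" "Dom C r = Cod C f" "Cod C r = G" "sfun p' z = enc (Cod C f) r"
        and s: "s \<in> Arr C" "Dom C s = Cod C g" "Cod C s = G" "sfun q' z = enc (Cod C g) s"
        by (elim pointsE) blast
      have "enc (Dom C f) (f \<Zsemi> r) = enc (Dom C f) (g \<Zsemi> s)"
        using set_map_appI[OF eq, of z] z * r s a(1,2,5) by (simp add: compose_def)
      then have "f \<Zsemi> r = g \<Zsemi> s" by (rule enc_eqD) (use r s a in auto)
      then obtain u where "u \<in> Arr C" "Dom C u = Cod C p" "Cod C u = G" "p \<Zsemi> u = r" "q \<Zsemi> u = s"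
        using is_pushout_ex[OF po r(1) s(1)] r s by metis
      then show ?thesis using r s by auto
    qed
    then obtain u where u: "u z \<in> Arr C" "Dom C (u z) = Cod C p" "Cod C (u z) = G"
      "sfun p' z = enc (Cod C f) (p \<Zsemi> u z)" "sfun q' z = enc (Cod C g) (q \<Zsemi> u z)" if "z \<in> sdom q'" for z
      by metis
    let ?h = "\<lparr>sdom = sdom q', sfun = (\<lambda>z\<in>sdom q'. enc (Cod C p) (u z)), scod = points (Cod C p)\<rparr>"
    have "precomp p \<Zsemi>\<^bsub>op_cat Set_cat\<^esub> ?h = p'"
      by (rule set_map_eqI[of _ "points (Cod C f)" "sdom q'"]) (use * u a(1-8) precomp_Hom[of p] in \<open>auto simp: compose_def\<close>)
    moreover have "precomp q \<Zsemi>\<^bsub>op_cat Set_cat\<^esub> ?h = q'"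
      by (rule set_map_eqI[of _ "points (Cod C g)" "sdom q'"]) (use * u a(1-8) precomp_Hom[of q] in \<open>auto simp: compose_def\<close>)
    moreover have "?h \<in> Arr (op_cat Set_cat)" using u by auto
    ultimately show "\<exists>h. h \<in> Arr (op_cat Set_cat) \<and> Dom (op_cat Set_cat) h = Cod (op_cat Set_cat) (precomp p) \<and>
      Cod (op_cat Set_cat) h = Cod (op_cat Set_cat) q' \<and> precomp p \<Zsemi>\<^bsub>op_cat Set_cat\<^esub> h = p' \<and> precomp q \<Zsemi>\<^bsub>op_cat Set_cat\<^esub> h = q'"
      by (intro exI[of _ ?h]) simp
  next
    fix h k :: "'u set_map"
    assume "h \<in> Arr (op_cat Set_cat)" "k \<in> Arr (op_cat Set_cat)" "Dom (op_cat Set_cat) h = Cod (op_cat Set_cat) (precomp p)"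
      "Dom (op_cat Set_cat) k = Cod (op_cat Set_cat) (precomp p)" "Cod (op_cat Set_cat) k = Cod (op_cat Set_cat) h"
      and eq: "precomp p \<Zsemi>\<^bsub>op_cat Set_cat\<^esub> h = precomp p \<Zsemi>\<^bsub>op_cat Set_cat\<^esub> k"
        "precomp q \<Zsemi>\<^bsub>op_cat Set_cat\<^esub> h = precomp q \<Zsemi>\<^bsub>op_cat Set_cat\<^esub> k"
    then have *: "sfun h \<in> sdom h \<rightarrow>\<^sub>E points (Cod C p)" "sfun k \<in> sdom h \<rightarrow>\<^sub>E points (Cod C p)"
      "scod h = points (Cod C p)" "scod k = points (Cod C p)" "sdom k = sdom h" by auto
    show "h = k"
    proof (rule set_map_eqI[of _ "points (Cod C p)" "sdom h"])
      fix z assume z: "z \<in> sdom h"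
      have "sfun h z \<in> points (Cod C p)" "sfun k z \<in> points (Cod C p)" using * z by auto
      then obtain r s where r: "r \<in> Arr C" "Dom C r = Cod C p" "Cod C r = G" "sfun h z = enc (Cod C p) r"
        and s: "s \<in> Arr C" "Dom C s = Cod C p" "Cod C s = G" "sfun k z = enc (Cod C p) s"
        by (elim pointsE) blast
      have "enc (Dom C p) (p \<Zsemi> r) = enc (Dom C p) (p \<Zsemi> s)"
        using set_map_appI[OF eq(1), of z] z * r s a(1-8) by (simp add: compose_def)
      then have 1: "p \<Zsemi> r = p \<Zsemi> s" by (rule enc_eqD) (use r s a in auto)
      have "enc (Dom C q) (q \<Zsemi> r) = enc (Dom C q) (q \<Zsemi> s)"
        using set_map_appI[OF eq(2), of z] z * r s a(1-8) by (simp add: compose_def)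
      then have 2: "q \<Zsemi> r = q \<Zsemi> s" by (rule enc_eqD) (use r s a in auto)
      have "r = s" by (rule is_pushout_eq[OF po]) (use r s 1 2 in auto)
      then show "sfun h z = sfun k z" using r s by simp
    qed (use * in auto)
  qed (use a arr[OF a(1)] arr[OF a(2)] arr[OF a(3)] arr[OF a(4)] in simp_all)
qed

theorem cocontinuous_precomp:
  "cocontinuous_functor C P (op_cat Set_cat) (Set_products :: ('u elem set, 'u set_map) chosen_bin) points precomp"
proof -
  interpret T: finitely_cocomplete "op_cat Set_cat" "Set_products :: ('u elem set, 'u set_map) chosen_bin"
    by (rule finitely_cocomplete_op_Set)
  show ?thesis
  proof
    fix X show "points X \<in> Obj (op_cat Set_cat)" by simp
  next
    fix f X Y assume "f \<in> Hom C X Y"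
    then show "precomp f \<in> Hom (op_cat Set_cat) (points X) (points Y)"
      using precomp_Hom[of f] by (auto simp: Hom_def)
  next
    fix X assume "X \<in> Obj C"
    then show "precomp (ident C X) = ident (op_cat Set_cat) (points X)"
      using precomp_Hom[of "ident C X"]
      by (intro set_map_eqI[of _ "points X" "points X"]) (simp_all, elim pointsE, simp)
  next
    fix f g X Y Z assume "f \<in> Hom C X Y" "g \<in> Hom C Y Z"
    then show "precomp (f \<Zsemi> g) = precomp f \<Zsemi>\<^bsub>op_cat Set_cat\<^esub> precomp g"
      by (intro precomp_seq) (auto simp: Hom_def)
  next
    let ?i = "initial_arrow (op_cat Set_cat) Set_products (points (neutral P))"
    have i: "?i \<in> Hom (op_cat Set_cat) {Star} (points (neutral P))"
      using T.initial_arr[of "points (neutral P)"] by simp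
    \<comment> \<open>There is exactly one arrow from the initial object to \<open>G\<close>, so its
      image is a singleton, terminal like \<open>{Star}\<close>.\<close>
    have pt: "points (neutral P) = {enc (neutral P) (initial_arrow C P G)}"
    proof -
      have "x = enc (neutral P) (initial_arrow C P G)" if "x \<in> points (neutral P)" for x
        using that G_Obj by (elim pointsE) (auto intro!: arg_cong[of _ _ "enc (neutral P)"] initial_eq)
      then show ?thesis using G_Obj by auto
    qed
    show "iso_arrow (op_cat Set_cat) ?i"
      by (rule op_Set_isoI) (use i in \<open>auto simp: pt bij_betw_def\<close>)
  next
    fix X Y assume o: "X \<in> Obj C" "Y \<in> Obj C"
    let ?c = "copair (op_cat Set_cat) Set_products (precomp (leg1 P X Y)) (precomp (leg2 P X Y))"
    let ?l = "precomp (leg1 P X Y)" and ?r = "precomp (leg2 P X Y)"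
    have arr: "?l \<in> Arr (op_cat Set_cat)" "?r \<in> Arr (op_cat Set_cat)"
      "Cod (op_cat Set_cat) ?l = Cod (op_cat Set_cat) ?r" "Dom (op_cat Set_cat) ?l = points X" "Dom (op_cat Set_cat) ?r = points Y"
      using precomp_Hom[of "leg1 P X Y"] precomp_Hom[of "leg2 P X Y"] o by simp_all
    have c: "sfun ?c \<in> points (bin P X Y) \<rightarrow>\<^sub>E set_prod (points X) (points Y)" "sdom ?c = points (bin P X Y)"
      "scod ?c = set_prod (points X) (points Y)"
      using T.copair_arr[OF arr(1-3)] o by simp_all
    \<comment> \<open>The comparison sends an arrow out of a coproduct to the pair of its
      restrictions. Injectivity is then uniqueness of copairs and surjectivity their
      existence.\<close>
    have "sfun ?c (enc (bin P X Y) f) = Tup (enc X (leg1 P X Y \<Zsemi> f)) (enc Y (leg2 P X Y \<Zsemi> f))"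
      if f: "f \<in> Arr C" "Dom C f = bin P X Y" "Cod C f = G" for f
    proof -
      have "sfun ?c (enc (bin P X Y) f) \<in> set_prod (points X) (points Y)"
        using c(1) f by (auto simp: PiE_iff)
      then obtain a b where ab: "sfun ?c (enc (bin P X Y) f) = Tup a b" "Tup a b \<in> set_prod (points X) (points Y)"
        by (auto simp: set_prod_def)
      show ?thesis
        using set_map_appI[OF T.leg_copair(1)[OF arr], of "enc (bin P X Y) f"]
          set_map_appI[OF T.leg_copair(2)[OF arr], of "enc (bin P X Y) f"] f o c(2) ab
        by (simp add: compose_def)
    qed
    note val = this
    have "inj_on (sfun ?c) (points (bin P X Y))"
    proof (rule inj_onI, elim pointsE)
      fix x y f g assume fg: "sfun ?c x = sfun ?c y" "f \<in> Arr C" "Dom C f = bin P X Y" "Cod C f = G" "x = enc (bin P X Y) f"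
        "g \<in> Arr C" "Dom C g = bin P X Y" "Cod C g = G" "y = enc (bin P X Y) g"
      then have "enc X (leg1 P X Y \<Zsemi> f) = enc X (leg1 P X Y \<Zsemi> g)" "enc Y (leg2 P X Y \<Zsemi> f) = enc Y (leg2 P X Y \<Zsemi> g)"
        using val[of f] val[of g] by simp_all
      then have e: "leg1 P X Y \<Zsemi> f = leg1 P X Y \<Zsemi> g" "leg2 P X Y \<Zsemi> f = leg2 P X Y \<Zsemi> g"
        using fg o by (auto dest!: enc_eqD)
      have "f = g" by (rule bin_eqI[of _ _ X Y]) (use fg o e in simp_all)
      then show "x = y" using fg by simp
    qed
    moreover have "sfun ?c ` points (bin P X Y) = set_prod (points X) (points Y)"
    proof
      show "sfun ?c ` points (bin P X Y) \<subseteq> set_prod (points X) (points Y)" using c by auto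
      show "set_prod (points X) (points Y) \<subseteq> sfun ?c ` points (bin P X Y)"
      proof
        fix z assume "z \<in> set_prod (points X) (points Y)"
        then obtain f g where fg: "z = Tup (enc X f) (enc Y g)" "f \<in> Arr C" "Dom C f = X" "Cod C f = G"
          "g \<in> Arr C" "Dom C g = Y" "Cod C g = G"
          unfolding set_prod_def by (elim CollectE exE conjE pointsE) blast
        have "z = sfun ?c (enc (bin P X Y) (copair C P f g))" using fg o by (simp add: val)
        moreover have "enc (bin P X Y) (copair C P f g) \<in> points (bin P X Y)" using fg by simp
        ultimately show "z \<in> sfun ?c ` points (bin P X Y)" by (rule image_eqI)
      qed
    qed
    ultimately show "iso_arrow (op_cat Set_cat) ?c"
      by (intro op_Set_isoI) (use c in \<open>auto simp: bij_betw_def\<close>)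
  next
    fix f g p q assume "is_pushout C f g p q"
    then show "is_pushout (op_cat Set_cat) (precomp f) (precomp g) (precomp p) (precomp q)"
      by (rule is_pushout_precomp)
  qed
qed

sublocale precomp: cocontinuous_functor C P "op_cat Set_cat" "Set_products :: ('u elem set, 'u set_map) chosen_bin" points precomp
  by (rule cocontinuous_precomp)

text \<open>As in the Yoneda lemma, the inequality is read off from the image of the identity of \<open>G\<close>.\<close>

lemma leq_if_Fcospan_leq:
  assumes "i \<in> Arr C" "j \<in> Arr C" "Cod C i = G" "Cod C j = G" "i' \<in> Arr C" "j' \<in> Arr C" "Cod C i' = Cod C j'"
    and dom: "Dom C i' = Dom C i" "Dom C j' = Dom C j"
    and le: "precomp.Fcospan (K i j) \<lesssim>\<^bsub>Span_Set\<^esub> precomp.Fcospan (K i' j')"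
  shows "K i j \<lesssim>\<^bsub>B\<^esub> K i' j'"
proof -
  have "precomp.T.K (precomp i) (precomp j) \<lesssim>\<^bsub>precomp.T.B\<^esub> precomp.T.K (precomp i') (precomp j')"
    using le assms(1-7) unfolding Span_Set_def span_pcb_def by simp
  \<comment> \<open>The reversed order of cospans and the opposite of sets cancel: as a function,
    \<open>h\<close> goes from the points of \<open>G\<close> to those of the other apex.\<close>
  then obtain h where h: "sfun h \<in> points G \<rightarrow>\<^sub>E points (Cod C j')"
      and hs: "sdom h = points G"
      and e: "precomp i' \<Zsemi>\<^bsub>op_cat Set_cat\<^esub> h = precomp i" "precomp j' \<Zsemi>\<^bsub>op_cat Set_cat\<^esub> h = precomp j"
    using precomp_Hom[of i] precomp_Hom[of j] precomp_Hom[of i'] precomp_Hom[of j'] assms(1-7)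
    by (subst (asm) precomp.T.cospan_class_leq) (auto simp del: op_Set_fields(6))
  have G: "enc G (ident C G) \<in> points G" using G_Obj by simp
  then have "sfun h (enc G (ident C G)) \<in> points (Cod C j')" using h by auto
  then obtain k where k: "k \<in> Arr C" "Dom C k = Cod C j'" "Cod C k = G" "sfun h (enc G (ident C G)) = enc (Cod C j') k"
    by (rule pointsE)
  \<comment> \<open>At the encoded identity \<open>precomp i\<close> returns the code of
    \<open>i\<close>, while \<open>h\<close> followed by \<open>precomp i'\<close> returns the code
    of \<open>i' \<Zsemi> k\<close>. The cospans have common feet, so the two codes use the same
    injective encoding.\<close>
  have "enc (Dom C i) (i' \<Zsemi> k) = enc (Dom C i) i" "enc (Dom C j) (j' \<Zsemi> k) = enc (Dom C j) j"
    using set_map_appI[OF e(1), of "enc G (ident C G)"] set_map_appI[OF e(2), of "enc G (ident C G)"] G hs k assms(1-7) dom G_Obj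
    by (simp_all add: compose_def)
  then have "i' \<Zsemi> k = i" "j' \<Zsemi> k = j"
    by (auto elim!: enc_eqD simp: assms(1-7) dom k)
  then show ?thesis using assms(1-7) k by (subst cospan_class_leq) auto
qed

end

section \<open>The theorem\<close>

text \<open>A copy of the natural numbers free of \<open>Atom\<close>: it does not depend on how
  many elements \<open>'u\<close> has.\<close>

primrec elem_of_nat :: "nat \<Rightarrow> 'u elem" where
  "elem_of_nat 0 = Star"
| "elem_of_nat (Suc n) = Tup Star (elem_of_nat n)"

lemma inj_elem_of_nat: "inj elem_of_nat"
proof (rule injI)
  show "m = n" if "elem_of_nat m = (elem_of_nat n :: 'u elem)" for m n
    using that by (induction m arbitrary: n) (case_tac n; simp)+
qed

lemma finite_inj_elem:
  assumes "finite A"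
  shows "\<exists>f :: 'b \<Rightarrow> 'u elem. inj_on f A"
proof -
  obtain g :: "'b \<Rightarrow> nat" where "inj_on g A"
    using finite_imp_inj_to_nat_seg[OF assms] by blast
  then have "inj_on (elem_of_nat \<circ> g :: 'b \<Rightarrow> 'u elem) A"
    by (rule comp_inj_on) (rule inj_on_subset[OF inj_elem_of_nat subset_UNIV])
  then show ?thesis by blast
qed

text \<open>The bound of \<open>{..<n}\<close> is exactly \<open>n\<close>, so the shifted second
  summand continues the first without a gap. Equality, rather than isomorphism, is what closes the
  set of finite ordinals under the tensor.\<close>

lemma hyp_sum_discrete: "hyp_sum (discrete n) (discrete m) = discrete (n + m)"
proof -
  have bound: "bound {..<n} = n" "bound {} = 0"
    unfolding bound_def by (rule Least_equality; auto simp: lessThan_subset_iff)+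
  have "{..<n} \<union> (+) n ` {..<m} = {..<n + m}"
    unfolding lessThan_atLeast0 image_add_atLeastLessThan by (simp add: ivl_disj_un add.commute)
  then show ?thesis by (simp add: hyp_sum_def discrete_def bound)
qed

theorem mainTheorem3:
  fixes \<Sigma> :: "'s signature"
    and n m :: nat
    and G G' :: "'s hypergraph"
    and \<iota> \<omega> \<iota>' \<omega>' :: "'s hyp_map"
  assumes "\<iota> \<in> Hom (Hyp \<Sigma>) (discrete n) G" and "\<omega> \<in> Hom (Hyp \<Sigma>) (discrete m) G"
    and "\<iota>' \<in> Hom (Hyp \<Sigma>) (discrete n) G'" and "\<omega>' \<in> Hom (Hyp \<Sigma>) (discrete m) G'"
    and "\<And>Mo M \<phi> \<phi>0.
      pcb_morphism (DiscCospan_Hyp \<Sigma>)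
        (Span_Set :: ('u elem set, ('u set_map \<times> 'u set_map) set) pcb) Mo M \<phi> \<phi>0 \<Longrightarrow>
      M (cospan_class (Hyp \<Sigma>) \<iota> \<omega>) \<lesssim>\<^bsub>Span_Set\<^esub> M (cospan_class (Hyp \<Sigma>) \<iota>' \<omega>')"
  shows "cospan_class (Hyp \<Sigma>) \<iota> \<omega> \<lesssim>\<^bsub>DiscCospan_Hyp \<Sigma>\<^esub> cospan_class (Hyp \<Sigma>) \<iota>' \<omega>'"
proof -
  interpret finitely_cocomplete "Hyp \<Sigma>" "Hyp_coproducts \<Sigma>" by (rule finitely_cocomplete_Hyp)
  have "\<exists>e :: 's hyp_map \<Rightarrow> 'u elem. inj_on e (Hom (Hyp \<Sigma>) X G)" for X
    by (rule finite_inj_elem[OF finite_Hyp_Hom])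
  then obtain enc :: "'s hypergraph \<Rightarrow> 's hyp_map \<Rightarrow> 'u elem" where enc: "inj_on (enc X) (Hom (Hyp \<Sigma>) X G)" for X
    by metis
  \<comment> \<open>The representing object is the apex of the cospan to be shown smaller, because a
    witness has to be an arrow into it.\<close>
  interpret R: representable "Hyp \<Sigma>" "Hyp_coproducts \<Sigma>" G enc
    by unfold_locales (use HomD[OF assms(1)] enc in \<open>simp_all del: Hyp_fields\<close>)
  \<comment> \<open>The morphism exists on all cospans of finite hypergraphs and is restricted here
    to those with finite ordinals as feet.\<close>
  have "pcb_morphism (DiscCospan_Hyp \<Sigma>) (Span_Set :: ('u elem set, ('u set_map \<times> 'u set_map) set) pcb)
      R.points R.precomp.Fcospan
      (\<lambda>X Y. R.precomp.T.star (R.precomp.sum_comparison X Y)) (R.precomp.T.star R.precomp.unit_comparison)"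
    unfolding DiscCospan_Hyp_def Span_Set_def span_pcb_def
    by (rule pcb_morphism_full_subcat[OF R.precomp.pcb_morphism_Fcospan]) (auto simp: hyp_sum_discrete)
  then have "R.precomp.Fcospan (K \<iota> \<omega>) \<lesssim>\<^bsub>Span_Set\<^esub> R.precomp.Fcospan (K \<iota>' \<omega>')"
    by (rule assms(5))
  then have "K \<iota> \<omega> \<lesssim>\<^bsub>B\<^esub> K \<iota>' \<omega>'"
    by (rule R.leq_if_Fcospan_leq[rotated 9])
      (use HomD[OF assms(1)] HomD[OF assms(2)] HomD[OF assms(3)] HomD[OF assms(4)] in \<open>simp_all del: Hyp_fields\<close>)
  then show ?thesis unfolding DiscCospan_Hyp_def full_subcat_pcb_fields .
qed

end
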